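(* Consider the system $$\dot z=q(z,x,d),\qquad \dot x=f(z,x,d)+bu,\quad b>0,$$ with $z\in\mathbb{R}^p$, $x\in\mathbb{R}$, $u\in\mathbb{R}$, $d\in\mathbb{D}$, and the controller with dynamic gain $$u(t)=\kappa(x(t_k),\hat\theta(t_k)),\quad t\in[t_k,t_{k+1}),\ k\in\mathbb{N},\qquad \dot{\hat\theta}=\lambda\rho(x)x^2,\quad\lambda>0,$$ where $\kappa(x,\hat\theta)=-\hat\theta\rho(x)x$. Suppose that: (1) $b\le\bar b$ for some known constant $\bar b$ (while $b$ itself is unknown); (2) the $z$-subsystem has an ISS-Lyapunov function $V(z)\sim\{\underline{\alpha},\bar\alpha,\alpha,\hat\sigma\mid\dot z=q(z,x,d)\}$ with $\limsup_{s\to0^+}s^2/\alpha(s)<\infty$ and $\limsup_{s\to0^+}\hat\sigma(s)/s^2<\infty$, where $\underline{\alpha},\bar\alpha,\alpha$ are known and $\hat\sigma$ is known up to a constant factor, i.e. $\hat\sigma=\bar p\,\sigma$ for an unknown constant $\bar p$ and a known function $\sigma$. Then there exist smooth positive functions $\rho:\mathbb{R}\to\mathbb{R}_{>0}$ and $\bar\gamma:\mathbb{R}\times\mathbb{R}\times\mathbb{R}\to\mathbb{R}_{>0}$ such that, if the event-triggered law is designed as $$t_{k+1}=\inf_{t\ge t_k}\Big\{2(t-t_k)\max_{\tau\in[t_k,t]}\big\{\bar\gamma(x(\tau),\hat\theta(\tau),\varpi(\tau))\,\varpi^2(\tau)\big\}\ge\tfrac12\|\varpi_{[t_k,t]}\|^2,\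 \text{ and }\ \|\varpi_{[t_k,t]}\|\ne0\Big\},$$ then the equilibrium point $(z,x)=0$ of the system is globally asymptotically stable and Zeno behavior is avoided.
   Context: The uncertainty $d$ takes values in a compact set $\mathbb{D}\subset\mathbb{R}^l$ whose size is unknown. The functions $q$ and $f$ are sufficiently smooth with $q(0,0,d)=0$ and $f(0,0,d)=0$ for all $d\in\mathbb{D}$. The state $z$ is not available for feedback. There are an unknown positive number $c$, depending on the size of $\mathbb{D}$, and two known positive sufficiently smooth functions $m_1,m_2$ such that $|f(z,x,d)|\le c\,m_1(z)\|z\|+c\,m_2(x)|x|$ for all $d\in\mathbb{D}$. Quantities called "unknown" ($b$, $\bar p$, $c$, the size of $\mathbb{D}$) may not be used in the design: $\rho$ and $\bar\gamma$ may depend only on known data ($\bar b,\lambda,\underline{\alpha},\bar\alpha,\alpha,\sigma,m_1,m_2$). The sampling error is $\varpi(t)=\kappa(x(t_k),\hat\theta(t_k))-\kappa(x(t),\hat\theta(t))$ for $t\in[t_k,t_{k+1})$, so that $\dot x=f(z,x,d)-b\hat\theta\rho(x)x+b\varpi$, with $\varpi$ reset to $0$ at each sampling instant. On an interval $[t_k,t]$ in the sampling law, $\varpi$ denotes the error relative to the sample at $t_k$ (so it starts from $0$ at $t_k$ and evolves continuously); the infimum is over those $t$ for which the condition in braces holds ($+\infty$ if none). $\|\varpi_{[a,b]}\|=\sup_{t\in[a,b]}|\varpi(t)|$, and $\mathbb{N}$ is the set of non-negative integers. $V(z)\sim\{\underline{\alpha},\bar\alpha,\alpha,\hat\sigma\mid\dot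 z=q(z,x,d)\}$ ("ISS-Lyapunov function") means that $V:\mathbb{R}^p\to\mathbb{R}_{\ge0}$ is continuously differentiable, $\underline{\alpha},\bar\alpha,\alpha,\hat\sigma\in\mathcal{K}_\infty$, and for all $z\in\mathbb{R}^p$, $x\in\mathbb{R}$, $d\in\mathbb{D}$: $\underline{\alpha}(\|z\|)\le V(z)\le\bar\alpha(\|z\|)$ and, along $\dot z=q(z,x,d)$, $\dot V(z)\le-\alpha(\|z\|)+\hat\sigma(|x|)$. Zeno behavior is avoided means that only a finite number of events are triggered in any finite amount of time.
   Formalization: Lyapunov stability of (z,x)=0 is claimed only near gains above a plant-dependent threshold (it fails for small initial gains, e.g. f=cx with c large); global existence, boundedness and convergence of (z,x) to 0 are claimed for all initial states and gains. *)

theory Defs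
  imports "HOL-Analysis.Analysis"
begin

text \<open>\<open>C_k k f\<close>: \<open>f\<close> is \<open>k\<close> times continuously differentiable on the whole space
  (stated through iterated directional derivatives).\<close>

primrec C_k :: "nat \<Rightarrow> ('a::euclidean_space \<Rightarrow> 'b::euclidean_space) \<Rightarrow> bool" where
  "C_k 0 f \<longleftrightarrow> continuous_on UNIV f"
| "C_k (Suc k) f \<longleftrightarrow>
     (\<forall>x. f differentiable (at x)) \<and> (\<forall>v. C_k k (\<lambda>x. frechet_derivative f (at x) v))"

definition smooth :: "('a::euclidean_space \<Rightarrow> 'b::euclidean_space) \<Rightarrow> bool" where
  "smooth f \<longleftrightarrow> (\<forall>k. C_k k f)"

definition class_Kinf :: "(real \<Rightarrow> real) \<Rightarrow> bool" where
  "class_Kinf a \<longleftrightarrow>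
     continuous_on {0..} a \<and> a 0 = 0 \<and> strict_mono_on {0..} a \<and> filterlim a at_top at_top"

definition ISS_Lyapunov ::
  "(real ^ 'p \<Rightarrow> real) \<Rightarrow> (real \<Rightarrow> real) \<Rightarrow> (real \<Rightarrow> real) \<Rightarrow> (real \<Rightarrow> real) \<Rightarrow> (real \<Rightarrow> real) \<Rightarrow>
   (real ^ 'p \<Rightarrow> real \<Rightarrow> real ^ 'l \<Rightarrow> real ^ 'p) \<Rightarrow> (real ^ 'l) set \<Rightarrow> bool" where
  "ISS_Lyapunov V alow aup alpha sig q D \<longleftrightarrow>
     C_k 1 V \<and> (\<forall>z. V z \<ge> 0) \<and>
     class_Kinf alow \<and> class_Kinf aup \<and> class_Kinf alpha \<and> class_Kinf sig \<and>
     (\<forall>z. alow (norm z) \<le> V z \<and> V z \<le> aup (norm z)) \<and>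
     (\<forall>z x d. d \<in> D \<longrightarrow>
        frechet_derivative V (at z) (q z x d) \<le> - alpha (norm z) + sig \<bar>x\<bar>)"

definition piecewise_continuous :: "(real \<Rightarrow> 'a::euclidean_space) \<Rightarrow> bool" where
  "piecewise_continuous d \<longleftrightarrow>
     (\<exists>S. (\<forall>s. finite (S \<inter> {0..s})) \<and> (\<forall>t>0. t \<notin> S \<longrightarrow> isCont d t)) \<and>
     (\<forall>t\<ge>0. \<exists>l. (d \<longlongrightarrow> l) (at_right t)) \<and>
     (\<forall>t>0. \<exists>l. (d \<longlongrightarrow> l) (at_left t))"

text \<open>The uncertainty is a signal with values in \<open>D\<close>; constant \<open>d\<close> is a special case.\<close>

definition admissible :: "(real ^ 'l) set \<Rightarrow> (real \<Rightarrow> real ^ 'l) \<Rightarrow> bool" where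
  "admissible D d \<longleftrightarrow> piecewise_continuous d \<and> (\<forall>t\<ge>0. d t \<in> D)"

definition kappa :: "(real \<Rightarrow> real) \<Rightarrow> real \<Rightarrow> real \<Rightarrow> real" where
  "kappa rho x th = - th * rho x * x"

text \<open>Sampling error at time \<open>t\<close> relative to the sample taken at time \<open>s\<close>, for signals
  \<open>x\<close> and \<open>th\<close>. It is a continuous function of \<open>t\<close>, not reset at later sampling instants.\<close>

definition samp_err ::
  "(real \<Rightarrow> real) \<Rightarrow> (real \<Rightarrow> real) \<Rightarrow> (real \<Rightarrow> real) \<Rightarrow> real \<Rightarrow> real \<Rightarrow> real" where
  "samp_err rho x th s t = kappa rho (x s) (th s) - kappa rho (x t) (th t)"

definition sup_norm :: "(real \<Rightarrow> real) \<Rightarrow> real \<Rightarrow> real \<Rightarrow> real" where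
  "sup_norm w a b = (SUP t\<in>{a..b}. \<bar>w t\<bar>)"

definition trigger ::
  "(real \<Rightarrow> real) \<Rightarrow> (real \<Rightarrow> real \<Rightarrow> real \<Rightarrow> real) \<Rightarrow> (real \<Rightarrow> real) \<Rightarrow> (real \<Rightarrow> real) \<Rightarrow>
   real \<Rightarrow> real \<Rightarrow> bool" where
  "trigger rho gam x th s t \<longleftrightarrow>
     (let w = samp_err rho x th s in
        2 * (t - s) * (SUP r\<in>{s..t}. gam (x r) (th r) (w r) * (w r)\<^sup>2)
          \<ge> 1 / 2 * (sup_norm w s t)\<^sup>2
        \<and> sup_norm w s t \<noteq> 0)"

text \<open>Sampling instants generated by signals defined on \<open>[0,T)\<close>. The value \<open>\<infinity>\<close> means that
  there is no such event before \<open>T\<close> (the infimum of the empty set is \<open>\<infinity>\<close>).\<close>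

primrec sample_time ::
  "(real \<Rightarrow> real) \<Rightarrow> (real \<Rightarrow> real \<Rightarrow> real \<Rightarrow> real) \<Rightarrow> ereal \<Rightarrow> (real \<Rightarrow> real) \<Rightarrow> (real \<Rightarrow> real) \<Rightarrow>
   nat \<Rightarrow> ereal" where
  "sample_time rho gam T x th 0 = 0"
| "sample_time rho gam T x th (Suc k) =
     (let s = sample_time rho gam T x th k in
      if s = \<infinity> then \<infinity>
      else Inf (ereal ` {t. real_of_ereal s \<le> t \<and> ereal t < T \<and>
                            trigger rho gam x th (real_of_ereal s) t}))"

text \<open>Solutions of the closed loop on \<open>[0,T)\<close>, \<open>0 < T \<le> \<infinity>\<close>, for the disturbance \<open>d\<close>: continuous
  signals satisfying the differential equations off a locally finite set of times, which
  accommodates the jumps of \<open>d\<close> and of the sampled input. Every \<open>t < T\<close> must lie in some sampling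
  interval, since otherwise the input is undefined; so \<open>T\<close> never exceeds an accumulation
  point of the sampling instants.\<close>

definition solution ::
  "(real ^ 'p \<Rightarrow> real \<Rightarrow> real ^ 'l \<Rightarrow> real ^ 'p) \<Rightarrow> (real ^ 'p \<Rightarrow> real \<Rightarrow> real ^ 'l \<Rightarrow> real) \<Rightarrow>
   real \<Rightarrow> real \<Rightarrow> (real \<Rightarrow> real) \<Rightarrow> (real \<Rightarrow> real \<Rightarrow> real \<Rightarrow> real) \<Rightarrow> (real \<Rightarrow> real ^ 'l) \<Rightarrow>
   ereal \<Rightarrow> (real \<Rightarrow> real ^ 'p) \<Rightarrow> (real \<Rightarrow> real) \<Rightarrow> (real \<Rightarrow> real) \<Rightarrow> bool" where
  "solution q f b lam rho gam d T z x th \<longleftrightarrow>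
     (let I = {t. 0 \<le> t \<and> ereal t < T}; ts = sample_time rho gam T x th in
       0 < T \<and>
       continuous_on I z \<and> continuous_on I x \<and> continuous_on I th \<and>
       (\<forall>t\<in>I. \<exists>k. ts k \<le> ereal t \<and> ereal t < ts (Suc k)) \<and>
       (\<exists>S. (\<forall>s\<in>I. finite (S \<inter> {0..s})) \<and>
         (\<forall>t\<in>I - S. \<forall>k. 0 < t \<and> ts k \<le> ereal t \<and> ereal t < ts (Suc k) \<longrightarrow>
            (z has_vector_derivative q (z t) (x t) (d t)) (at t) \<and>
            (x has_real_derivative
               f (z t) (x t) (d t)
               + b * kappa rho (x (real_of_ereal (ts k))) (th (real_of_ereal (ts k)))) (at t) \<and>
            (th has_real_derivative lam * rho (x t) * (x t)\<^sup>2) (at t))))"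

definition maximal_solution ::
  "(real ^ 'p \<Rightarrow> real \<Rightarrow> real ^ 'l \<Rightarrow> real ^ 'p) \<Rightarrow> (real ^ 'p \<Rightarrow> real \<Rightarrow> real ^ 'l \<Rightarrow> real) \<Rightarrow>
   real \<Rightarrow> real \<Rightarrow> (real \<Rightarrow> real) \<Rightarrow> (real \<Rightarrow> real \<Rightarrow> real \<Rightarrow> real) \<Rightarrow> (real \<Rightarrow> real ^ 'l) \<Rightarrow>
   ereal \<Rightarrow> (real \<Rightarrow> real ^ 'p) \<Rightarrow> (real \<Rightarrow> real) \<Rightarrow> (real \<Rightarrow> real) \<Rightarrow> bool" where
  "maximal_solution q f b lam rho gam d T z x th \<longleftrightarrow>
     solution q f b lam rho gam d T z x th \<and>
     \<not> (\<exists>T' z' x' th'. T < T' \<and> solution q f b lam rho gam d T' z' x' th' \<and>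
          (\<forall>t. 0 \<le> t \<and> ereal t < T \<longrightarrow> z' t = z t \<and> x' t = x t \<and> th' t = th t))"

text \<open>Global asymptotic stability of \<open>(z,x) = 0\<close>, for solutions given by a predicate
  \<open>sol T z x th\<close> on \<open>[0,T)\<close>. The closed loop has the additional state \<open>th\<close> (the dynamic gain), and
  every \<open>(0,0,g)\<close> is an equilibrium. When the gain is below an unknown, plant-dependent
  threshold, \<open>(0,0,g)\<close> is in general unstable (the gain must first grow, which takes an excursion
  of \<open>x\<close> that does not shrink with the initial value); stability is therefore required at all
  equilibria with gain above some threshold, whereas completeness, boundedness and attractivity
  are required from all initial states and all initial gains. For initial gain exactly \<open>g\<close> the
  first clause is the usual epsilon-delta stability of \<open>(z,x) = 0\<close>.\<close>

definition stable_zx ::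
  "(ereal \<Rightarrow> (real \<Rightarrow> real ^ 'p) \<Rightarrow> (real \<Rightarrow> real) \<Rightarrow> (real \<Rightarrow> real) \<Rightarrow> bool) \<Rightarrow> bool" where
  "stable_zx sol \<longleftrightarrow>
     (\<exists>gs. \<forall>g\<ge>gs. \<forall>\<epsilon>>0. \<exists>\<delta>>0. \<forall>T z x th.
        sol T z x th \<and> norm (z 0, x 0, th 0 - g) < \<delta> \<longrightarrow>
        (\<forall>t. 0 \<le> t \<and> ereal t < T \<longrightarrow> norm (z t, x t, th t - g) < \<epsilon>))"

definition bounded_solutions ::
  "(ereal \<Rightarrow> (real \<Rightarrow> real ^ 'p) \<Rightarrow> (real \<Rightarrow> real) \<Rightarrow> (real \<Rightarrow> real) \<Rightarrow> bool) \<Rightarrow> bool" where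
  "bounded_solutions sol \<longleftrightarrow>
     (\<forall>R. \<exists>M. \<forall>T z x th.
        sol T z x th \<and> norm (z 0, x 0, th 0) \<le> R \<longrightarrow>
        (\<forall>t. 0 \<le> t \<and> ereal t < T \<longrightarrow> norm (z t, x t, th t) \<le> M))"

definition attractive_zx ::
  "(ereal \<Rightarrow> (real \<Rightarrow> real ^ 'p) \<Rightarrow> (real \<Rightarrow> real) \<Rightarrow> (real \<Rightarrow> real) \<Rightarrow> bool) \<Rightarrow> bool" where
  "attractive_zx sol \<longleftrightarrow>
     (\<forall>z x th. sol \<infinity> z x th \<longrightarrow> ((\<lambda>t. (z t, x t)) \<longlongrightarrow> (0, 0)) at_top)"

text \<open>Global existence from every initial state, and no maximal solution stops in finite time.\<close>

definition forward_complete ::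
  "(real ^ 'p \<Rightarrow> real \<Rightarrow> real ^ 'l \<Rightarrow> real ^ 'p) \<Rightarrow> (real ^ 'p \<Rightarrow> real \<Rightarrow> real ^ 'l \<Rightarrow> real) \<Rightarrow>
   real \<Rightarrow> real \<Rightarrow> (real \<Rightarrow> real) \<Rightarrow> (real \<Rightarrow> real \<Rightarrow> real \<Rightarrow> real) \<Rightarrow> (real \<Rightarrow> real ^ 'l) \<Rightarrow> bool" where
  "forward_complete q f b lam rho gam d \<longleftrightarrow>
     (\<forall>z0 x0 th0. \<exists>z x th.
        solution q f b lam rho gam d \<infinity> z x th \<and> z 0 = z0 \<and> x 0 = x0 \<and> th 0 = th0) \<and>
     (\<forall>T z x th. maximal_solution q f b lam rho gam d T z x th \<longrightarrow> T = \<infinity>)"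

definition globally_asymptotically_stable ::
  "(real ^ 'p \<Rightarrow> real \<Rightarrow> real ^ 'l \<Rightarrow> real ^ 'p) \<Rightarrow> (real ^ 'p \<Rightarrow> real \<Rightarrow> real ^ 'l \<Rightarrow> real) \<Rightarrow>
   real \<Rightarrow> real \<Rightarrow> (real \<Rightarrow> real) \<Rightarrow> (real \<Rightarrow> real \<Rightarrow> real \<Rightarrow> real) \<Rightarrow> (real \<Rightarrow> real ^ 'l) \<Rightarrow> bool" where
  "globally_asymptotically_stable q f b lam rho gam d \<longleftrightarrow>
     forward_complete q f b lam rho gam d \<and>
     stable_zx (solution q f b lam rho gam d) \<and>
     bounded_solutions (solution q f b lam rho gam d) \<and>
     attractive_zx (solution q f b lam rho gam d)"

definition Zeno_free ::
  "(real ^ 'p \<Rightarrow> real \<Rightarrow> real ^ 'l \<Rightarrow> real ^ 'p) \<Rightarrow> (real ^ 'p \<Rightarrow> real \<Rightarrow> real ^ 'l \<Rightarrow> real) \<Rightarrow>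
   real \<Rightarrow> real \<Rightarrow> (real \<Rightarrow> real) \<Rightarrow> (real \<Rightarrow> real \<Rightarrow> real \<Rightarrow> real) \<Rightarrow> (real \<Rightarrow> real ^ 'l) \<Rightarrow> bool" where
  "Zeno_free q f b lam rho gam d \<longleftrightarrow>
     (\<forall>T z x th. solution q f b lam rho gam d T z x th \<longrightarrow>
        (\<forall>s::real. finite {k. sample_time rho gam T x th k \<le> ereal s}))"

end

theory Submission
  imports Defs
begin

text \<open>
Passing from \<open>V\<close> to \<open>U = V * H V\<close> makes the supply rate of the \<open>z\<close>-subsystem quadratic,
\<open>U' \<le> - m1\<^sup>2 |z|\<^sup>2 + p rho(x) x\<^sup>2\<close>, with a known \<open>rho\<close> and an unknown constant \<open>p\<close>.
Before the next event the law reads \<open>2 (t - s) max (gam w\<^sup>2) < max w\<^sup>2 / 2\<close>, whereas Cauchy-Schwarz gives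
\<open>max w\<^sup>2 \<le> 4 (t - s) \<integral> A\<^sup>2\<close> for the part \<open>A\<close> of the derivative of \<open>w\<close> that does not contain \<open>w\<close>.
The factors \<open>t - s\<close> cancel, and a large \<open>gam\<close>, evaluated where \<open>|w|\<close> is maximal, yields
\<open>max w\<^sup>2 \<le> C \<integral> (m1\<^sup>2 |z|\<^sup>2 + rho x\<^sup>2)\<close>. For this the peak of \<open>|x|\<close> on the sampling interval must be known at
that instant: if \<open>th \<ge> 1\<close> it is bounded by \<open>|kappa| = |u - w|\<close>, and while \<open>th \<le> 1\<close> the state moves by a
bounded amount because \<open>lam \<integral> rho x\<^sup>2\<close> is the increase of \<open>th\<close>.
Hence \<open>K U + x\<^sup>2 / 2 + b / (2 lam) (th - g)\<^sup>2\<close> decreases at least at the rate \<open>m1\<^sup>2 |z|\<^sup>2 + rho x\<^sup>2\<close> for all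
large \<open>g\<close>. The coupling constant \<open>C\<close> does not depend on the solution once \<open>th(0) > 1\<close>, which is what
stability at every large gain \<open>g\<close> needs.
\<close>

subsection \<open>Smooth majorants\<close>

text \<open>Since \<open>rho\<close> and \<open>gam\<close> are fixed before the plant, no design
  bound may refer to \<open>V\<close>, \<open>q\<close>, \<open>f\<close> or \<open>b\<close>. The
  change of supply rate therefore takes suprema over all values that \<open>alow\<close>,
  \<open>aup\<close>, \<open>alpha\<close> leave possible. Such suprema are locally bounded but need
  not be continuous, hence the passage to smooth majorants. The gain threshold involves
  \<open>1 / b\<close> and other unknown constants. It enters only through the comparison gain
  \<open>g\<close>: differentiating \<open>(th - g)\<^sup>2\<close> turns the actual gain in the
  decay of \<open>x\<^sup>2\<close> into \<open>g\<close>, so the design stays independent of it. A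
  sampling instant is an infimum over events before the horizon \<open>T\<close>, so it can change
  with \<open>T\<close>, and events could accumulate. The circle is broken by proving the Lyapunov
  estimate on an arbitrary \<open>[0,T)\<close>: it bounds the state, the bound yields a dwell time,
  and only then are solutions continued past a finite \<open>T\<close>.\<close>

lemma C_k_power_series_linear:
  fixes L :: "'a::euclidean_space \<Rightarrow> real"
  assumes L: "bounded_linear L" and "\<And>x. summable (\<lambda>n. c n * x ^ n)"
  shows "C_k k (\<lambda>p. \<Sum>n. c n * (L p) ^ n)"
  using assms(2)
proof (induction k arbitrary: c)
  case (0 c)
  have "continuous_on UNIV (\<lambda>x. \<Sum>n. c n * x ^ n)"
    using isCont_powser_converges_everywhere[of c] 0 by (auto simp: continuous_on_eq_continuous_at)
  then have "continuous_on UNIV (\<lambda>p. \<Sum>n. c n * (L p) ^ n)"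
    using continuous_on_compose2[of UNIV _ UNIV L] linear_continuous_on[OF L] by auto
  then show ?case by simp
next
  \<comment> \<open>Power series in one linear functional are closed under directional derivatives:
    differentiating along \<open>v\<close> gives the coefficients \<open>L v * diffs c n\<close>.
    Hence the induction with arbitrary \<open>c\<close>.\<close>
  case (Suc k c)
  have d: "((\<lambda>p. \<Sum>n. c n * (L p) ^ n) has_derivative
      (\<lambda>v. (\<Sum>n. diffs c n * (L p) ^ n) * L v)) (at p)" for p
  proof -
    have "((\<lambda>x. \<Sum>n. c n * x ^ n) has_derivative (*) (\<Sum>n. diffs c n * (L p) ^ n)) (at (L p))"
      using termdiffs_strong_converges_everywhere[of c "L p"] Suc.prems
      by (simp add: has_field_derivative_def)
    from diff_chain_at[OF bounded_linear_imp_has_derivative[OF L] this]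
    show ?thesis by (simp add: o_def)
  qed
  have summ: "summable (\<lambda>n. (L v * diffs c n) * x ^ n)" for v x
    using summable_mult[OF termdiff_converges_all[OF Suc.prems], of "L v" x] by (simp add: mult.assoc)
  have fd: "(\<lambda>p. frechet_derivative (\<lambda>p. \<Sum>n. c n * (L p) ^ n) (at p) v)
      = (\<lambda>p. \<Sum>n. (L v * diffs c n) * (L p) ^ n)" for v
  proof
    fix p
    have "frechet_derivative (\<lambda>p. \<Sum>n. c n * (L p) ^ n) (at p) = (\<lambda>v. (\<Sum>n. diffs c n * (L p) ^ n) * L v)"
      using frechet_derivative_at[OF d] by simp
    moreover have "(\<Sum>n. (L v * diffs c n) * (L p) ^ n) = L v * (\<Sum>n. diffs c n * (L p) ^ n)"
      using suminf_mult[OF termdiff_converges_all[OF Suc.prems], of "L v" "L p"] by (simp add: mult.assoc)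
    ultimately show "frechet_derivative (\<lambda>p. \<Sum>n. c n * (L p) ^ n) (at p) v
      = (\<Sum>n. (L v * diffs c n) * (L p) ^ n)" by simp
  qed
  show ?case
    using d fd Suc.IH[OF summ] by (auto simp: differentiable_def)
qed

lemma C_k_add:
  assumes "C_k k f" "C_k k g"
  shows "C_k k (\<lambda>x. f x + g x)"
  using assms
proof (induction k arbitrary: f g)
  case 0
  then show ?case by (auto intro: continuous_on_add)
next
  case (Suc k)
  have "(\<lambda>x. frechet_derivative (\<lambda>x. f x + g x) (at x) v)
      = (\<lambda>x. frechet_derivative f (at x) v + frechet_derivative g (at x) v)" for v
  proof
    fix x
    have "(f has_derivative frechet_derivative f (at x)) (at x)"
      "(g has_derivative frechet_derivative g (at x)) (at x)"
      using Suc.prems by (auto simp: frechet_derivative_works)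
    from frechet_derivative_at[OF has_derivative_add[OF this]] show "frechet_derivative (\<lambda>x. f x + g x) (at x) v
        = frechet_derivative f (at x) v + frechet_derivative g (at x) v"
      by metis
  qed
  then show ?case using Suc by auto
qed

lemma smooth_add: "smooth f \<Longrightarrow> smooth g \<Longrightarrow> smooth (\<lambda>x. f x + g x)"
  by (auto simp: smooth_def intro: C_k_add)

text \<open>An even power series with nonnegative coefficients increases with the absolute value of
  its argument and stays smooth when composed with a linear functional. With sparse, fast growing
  exponents it dominates any locally bounded function: the \<open>n\<close>-th term is negligible
  while \<open>\<bar>x\<bar>\<close> is small against \<open>n\<close>, and exceeds the bound for
  \<open>F\<close> when \<open>n + 1 \<le> \<bar>x\<bar> \<le> n + 2\<close>.\<close>

lemma smooth_majorant:
  fixes F :: "real \<Rightarrow> real"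
  assumes "\<And>n::nat. bdd_above (F ` {- real n..real n})"
  obtains H H' where
    "\<And>L :: 'a::euclidean_space \<Rightarrow> real. bounded_linear L \<Longrightarrow> smooth (\<lambda>p. H (L p))" "smooth H"
    "\<And>x. (H has_real_derivative H' x) (at x)" "continuous_on UNIV H'"
    "\<And>x y. \<bar>x\<bar> \<le> \<bar>y\<bar> \<Longrightarrow> H x \<le> H y" "\<And>x. 1 \<le> H x" "\<And>x. F x \<le> H x"
proof -
  obtain B where B: "\<And>n x. \<bar>x\<bar> \<le> real n \<Longrightarrow> F x \<le> B n"
  proof -
    have "\<forall>n. \<exists>b. \<forall>x\<in>{- real n..real n}. F x \<le> b" using assms by (auto simp: bdd_above_def)
    then obtain B where "\<And>n x. x \<in> {- real n..real n} \<Longrightarrow> F x \<le> B n" by metis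
    then show ?thesis using that[of B] by (auto simp: abs_le_iff)
  qed
  define N where "N = (\<lambda>n. nat \<lceil>B n\<rceil>)"
  have BN: "B n \<le> real (N n)" for n unfolding N_def by linarith
  \<comment> \<open>The \<open>n\<close>-th term has to beat \<open>N (n+2)\<close>. The partial
    sum, unlike \<open>N (n+2)\<close> alone, is nondecreasing in \<open>n\<close>, so the exponents
    strictly increase; the factor 2 in \<open>g\<close> makes them even.\<close>
  define k where "k = (\<lambda>n. n + 1 + (\<Sum>i\<le>n+2. N i))"
  define g where "g = (\<lambda>n. 2 * k n)"
  have g: "strict_mono g" unfolding strict_mono_Suc_iff g_def k_def by simp
  have inj: "inj g" using g by (simp add: strict_mono_imp_inj_on)
  have g0: "g n \<noteq> 0" for n by (simp add: g_def k_def)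
  \<comment> \<open>Written out, this is the series of \<open>(2 * x / (n + 1)) ^ g n\<close>. The
    base has absolute value at least 2 for \<open>\<bar>x\<bar> \<ge> n + 1\<close>, so the term is
    at least \<open>2 ^ g n\<close>; it is at most 1/2 for \<open>n \<ge> 4 * \<bar>x\<bar>\<close>,
    so the series converges everywhere. The constant in \<open>c0\<close> takes care of
    \<open>\<bar>x\<bar> \<le> 1\<close>.\<close>
  define c1 where "c1 = (\<lambda>m. if m \<in> range g then (2 / (real (inv g m) + 1)) ^ m else (0::real))"
  define c0 where "c0 = (\<lambda>m::nat. if m = 0 then 1 + real (N 1) else 0)"
  define c where "c = (\<lambda>m. c0 m + c1 m)"
  have c1g: "c1 (g n) * x ^ g n = (2 * x / (real n + 1)) ^ g n" for n x
    using inv_f_f[OF inj] by (simp add: c1_def power_mult_distrib power_divide)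
  have s1: "summable (\<lambda>m. c1 m * x ^ m)" for x
  proof -
    have "summable (\<lambda>n. c1 (g n) * x ^ g n)"
    proof (rule summable_comparison_test_ev)
      show "summable (\<lambda>n. (1/2::real) ^ n)" by (rule summable_geometric) simp
      show "\<forall>\<^sub>F n in sequentially. norm (c1 (g n) * x ^ g n) \<le> (1/2) ^ n"
        using eventually_ge_at_top[of "nat \<lceil>4 * \<bar>x\<bar>\<rceil>"]
      proof eventually_elim
        case (elim n)
        then have "4 * \<bar>x\<bar> \<le> real n" by linarith
        then have le: "\<bar>2 * x / (real n + 1)\<bar> \<le> 1/2" by (simp add: abs_mult field_simps)
        have "norm (c1 (g n) * x ^ g n) = \<bar>2 * x / (real n + 1)\<bar> ^ g n"
          unfolding c1g by (simp add: power_abs)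
        also have "\<dots> \<le> (1/2) ^ g n" using le by (intro power_mono) auto
        also have "\<dots> \<le> (1/2) ^ n" by (rule power_decreasing) (auto simp: g_def k_def)
        finally show ?case .
      qed
    qed
    then show ?thesis
      using summable_mono_reindex[OF g, of "\<lambda>m. c1 m * x ^ m"] by (auto simp: c1_def)
  qed
  have s0: "(\<lambda>m. c0 m * x ^ m) sums (1 + real (N 1))" for x
    using sums_If_finite[of "\<lambda>m. m = 0" "\<lambda>m. (1 + real (N 1)) * x ^ m"]
    by (simp add: c0_def if_distrib[of "\<lambda>a. a * _"] cong: if_cong)
  have s: "summable (\<lambda>m. c m * x ^ m)" for x
    using summable_add[OF sums_summable[OF s0[of x]] s1[of x]] by (simp add: c_def algebra_simps)
  define H where "H = (\<lambda>x. \<Sum>m. c m * x ^ m)"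
  define H' where "H' = (\<lambda>x. \<Sum>m. diffs c m * x ^ m)"
  have Heq: "H x = 1 + real (N 1) + (\<Sum>m. c1 m * x ^ m)" for x
    using suminf_add[OF sums_summable[OF s0[of x]] s1[of x]] sums_unique[OF s0[of x]]
    by (simp add: H_def c_def algebra_simps)
  have c1abs: "c1 m * x ^ m = c1 m * \<bar>x\<bar> ^ m" for m x
  proof (cases "m \<in> range g")
    case True
    then have "even m" by (auto simp: g_def)
    then show ?thesis by (simp add: power_even_abs)
  qed (simp add: c1_def)
  have c1nn: "0 \<le> c1 m" for m by (simp add: c1_def)
  have nn: "0 \<le> c1 m * x ^ m" for m x
    by (subst c1abs) (intro mult_nonneg_nonneg c1nn zero_le_power abs_ge_zero)
  have mono: "H x \<le> H y" if "\<bar>x\<bar> \<le> \<bar>y\<bar>" for x y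
  proof -
    have "(\<Sum>m. c1 m * x ^ m) \<le> (\<Sum>m. c1 m * y ^ m)"
    proof (rule suminf_le[OF _ s1 s1])
      fix m show "c1 m * x ^ m \<le> c1 m * y ^ m"
        unfolding c1abs[of m x] c1abs[of m y] using that
        by (intro mult_left_mono power_mono c1nn) auto
    qed
    then show ?thesis by (simp add: Heq)
  qed
  have snn: "0 \<le> (\<Sum>m. c1 m * x ^ m)" for x by (rule suminf_nonneg[OF s1 nn])
  have ge: "F x \<le> H x" for x
  proof (cases "\<bar>x\<bar> \<le> 1")
    case True
    then have "F x \<le> B 1" using B[of x 1] by simp
    then show ?thesis using BN[of 1] snn[of x] by (simp add: Heq)
  next
    case False
    define n where "n = nat \<lfloor>\<bar>x\<bar>\<rfloor> - 1"
    have n1: "real n + 1 \<le> \<bar>x\<bar>" "\<bar>x\<bar> \<le> real (n + 2)" using False unfolding n_def by linarith+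
    have "F x \<le> B (n+2)" using B n1 by blast
    also have "\<dots> \<le> real (N (n+2))" by (rule BN)
    also have "real (N (n+2)) \<le> real (g n)"
    proof -
      have "N (n+2) \<le> (\<Sum>i\<le>n+2. N i)" by (rule member_le_sum) auto
      also have "S \<le> 2 * (n + 1 + S)" for S :: nat by simp
      finally show ?thesis unfolding g_def k_def of_nat_le_iff .
    qed
    also have "real (g n) \<le> 2 ^ g n" using less_exp[of "g n"] by (metis of_nat_le_numeral_power_cancel_iff less_imp_le)
    also have "\<dots> \<le> \<bar>2 * x / (real n + 1)\<bar> ^ g n"
      using n1 by (intro power_mono) (auto simp: abs_mult field_simps)
    also have "\<dots> = c1 (g n) * x ^ g n"
      unfolding c1g by (rule power_even_abs) (simp add: g_def)
    also have "\<dots> \<le> (\<Sum>m. c1 m * x ^ m)"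
      using sum_le_suminf[OF s1, of "{g n}"] nn by simp
    also have "\<dots> \<le> H x" by (simp add: Heq)
    finally show ?thesis .
  qed
  have d: "(H has_real_derivative H' x) (at x)" for x
    using termdiffs_strong_converges_everywhere[OF s] unfolding H_def H'_def .
  have "continuous_on UNIV H'"
    using isCont_powser_converges_everywhere[OF termdiff_converges_all[OF s]]
    unfolding H'_def by (auto simp: continuous_on_eq_continuous_at)
  moreover have "smooth (\<lambda>p. H (L p))" if "bounded_linear L" for L :: "'a \<Rightarrow> real"
    using C_k_power_series_linear[OF that s] unfolding smooth_def H_def by blast
  moreover have "smooth H"
    using C_k_power_series_linear[OF bounded_linear_ident s] unfolding smooth_def H_def by blast
  moreover have "1 \<le> H x" for x using snn[of x] by (simp add: Heq)
  ultimately show ?thesis using that[of H H'] mono ge d by blast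
qed

subsection \<open>Calculus on intervals\<close>

text \<open>Solutions are differentiable only off a finite set. Giving the derivative the value
  \<open>h\<close> at the exceptional points keeps it below \<open>h\<close> everywhere, and the
  fundamental theorem for the gauge integral supplies its integrability.\<close>

lemma diff_le_integral_off_finite:
  fixes g h :: "real \<Rightarrow> real"
  assumes "a \<le> b" "finite S" "continuous_on {a..b} g" "continuous_on {a..b} h"
    and d: "\<And>t. t \<in> {a<..<b} - S \<Longrightarrow> \<exists>D. (g has_real_derivative D) (at t) \<and> D \<le> h t"
  shows "g b - g a \<le> integral {a..b} h"
proof -
  obtain D where D: "\<And>t. t \<in> {a<..<b} - S \<Longrightarrow> (g has_real_derivative D t) (at t) \<and> D t \<le> h t"
    using d by metis
  define g' where "g' = (\<lambda>t. if t \<in> {a<..<b} - S then D t else h t)"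
  have "(g' has_integral (g b - g a)) {a..b}"
    using assms D by (intro fundamental_theorem_of_calculus_interior_strong[of S])
      (auto simp: g'_def has_real_derivative_iff_has_vector_derivative)
  moreover have "(h has_integral integral {a..b} h) {a..b}"
    using assms by (intro integrable_integral integrable_continuous_real)
  ultimately show ?thesis
    by (rule has_integral_le) (use D in \<open>auto simp: g'_def\<close>)
qed

lemma norm_diff_le_off_finite:
  fixes g :: "real \<Rightarrow> 'a::euclidean_space"
  assumes "a \<le> b" "finite S" "continuous_on {a..b} g" "0 \<le> B"
    and d: "\<And>t. t \<in> {a<..<b} - S \<Longrightarrow> \<exists>D. (g has_vector_derivative D) (at t) \<and> norm D \<le> B"
  shows "norm (g b - g a) \<le> B * (b - a)"
proof -
  obtain D where D: "\<And>t. t \<in> {a<..<b} - S \<Longrightarrow> (g has_vector_derivative D t) (at t) \<and> norm (D t) \<le> B"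
    using d by metis
  define g' where "g' = (\<lambda>t. if t \<in> {a<..<b} - S then D t else 0)"
  have "(g' has_integral (g b - g a)) (cbox a b)"
    unfolding box_real using assms D by (intro fundamental_theorem_of_calculus_interior_strong[of S])
      (auto simp: g'_def)
  from has_integral_bound[OF \<open>0 \<le> B\<close> this] show ?thesis
    using D \<open>a \<le> b\<close> \<open>0 \<le> B\<close> by (auto simp: g'_def)
qed

lemma C_k_1D:
  assumes "C_k 1 f"
  shows "(f has_derivative frechet_derivative f (at x)) (at x)"
    and "continuous_on UNIV (\<lambda>x. frechet_derivative f (at x) v)"
    and "continuous_on A f"
proof -
  have "f differentiable (at x)" for x using assms by simp
  then show d: "(f has_derivative frechet_derivative f (at x)) (at x)" for x
    by (simp add: frechet_derivative_works)
  show "continuous_on UNIV (\<lambda>x. frechet_derivative f (at x) v)" using assms by simp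
  show "continuous_on A f"
    using has_derivative_continuous[OF d] by (auto intro: continuous_at_imp_continuous_on)
qed

text \<open>\<open>C_k 1\<close> gives continuity of each directional derivative separately.
  Expanding a direction in the basis turns the bounds for finitely many of them on the compact ball
  into a bound on the operator norm, and the ball is convex.\<close>

lemma C_k_1_lipschitz_on_cball:
  fixes f :: "'a::euclidean_space \<Rightarrow> 'b::euclidean_space"
  assumes "C_k 1 f"
  obtains B where "0 \<le> B"
    "\<And>x y. norm x \<le> R \<Longrightarrow> norm y \<le> R \<Longrightarrow> norm (f x - f y) \<le> B * norm (x - y)"
proof -
  let ?D = "\<lambda>x. frechet_derivative f (at x)"
  have "\<exists>b. \<forall>x\<in>cball 0 R. norm (?D x i) \<le> b" for i
  proof -
    have "compact ((\<lambda>x. ?D x i) ` cball 0 R)"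
      using C_k_1D(2)[OF assms, of i] by (intro compact_continuous_image) (auto intro: continuous_on_subset)
    from compact_imp_bounded[OF this] show ?thesis by (auto simp: bounded_iff)
  qed
  then obtain b where b: "\<And>i x. x \<in> cball 0 R \<Longrightarrow> norm (?D x i) \<le> b i" by metis
  define B where "B = (\<Sum>i\<in>Basis. \<bar>b i\<bar>)"
  have on: "onorm (?D x) \<le> B" if "x \<in> cball 0 R" for x
  proof (rule onorm_bound)
    show "0 \<le> B" by (auto simp: B_def intro: sum_nonneg)
    fix v
    have lin: "linear (?D x)" using C_k_1D(1)[OF assms] has_derivative_linear by blast
    have "?D x v = ?D x (\<Sum>i\<in>Basis. (v \<bullet> i) *\<^sub>R i)" by (simp add: euclidean_representation)
    also have "\<dots> = (\<Sum>i\<in>Basis. (v \<bullet> i) *\<^sub>R ?D x i)"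
      by (simp only: linear_sum[OF lin] linear_cmul[OF lin])
    also have "norm \<dots> \<le> (\<Sum>i\<in>Basis. \<bar>b i\<bar> * norm v)"
    proof (rule sum_norm_le)
      fix i :: 'a assume "i \<in> Basis"
      then have "\<bar>v \<bullet> i\<bar> * norm (?D x i) \<le> norm v * \<bar>b i\<bar>"
        using b[OF that, of i] by (intro mult_mono) (auto simp: Basis_le_norm)
      then show "norm ((v \<bullet> i) *\<^sub>R ?D x i) \<le> \<bar>b i\<bar> * norm v" by (simp add: mult.commute)
    qed
    also have "\<dots> = B * norm v" by (simp add: B_def sum_distrib_right)
    finally show "norm (?D x v) \<le> B * norm v" .
  qed
  show ?thesis
  proof (rule that)
    show "0 \<le> B" by (auto simp: B_def intro: sum_nonneg)
    fix x y :: 'a assume "norm x \<le> R" "norm y \<le> R"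
    then show "norm (f x - f y) \<le> B * norm (x - y)"
      using differentiable_bound[OF convex_cball _ on, of 0 R f] C_k_1D(1)[OF assms]
      by (meson has_derivative_at_withinI mem_cball_0)
  qed
qed

lemma
  fixes f :: "real \<Rightarrow> real"
  assumes "continuous_on {a..b} f" "a \<le> b"
  shows cSUP_upper_atLeastAtMost: "\<And>t. t \<in> {a..b} \<Longrightarrow> f t \<le> (SUP r\<in>{a..b}. f r)"
    and cSUP_attained_atLeastAtMost: "\<exists>r\<in>{a..b}. (SUP r\<in>{a..b}. f r) = f r"
proof -
  have c: "compact (f ` {a..b})" using assms(1) by (intro compact_continuous_image) auto
  then have bdd: "bdd_above (f ` {a..b})" by (simp add: bounded_imp_bdd_above compact_imp_bounded)
  show u: "\<And>t. t \<in> {a..b} \<Longrightarrow> f t \<le> (SUP r\<in>{a..b}. f r)" using bdd by (intro cSUP_upper)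
  obtain r where "r \<in> {a..b}" "\<And>t. t \<in> {a..b} \<Longrightarrow> f t \<le> f r"
    using continuous_attains_sup[of "{a..b}" f] assms by auto
  then show "\<exists>r\<in>{a..b}. (SUP r\<in>{a..b}. f r) = f r"
    using u assms(2) by (intro bexI[of _ r] antisym cSUP_least) auto
qed

text \<open>Both sides of the triggering inequality are built from such running maxima; this is used
  where events accumulate from the right. Just after \<open>t\<close> only values close to
  \<open>f t\<close> enter the supremum.\<close>

lemma running_SUP_right_continuous:
  fixes f :: "real \<Rightarrow> real"
  assumes f: "continuous_on {s..b} f" and "s \<le> t" "t < b"
  shows "((\<lambda>t. SUP r\<in>{s..t}. f r) \<longlongrightarrow> (SUP r\<in>{s..t}. f r)) (at_right t)"
proof (rule tendstoI)
  let ?m = "\<lambda>t. SUP r\<in>{s..t}. f r"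
  fix e :: real assume "0 < e"
  have sub: "continuous_on {s..u} f" if "u \<le> b" for u using f that by (auto intro: continuous_on_subset)
  have "\<exists>d>0. \<forall>u\<in>{s..b}. dist u t < d \<longrightarrow> dist (f u) (f t) < e/2"
    using f[unfolded continuous_on_iff, rule_format, of t "e/2"] assms(2,3) \<open>0 < e\<close> by simp
  then obtain d where d: "d > 0" "\<And>u. u \<in> {s..b} \<Longrightarrow> dist u t < d \<Longrightarrow> dist (f u) (f t) < e/2" by auto
  have "eventually (\<lambda>u. u \<in> {t<..<min b (t + d)}) (at_right t)"
    using d(1) assms(3) by (intro eventually_at_right_real) auto
  then show "\<forall>\<^sub>F u in at_right t. dist (?m u) (?m t) < e"
  proof eventually_elim
    case (elim u)
    have ut: "t < u" "u < b" "u < t + d" using elim by auto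
    have "?m t \<le> ?m u"
      using cSUP_attained_atLeastAtMost[OF sub, of t] cSUP_upper_atLeastAtMost[OF sub, of u] ut assms by force
    moreover have "?m u \<le> ?m t + e/2"
    proof (rule cSUP_least)
      show "{s..u} \<noteq> {}" using ut assms by auto
      fix r assume r: "r \<in> {s..u}"
      show "f r \<le> ?m t + e/2"
      proof (cases "r \<le> t")
        case True
        then show ?thesis using cSUP_upper_atLeastAtMost[OF sub, of t r] r assms \<open>0 < e\<close> by auto
      next
        case False
        then have "dist (f r) (f t) < e/2" using r ut by (intro d(2)) (auto simp: dist_real_def)
        then have "f r \<le> f t + e/2" unfolding dist_real_def by linarith
        then show ?thesis using cSUP_upper_atLeastAtMost[OF sub, of t t] assms by auto
      qed
    qed
    ultimately show ?case using \<open>0 < e\<close> by (auto simp: dist_real_def)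
  qed
qed

text \<open>To use the contraction principle on the whole space of bounded continuous functions,
  time is clamped to the interval (\<open>cl\<close>) and the state is projected to the ball
  (\<open>pr\<close>, which is 1-Lipschitz). The fixed point stays in the ball, where the projection
  is the identity, so it solves the original equation.\<close>

lemma picard:
  fixes F :: "real \<Rightarrow> 'a::euclidean_space \<Rightarrow> 'a"
  assumes "0 < a" "0 < r"
    and cont: "continuous_on ({T..T+a} \<times> cball y0 r) (\<lambda>(t, y). F t y)"
    and lip: "\<And>t x y. t \<in> {T..T+a} \<Longrightarrow> x \<in> cball y0 r \<Longrightarrow> y \<in> cball y0 r \<Longrightarrow>
        norm (F t x - F t y) \<le> B * norm (x - y)"
  obtains \<delta> y where "0 < \<delta>" "\<delta> \<le> a" "continuous_on {T..T+\<delta>} y" "y T = y0"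
    "\<And>t. t \<in> {T<..<T+\<delta>} \<Longrightarrow> (y has_vector_derivative F t (y t)) (at t)"
proof -
  have "compact ((\<lambda>(t, y). F t y) ` ({T..T+a} \<times> cball y0 r))"
    by (intro compact_continuous_image cont compact_Times) auto
  from compact_imp_bounded[OF this]
  obtain K0 where "\<forall>x\<in>{T..T+a} \<times> cball y0 r. norm (case x of (t, y) \<Rightarrow> F t y) \<le> K0"
    unfolding bounded_iff by auto
  then have K0: "\<And>t y. t \<in> {T..T+a} \<Longrightarrow> y \<in> cball y0 r \<Longrightarrow> norm (F t y) \<le> K0"
    by force
  define K where "K = \<bar>K0\<bar> + 1"
  define B' where "B' = \<bar>B\<bar> + 1"
  \<comment> \<open>\<open>\<delta> * K \<le> r\<close> keeps the integral curve in the ball,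
    \<open>\<delta> * B' \<le> 1/2\<close> makes the integral operator a contraction.\<close>
  define \<delta> where "\<delta> = min a (min (r / K) (1 / (2 * B')))"
  have K: "K > 0" and B': "B' > 0" by (auto simp: K_def B'_def)
  have \<delta>: "0 < \<delta>" "\<delta> \<le> a" "\<delta> * K \<le> r" "\<delta> * B' \<le> 1/2"
  proof -
    show "0 < \<delta>" "\<delta> \<le> a" using assms K B' by (auto simp: \<delta>_def)
    have "\<delta> \<le> r / K" "\<delta> \<le> 1 / (2 * B')" by (auto simp: \<delta>_def)
    then show "\<delta> * K \<le> r" "\<delta> * B' \<le> 1/2" using K B' by (auto simp: field_simps)
  qed
  define cl where "cl = (\<lambda>t::real. max T (min t (T + \<delta>)))"
  define pr where "pr = closest_point (cball y0 r)"
  have cl: "cl t \<in> {T..T+a}" "cl t \<in> {T..T+\<delta>}" for t using \<delta> by (auto simp: cl_def)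
  have clid: "cl t = t" if "t \<in> {T..T+\<delta>}" for t using that by (auto simp: cl_def)
  have ne: "cball y0 r \<noteq> {}" using \<open>0 < r\<close> by simp
  have pr: "pr y \<in> cball y0 r" for y unfolding pr_def by (rule closest_point_in_set[OF closed_cball ne])
  have prid: "pr y = y" if "y \<in> cball y0 r" for y using that by (simp add: pr_def closest_point_self)
  have prlip: "dist (pr x) (pr y) \<le> dist x y" for x y
    unfolding pr_def by (rule closest_point_lipschitz[OF convex_cball closed_cball ne])
  have prcont: "continuous_on A pr" for A
    unfolding pr_def by (rule continuous_on_closest_point[OF convex_cball closed_cball ne])
  define G where "G = (\<lambda>\<phi> t. F (cl t) (pr (apply_bcontfun \<phi> (cl t))))"
  have Gc: "continuous_on A (G \<phi>)" for A \<phi>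
  proof -
    have "continuous_on A cl" unfolding cl_def by (intro continuous_intros)
    moreover have "continuous_on A (\<lambda>t. pr (apply_bcontfun \<phi> (cl t)))"
      by (rule continuous_on_compose2[OF prcont[of UNIV]],
          rule continuous_on_compose2[OF _ \<open>continuous_on A cl\<close>, of UNIV])
        (use apply_bcontfun[of \<phi>] in \<open>auto simp: bcontfun_def\<close>)
    ultimately have "continuous_on A (\<lambda>t. (cl t, pr (apply_bcontfun \<phi> (cl t))))" by (intro continuous_intros)
    moreover have "(\<lambda>t. (cl t, pr (apply_bcontfun \<phi> (cl t)))) ` A \<subseteq> {T..T+a} \<times> cball y0 r"
      using cl(1) pr by blast
    ultimately show ?thesis using continuous_on_compose2[OF cont] by (fastforce simp: G_def)
  qed
  have Gi: "G \<phi> integrable_on {u..v}" for \<phi> u v by (rule integrable_continuous_real[OF Gc])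
  have Gb: "norm (G \<phi> t) \<le> K" for \<phi> t using K0[OF cl(1) pr, of t "apply_bcontfun \<phi> (cl t)"] by (simp add: G_def K_def)
  have Gint: "norm (integral {T..u} (G \<phi>)) \<le> r" if "u \<in> {T..T+\<delta>}" for u \<phi>
  proof -
    have "norm (integral {T..u} (G \<phi>)) \<le> K * (u - T)"
      using that integral_bound[of T u "G \<phi>" K] Gc Gb by auto
    also have "\<dots> \<le> K * \<delta>" using that K by (intro mult_left_mono) auto
    finally show ?thesis using \<delta>(3) by (simp add: mult.commute)
  qed
  define Pf where "Pf = (\<lambda>\<phi> t. y0 + integral {T..cl t} (G \<phi>))"
  have "Pf \<phi> \<in> bcontfun" for \<phi>
  proof (rule bcontfun_normI)
    have "continuous_on {T..T+\<delta>} (\<lambda>u. integral {T..u} (G \<phi>))"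
      by (rule indefinite_integral_continuous_1[OF Gi])
    moreover have "continuous_on UNIV cl" unfolding cl_def by (intro continuous_intros)
    ultimately have "continuous_on UNIV (\<lambda>t. integral {T..cl t} (G \<phi>))"
      by (rule continuous_on_compose2) (use cl in auto)
    then show "continuous_on UNIV (Pf \<phi>)" unfolding Pf_def by (intro continuous_intros)
    fix t show "norm (Pf \<phi> t) \<le> norm y0 + r"
      unfolding Pf_def using norm_triangle_ineq[of y0] Gint[OF cl(2)] by (meson add_left_mono order_trans)
  qed
  then have app: "apply_bcontfun (Bcontfun (Pf \<phi>)) t = Pf \<phi> t" for \<phi> t by (simp add: Bcontfun_inverse)
  have "\<exists>!\<phi>. Bcontfun (Pf \<phi>) = \<phi>"
  proof (rule banach_fix_type[of "1/2"])
    show "\<forall>\<phi> \<psi>. dist (Bcontfun (Pf \<phi>)) (Bcontfun (Pf \<psi>)) \<le> 1/2 * dist \<phi> \<psi>"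
    proof (intro allI dist_bound)
      fix \<phi> \<psi> t
      have "dist (apply_bcontfun (Bcontfun (Pf \<phi>)) t) (apply_bcontfun (Bcontfun (Pf \<psi>)) t)
          = norm (integral {T..cl t} (\<lambda>s. G \<phi> s - G \<psi> s))"
        unfolding app using Henstock_Kurzweil_Integration.integral_diff[OF Gi Gi, of T "cl t" \<phi> \<psi>]
        by (simp add: Pf_def dist_norm)
      also have "\<dots> \<le> (B' * dist \<phi> \<psi>) * (cl t - T)"
      proof (rule integral_bound)
        show "T \<le> cl t" using cl(2)[of t] by auto
        show "continuous_on {T..cl t} (\<lambda>s. G \<phi> s - G \<psi> s)" by (intro continuous_intros Gc)
        fix s
        have "norm (G \<phi> s - G \<psi> s) \<le> B * dist (pr (apply_bcontfun \<phi> (cl s))) (pr (apply_bcontfun \<psi> (cl s)))"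
          unfolding G_def dist_norm by (rule lip[OF cl(1) pr pr])
        also have "\<dots> \<le> B' * dist (pr (apply_bcontfun \<phi> (cl s))) (pr (apply_bcontfun \<psi> (cl s)))"
          by (intro mult_right_mono) (auto simp: B'_def)
        also have "\<dots> \<le> B' * dist \<phi> \<psi>"
          using B' prlip order_trans[OF prlip dist_bounded] by (intro mult_left_mono) auto
        finally show "norm (G \<phi> s - G \<psi> s) \<le> B' * dist \<phi> \<psi>" .
      qed
      also have "\<dots> \<le> (B' * dist \<phi> \<psi>) * \<delta>"
        using cl(2)[of t] B' by (intro mult_left_mono) auto
      also have "\<dots> = (\<delta> * B') * dist \<phi> \<psi>" by simp
      also have "\<dots> \<le> 1/2 * dist \<phi> \<psi>" using \<delta>(4) by (intro mult_right_mono) auto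
      finally show "dist (apply_bcontfun (Bcontfun (Pf \<phi>)) t) (apply_bcontfun (Bcontfun (Pf \<psi>)) t)
        \<le> 1/2 * dist \<phi> \<psi>" .
    qed
  qed auto
  then obtain \<phi> where fp: "Bcontfun (Pf \<phi>) = \<phi>" by blast
  define y where "y = apply_bcontfun \<phi>"
  have y: "y t = y0 + integral {T..cl t} (G \<phi>)" for t using app[of \<phi> t] unfolding fp by (simp add: y_def Pf_def)
  have yb: "y t \<in> cball y0 r" for t using Gint[OF cl(2)] by (simp add: y dist_norm)
  have yc: "continuous_on A y" for A
    unfolding y_def using apply_bcontfun[of \<phi>] by (auto simp: bcontfun_def intro: continuous_on_subset)
  have "(y has_vector_derivative F t (y t)) (at t)" if t: "t \<in> {T<..<T+\<delta>}" for t
  proof -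
    have "((\<lambda>u. integral {T..u} (G \<phi>)) has_vector_derivative G \<phi> t) (at t within {T..T+\<delta>})"
      using t by (intro integral_has_vector_derivative Gc) auto
    then have "((\<lambda>u. integral {T..u} (G \<phi>)) has_vector_derivative G \<phi> t) (at t)"
      using t at_within_interior[of t "{T..T+\<delta>}"] by (simp add: interior_atLeastAtMost_real)
    then have "((\<lambda>u. y0 + integral {T..u} (G \<phi>)) has_vector_derivative G \<phi> t) (at t)"
      by (auto intro: derivative_eq_intros)
    then have "(y has_vector_derivative G \<phi> t) (at t)"
      by (rule has_vector_derivative_transform_within_open[of _ _ _ "{T<..<T+\<delta>}"]) (use t in \<open>auto simp: y clid\<close>)
    then show ?thesis using t prid[OF yb] by (simp add: G_def clid y_def)
  qed
  moreover have "y T = y0" using \<delta> by (simp add: y clid)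
  ultimately show ?thesis using that[OF \<delta>(1,2) yc] by blast
qed

subsection \<open>Change of the supply rate\<close>

lemma Limsup_at_right_0_boundD:
  fixes g :: "real \<Rightarrow> real"
  assumes "Limsup (at_right 0) (\<lambda>s. ereal (g s)) < \<infinity>"
  obtains C \<delta> where "0 < \<delta>" "0 \<le> C" "\<And>s. 0 < s \<Longrightarrow> s < \<delta> \<Longrightarrow> g s \<le> C"
proof -
  obtain r where "Limsup (at_right 0) (\<lambda>s. ereal (g s)) < ereal r"
    using ereal_dense2[OF assms] by blast
  from Limsup_lessD[OF this] obtain \<delta> where "\<delta> > 0" "\<And>s. 0 < s \<Longrightarrow> s < \<delta> \<Longrightarrow> g s < r"
    by (auto simp: eventually_at_right_field)
  then show ?thesis using that[of \<delta> "\<bar>r\<bar>"] by fastforce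
qed

lemma class_KinfD:
  assumes "class_Kinf a"
  shows "continuous_on {0..} a" "a 0 = 0"
    "\<And>r s. 0 \<le> r \<Longrightarrow> r \<le> s \<Longrightarrow> a r \<le> a s" "\<And>r. 0 < r \<Longrightarrow> 0 < a r" "\<And>r. 0 \<le> r \<Longrightarrow> 0 \<le> a r"
    "\<exists>R>0. \<forall>r\<ge>R. y < a r"
proof -
  show "continuous_on {0..} a" "a 0 = 0" using assms by (auto simp: class_Kinf_def)
  have sm: "strict_mono_on {0..} a" using assms by (simp add: class_Kinf_def)
  show m: "\<And>r s. 0 \<le> r \<Longrightarrow> r \<le> s \<Longrightarrow> a r \<le> a s"
    using strict_mono_on_leD[OF sm] by auto
  show "\<And>r. 0 < r \<Longrightarrow> 0 < a r"
    using strict_mono_onD[OF sm, of 0] \<open>a 0 = 0\<close> by auto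
  show "\<And>r. 0 \<le> r \<Longrightarrow> 0 \<le> a r" using m[of 0] \<open>a 0 = 0\<close> by auto
  have "eventually (\<lambda>r. y < a r) at_top"
    using assms by (simp add: class_Kinf_def filterlim_at_top_dense)
  then obtain N where "\<forall>r\<ge>N. y < a r" by (auto simp: eventually_at_top_linorder)
  then show "\<exists>R>0. \<forall>r\<ge>R. y < a r" by (intro exI[of _ "max N 1"]) auto
qed

text \<open>The supply rate is made quadratic by passing to \<open>U = V * H V\<close>. The unknown factor of
  \<open>sigma\<close> enters nonlinearly; it is separated from \<open>sigma\<close> by \<open>2 p \<sigma> \<le> max (4 p\<^sup>2) (\<sigma>\<^sup>2)\<close>.\<close>

lemma change_of_supply:
  fixes m1 :: "real ^ 'p \<Rightarrow> real" and alow aup alpha sigma :: "real \<Rightarrow> real"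
  assumes K: "class_Kinf alow" "class_Kinf aup" "class_Kinf alpha" "class_Kinf (\<lambda>s. p0 * sigma s)"
    and lim: "Limsup (at_right 0) (\<lambda>s. ereal (s\<^sup>2 / alpha s)) < \<infinity>"
      "Limsup (at_right 0) (\<lambda>s. ereal (p0 * sigma s / s\<^sup>2)) < \<infinity>"
    and m1: "continuous_on UNIV m1"
  obtains \<phi> a2 where "\<And>n::nat. bdd_above (\<phi> ` {- real n..real n})" "\<And>x. 0 \<le> \<phi> x"
    "continuous_on {0..} a2" "a2 0 = 0" "mono_on {0..} a2"
    "\<forall>V q (D :: (real ^ 'l) set) p. ISS_Lyapunov V alow aup alpha (\<lambda>s. p * sigma s) q D \<longrightarrow>
      (\<exists>U p'. 0 \<le> p' \<and> (\<forall>z. U differentiable (at z)) \<and>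
        (\<forall>z. alow (norm z) \<le> U z \<and> U z \<le> a2 (norm z)) \<and>
        (\<forall>z x d. d \<in> D \<longrightarrow> frechet_derivative U (at z) (q z x d)
          \<le> - (m1 z * norm z)\<^sup>2 + p' * (\<phi> x * x\<^sup>2)))"
proof -
  note Kl = class_KinfD[OF K(1)] and Ku = class_KinfD[OF K(2)] and Ka = class_KinfD[OF K(3)]
    and Ks = class_KinfD[OF K(4)]
  obtain C1 \<delta>1 where C1: "0 < \<delta>1" "0 \<le> C1" "\<And>s. 0 < s \<Longrightarrow> s < \<delta>1 \<Longrightarrow> s\<^sup>2 / alpha s \<le> C1"
    by (rule Limsup_at_right_0_boundD[OF lim(1)]) blast
  \<comment> \<open>For \<open>z \<noteq> 0\<close>, \<open>g z \<le> \<xi> (V z)\<close> says that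
    half of the decay \<open>\<xi> (V z) * alpha (norm z)\<close> pays for
    \<open>(m1 z * norm z)\<^sup>2\<close>. The limit condition on
    \<open>s\<^sup>2 / alpha s\<close> keeps \<open>g\<close> bounded near the origin.\<close>
  define g where "g = (\<lambda>z. 2 * (m1 z * norm z)\<^sup>2 / alpha (norm z))"
  have gb: "\<exists>B. \<forall>z. norm z \<le> R \<longrightarrow> g z \<le> B" for R
  proof -
    have "compact (m1 ` cball 0 R)"
      by (intro compact_continuous_image continuous_on_subset[OF m1]) auto
    from compact_imp_bounded[OF this] obtain M where "\<forall>z\<in>cball 0 R. \<bar>m1 z\<bar> \<le> M"
      by (auto simp: bounded_iff)
    then have M: "\<bar>m1 z\<bar> \<le> M" if "norm z \<le> R" for z using that by simp
    have "g z \<le> 2 * M\<^sup>2 * C1 + 2 * (M * R)\<^sup>2 / alpha \<delta>1" if z: "norm z \<le> R" for z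
    proof -
      have m: "(m1 z)\<^sup>2 \<le> M\<^sup>2" using M[OF z] by (metis abs_ge_zero power2_abs power_mono)
      have nn: "0 \<le> 2 * M\<^sup>2 * C1" "0 \<le> 2 * (M * R)\<^sup>2 / alpha \<delta>1" using C1 Ka(4)[of \<delta>1] by auto
      consider "z = 0" | "0 < norm z" "norm z < \<delta>1" | "\<delta>1 \<le> norm z" by force
      then show ?thesis
      proof cases
        case 1
        then show ?thesis using nn by (simp add: g_def)
      next
        case 2
        have "g z = 2 * (m1 z)\<^sup>2 * ((norm z)\<^sup>2 / alpha (norm z))" by (simp add: g_def power_mult_distrib)
        also have "\<dots> \<le> 2 * M\<^sup>2 * C1" using C1(3)[OF 2] m 2 Ka(4)[of "norm z"] by (intro mult_mono) auto
        finally show ?thesis using nn by simp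
      next
        case 3
        have "(m1 z * norm z)\<^sup>2 \<le> (M * R)\<^sup>2"
          unfolding power_mult_distrib by (intro mult_mono[OF m power_mono[OF z]]) auto
        moreover have "0 < alpha \<delta>1" "alpha \<delta>1 \<le> alpha (norm z)" using C1 Ka(3,4) 3 by auto
        ultimately have "g z \<le> 2 * (M * R)\<^sup>2 / alpha \<delta>1" unfolding g_def by (intro frac_le) auto
        then show ?thesis using nn by linarith
      qed
    qed
    then show ?thesis by blast
  qed
  \<comment> \<open>Contains every \<open>z\<close> with \<open>V z = v\<close>, for whichever
    \<open>V\<close> lies above \<open>alow\<close>; the supremum \<open>F1\<close> over it thus
    does not depend on \<open>V\<close>.\<close>
  define S1 where "S1 = (\<lambda>v::real. {z :: real ^ 'p. alow (norm z) \<le> \<bar>v\<bar>})"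
  have S1g: "\<exists>B. \<forall>z\<in>S1 v. g z \<le> B" for v
  proof -
    obtain R where "\<forall>r\<ge>R. \<bar>v\<bar> < alow r" using Kl(6)[of "\<bar>v\<bar>"] by blast
    then have "norm z \<le> R" if "z \<in> S1 v" for z
      using that by (cases "R \<le> norm z") (auto simp: S1_def)
    then show ?thesis using gb[of R] by blast
  qed
  define F1 where "F1 = (\<lambda>v. SUP z\<in>S1 v. g z)"
  have F1: "g z \<le> F1 v" if "z \<in> S1 v" for z v
    unfolding F1_def using S1g[of v] that by (intro cSUP_upper) (auto simp: bdd_above_def)
  have "bdd_above (F1 ` {- real n..real n})" for n
  proof -
    obtain B where B: "\<forall>z\<in>S1 (real n). g z \<le> B" using S1g by blast
    have "F1 v \<le> B" if "v \<in> {- real n..real n}" for v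
      unfolding F1_def using that B Kl(2) by (intro cSUP_least) (auto simp: S1_def intro: exI[of _ 0])
    then show ?thesis by (rule bdd_aboveI2)
  qed
  then obtain H H' where H: "\<And>x. (H has_real_derivative H' x) (at x)" "continuous_on UNIV H'"
    "\<And>x y. \<bar>x\<bar> \<le> \<bar>y\<bar> \<Longrightarrow> H x \<le> H y" "\<And>x. 1 \<le> H x" "\<And>x. F1 x \<le> H x"
    by (rule smooth_majorant[where 'a = real]) blast
  have Hc: "continuous_on A H" for A using H(1) by (meson DERIV_isCont continuous_at_imp_continuous_on)
  \<comment> \<open>The derivative of \<open>v * H v\<close>, hence the factor by which the rate of
    \<open>V\<close> is multiplied in \<open>U\<close>.\<close>
  define \<xi> where "\<xi> = (\<lambda>v. H v + v * H' v)"
  have \<xi>c: "continuous_on A \<xi>" for A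
    unfolding \<xi>_def by (intro continuous_intros Hc continuous_on_subset[OF H(2)]) auto
  have \<xi>H: "H v \<le> \<xi> v" if "0 \<le> v" for v
  proof (cases "v = 0")
    case False
    then have "0 \<le> H' v" using that H(3)
      by (intro mono_on_imp_deriv_nonneg[of "{0..}" H _ v] H(1)) (auto simp: mono_on_def)
    then show ?thesis using that by (simp add: \<xi>_def)
  qed (simp add: \<xi>_def)
  \<comment> \<open>Contains every value that \<open>V z\<close> can take while
    \<open>alpha (norm z) \<le> \<bar>a\<bar>\<close>, again for any \<open>V\<close> below
    \<open>aup\<close>.\<close>
  define S2 where "S2 = (\<lambda>a. {v. 0 \<le> v \<and> (\<exists>r\<ge>0. alpha r \<le> \<bar>a\<bar> \<and> v \<le> aup r)})"
  have S2\<xi>: "\<exists>B. \<forall>v\<in>S2 a. \<xi> v \<le> B" for a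
  proof -
    obtain R where R: "\<forall>r\<ge>R. \<bar>a\<bar> < alpha r" using Ka(6)[of "\<bar>a\<bar>"] by blast
    have "v \<in> {0..aup R}" if v: "v \<in> S2 a" for v
    proof -
      obtain r where r: "0 \<le> v" "r \<ge> 0" "alpha r \<le> \<bar>a\<bar>" "v \<le> aup r" using v by (auto simp: S2_def)
      then have "r \<le> R" using R by (force simp: not_less[symmetric])
      then show ?thesis using r Ku(3)[of r R] by auto
    qed
    moreover have "\<exists>B. \<forall>v\<in>{0..aup R}. \<xi> v \<le> B"
    proof -
      have "compact (\<xi> ` {0..aup R})" by (intro compact_continuous_image \<xi>c) auto
      from compact_imp_bounded[OF this] show ?thesis by (auto simp: bounded_iff abs_le_iff)
    qed
    ultimately show ?thesis by blast
  qed
  define F2 where "F2 = (\<lambda>a. SUP v\<in>S2 a. \<xi> v)"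
  have F2: "\<xi> v \<le> F2 a" if "v \<in> S2 a" for v a
    unfolding F2_def using S2\<xi>[of a] that by (intro cSUP_upper) (auto simp: bdd_above_def)
  have z2: "0 \<in> S2 a" for a using Ka(2) Ku(2) by (auto simp: S2_def)
  have F21: "1 \<le> F2 a" for a using F2[OF z2, of a] H(4)[of 0] by (simp add: \<xi>_def)
  have F2mono: "F2 a \<le> F2 b" if "\<bar>a\<bar> \<le> \<bar>b\<bar>" for a b
  proof -
    have "S2 a \<subseteq> S2 b" using that by (force simp: S2_def)
    then show ?thesis unfolding F2_def[of ] using z2 F2 unfolding F2_def by (intro cSUP_least) blast+
  qed
  have p0: "p0 \<noteq> 0" using Ks(4)[of 1] by auto
  have sig0: "sigma 0 = 0" using Ks(2) p0 by simp
  \<comment> \<open>Only the product of the unknown factor and \<open>sigma\<close> is of class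
    K-infinity, so both factors may be negative; the product equals
    \<open>\<bar>p\<bar> * sg x\<close> in either case.\<close>
  define sg where "sg = (\<lambda>x. \<bar>sigma \<bar>x\<bar>\<bar>)"
  have sgnn: "0 \<le> sg x" for x by (simp add: sg_def)
  have sgp: "sg x = (p0 * sigma \<bar>x\<bar>) / \<bar>p0\<bar>" for x
    using Ks(5)[of "\<bar>x\<bar>"] p0 by (simp add: sg_def field_simps abs_mult[symmetric])
  obtain C2 \<delta>2 where C2: "0 < \<delta>2" "0 \<le> C2" "\<And>s. 0 < s \<Longrightarrow> s < \<delta>2 \<Longrightarrow> p0 * sigma s / s\<^sup>2 \<le> C2"
    by (rule Limsup_at_right_0_boundD[OF lim(2)]) blast
  \<comment> \<open>Dividing by \<open>x\<^sup>2\<close> prepares the quadratic supply rate. The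
    second limit condition makes the quotient bounded near 0; at 0 it is 0 by the convention for
    division.\<close>
  define \<phi> where "\<phi> = (\<lambda>x. F2 ((sg x)\<^sup>2) * (sg x / x\<^sup>2))"
  have \<phi>nn: "0 \<le> \<phi> x" for x
    unfolding \<phi>_def using F21[of "(sg x)\<^sup>2"] sgnn by (intro mult_nonneg_nonneg divide_nonneg_nonneg) auto
  have "bdd_above (\<phi> ` {- real n..real n})" for n
  proof -
    define B where "B = sg (real n)"
    have sgB: "sg x \<le> B" if "\<bar>x\<bar> \<le> real n" for x
      unfolding B_def sgp using Ks(3)[of "\<bar>x\<bar>" "real n"] that by (intro divide_right_mono) auto
    have le: "\<phi> x \<le> F2 (B\<^sup>2) * (C2 / \<bar>p0\<bar> + B / \<delta>2\<^sup>2)" if "\<bar>x\<bar> \<le> real n" for x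
      unfolding \<phi>_def
    proof (intro mult_mono)
      show "F2 ((sg x)\<^sup>2) \<le> F2 (B\<^sup>2)"
        using sgB[OF that] sgnn[of x] by (intro F2mono) (auto intro!: power_mono)
      have nn: "0 \<le> C2 / \<bar>p0\<bar>" "0 \<le> B / \<delta>2\<^sup>2" using C2 sgnn by (auto simp: B_def)
      consider "x = 0" | "0 < \<bar>x\<bar>" "\<bar>x\<bar> < \<delta>2" | "\<delta>2 \<le> \<bar>x\<bar>" by force
      then show "sg x / x\<^sup>2 \<le> C2 / \<bar>p0\<bar> + B / \<delta>2\<^sup>2"
      proof cases
        case 1
        then show ?thesis using nn by simp
      next
        case 2
        have "sg x / x\<^sup>2 = (p0 * sigma \<bar>x\<bar> / \<bar>x\<bar>\<^sup>2) / \<bar>p0\<bar>" by (simp add: sgp)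
        also have "\<dots> \<le> C2 / \<bar>p0\<bar>" using C2(3)[OF 2] by (intro divide_right_mono) auto
        finally show ?thesis using nn by simp
      next
        case 3
        then have "\<delta>2\<^sup>2 \<le> x\<^sup>2" using C2 by (simp add: abs_le_square_iff[symmetric])
        then have "sg x / x\<^sup>2 \<le> B / \<delta>2\<^sup>2"
          using C2 sgB[OF that] sgnn[of "real n"] by (intro frac_le) (auto simp: B_def)
        then show ?thesis using nn by linarith
      qed
    qed (use F21[of "B\<^sup>2"] sgnn in auto)
    show ?thesis by (rule bdd_aboveI2[OF le]) (auto simp: abs_le_iff)
  qed
  moreover define a2 where "a2 = (\<lambda>r. aup r * H (aup r))"
  have "continuous_on {0..} a2"
    unfolding a2_def by (intro continuous_intros Ku(1) continuous_on_compose2[OF Hc Ku(1)]) auto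
  moreover have "a2 0 = 0" by (simp add: a2_def Ku(2))
  moreover have \<Xi>mono: "v * H v \<le> w * H w" if "0 \<le> v" "v \<le> w" for v w
    using that H(3)[of v w] H(4)[of v] by (intro mult_mono) auto
  then have "mono_on {0..} a2" unfolding a2_def mono_on_def using Ku(3,5) by auto
  moreover have "\<exists>U p'. 0 \<le> p' \<and> (\<forall>z. U differentiable (at z)) \<and>
        (\<forall>z. alow (norm z) \<le> U z \<and> U z \<le> a2 (norm z)) \<and>
        (\<forall>z x d. d \<in> D \<longrightarrow> frechet_derivative U (at z) (q z x d)
          \<le> - (m1 z * norm z)\<^sup>2 + p' * (\<phi> x * x\<^sup>2))"
    if iss: "ISS_Lyapunov V alow aup alpha (\<lambda>s. p * sigma s) q D" for V q p and D :: "(real ^ 'l) set"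
  proof -
    have V: "C_k 1 V" "0 \<le> V z" "alow (norm z) \<le> V z" "V z \<le> aup (norm z)"
      "d \<in> D \<Longrightarrow> frechet_derivative V (at z) (q z x d) \<le> - alpha (norm z) + p * sigma \<bar>x\<bar>" for z x d
      using iss by (auto simp: ISS_Lyapunov_def)
    have Kp: "class_Kinf (\<lambda>s. p * sigma s)" using iss by (auto simp: ISS_Lyapunov_def)
    have psg: "p * sigma \<bar>x\<bar> = \<bar>p\<bar> * sg x" for x
      using class_KinfD(5)[OF Kp, of "\<bar>x\<bar>"] by (simp add: sg_def abs_mult[symmetric])
    define U where "U = (\<lambda>z. V z * H (V z))"
    define p' where "p' = 2 * F2 (4 * p\<^sup>2) * \<bar>p\<bar>"
    have dU: "(U has_derivative (\<lambda>h. \<xi> (V z) * frechet_derivative V (at z) h)) (at z)" for z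
    proof -
      have "((\<lambda>v. v * H v) has_real_derivative \<xi> (V z)) (at (V z))"
        using DERIV_mult[OF DERIV_ident H(1)] by (simp add: \<xi>_def add.commute mult.commute)
      then have "((\<lambda>v. v * H v) has_derivative (*) (\<xi> (V z))) (at (V z))" by (simp add: has_field_derivative_def)
      from diff_chain_at[OF C_k_1D(1)[OF V(1)] this] show ?thesis by (simp add: U_def o_def)
    qed
    have "frechet_derivative U (at z) (q z x d) \<le> - (m1 z * norm z)\<^sup>2 + p' * (\<phi> x * x\<^sup>2)"
      if d: "d \<in> D" for z x d
    proof -
      let ?a = "alpha (norm z)" and ?s = "\<bar>p\<bar> * sg x"
      have a: "0 \<le> ?a" using Ka(5) by simp
      have \<xi>1: "1 \<le> \<xi> (V z)" using \<xi>H[OF V(2)] H(4) order_trans by blast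
      have main: "(m1 z * norm z)\<^sup>2 \<le> \<xi> (V z) * (?a / 2)"
      proof (cases "z = 0")
        case True
        then show ?thesis using Ka(2) by simp
      next
        case False
        then have a0: "0 < ?a" using Ka(4) by simp
        have "g z \<le> F1 (V z)" using F1[of z "V z"] V(2,3) by (simp add: S1_def)
        also have "\<dots> \<le> \<xi> (V z)" using H(5) \<xi>H[OF V(2)] order_trans by blast
        finally show ?thesis using a0 by (simp add: g_def field_simps)
      qed
      have sx: "sg x = sg x / x\<^sup>2 * x\<^sup>2" using sig0 by (cases "x = 0") (auto simp: sg_def)
      have p'nn: "0 \<le> p'" using F21[of "4 * p\<^sup>2"] by (simp add: p'_def)
      have "frechet_derivative U (at z) (q z x d) = \<xi> (V z) * frechet_derivative V (at z) (q z x d)"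
        by (simp add: frechet_derivative_at[OF dU, symmetric])
      also have "\<dots> \<le> \<xi> (V z) * (- ?a + ?s)"
        using V(5)[OF d, of z x] psg[of x] \<xi>1 by (intro mult_left_mono) auto
      also have "\<dots> \<le> - (m1 z * norm z)\<^sup>2 + p' * (\<phi> x * x\<^sup>2)"
      proof (cases "?s \<le> ?a / 2")
        case True
        then have "\<xi> (V z) * (- ?a + ?s) \<le> \<xi> (V z) * (- (?a / 2))" using \<xi>1 by (intro mult_left_mono) auto
        moreover have "0 \<le> p' * (\<phi> x * x\<^sup>2)" by (intro mult_nonneg_nonneg p'nn \<phi>nn) simp
        ultimately show ?thesis using main unfolding mult_minus_right by linarith
      next
        case False
        then have lt: "?a \<le> 2 * \<bar>p\<bar> * sg x" by simp
        have "\<xi> (V z) \<le> F2 (4 * p\<^sup>2) + F2 ((sg x)\<^sup>2)"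
        proof (cases "sg x \<le> 2 * \<bar>p\<bar>")
          case True
          then have "2 * \<bar>p\<bar> * sg x \<le> 2 * \<bar>p\<bar> * (2 * \<bar>p\<bar>)" by (intro mult_left_mono) auto
          then have "?a \<le> \<bar>4 * p\<^sup>2\<bar>" using lt by (simp add: power2_eq_square)
          then have "V z \<in> S2 (4 * p\<^sup>2)" using V(2,4)[of z] by (auto simp: S2_def intro!: exI[of _ "norm z"])
          from F2[OF this] show ?thesis using F21[of "(sg x)\<^sup>2"] by linarith
        next
          case False
          then have "2 * \<bar>p\<bar> * sg x \<le> sg x * sg x" using sgnn by (intro mult_right_mono) auto
          then have "?a \<le> \<bar>(sg x)\<^sup>2\<bar>" using lt by (simp add: power2_eq_square)
          then have "V z \<in> S2 ((sg x)\<^sup>2)" using V(2,4)[of z] by (auto simp: S2_def intro!: exI[of _ "norm z"])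
          from F2[OF this] show ?thesis using F21[of "4 * p\<^sup>2"] by linarith
        qed
        \<comment> \<open>Both values are at least 1, so their sum is at most twice their product.
          The product form lets the value at \<open>4 * p\<^sup>2\<close> go into the unknown
          constant \<open>p'\<close> and the value at \<open>(sg x)\<^sup>2\<close> into the known
          \<open>\<phi>\<close>.\<close>
        also have "\<dots> \<le> 2 * F2 (4 * p\<^sup>2) * F2 ((sg x)\<^sup>2)"
        proof -
          have "u + v \<le> 2 * u * v" if "1 \<le> u" "1 \<le> v" for u v :: real
            using mult_left_mono[of 1 v u] mult_right_mono[of 1 u v] that by linarith
          then show ?thesis using F21 by blast
        qed
        finally have "\<xi> (V z) * ?s \<le> 2 * F2 (4 * p\<^sup>2) * F2 ((sg x)\<^sup>2) * ?s"
          using sgnn by (intro mult_right_mono) auto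
        also have "\<dots> = p' * (F2 ((sg x)\<^sup>2) * sg x)" by (simp add: p'_def)
        also have "\<dots> = p' * (\<phi> x * x\<^sup>2)" by (subst (2) sx) (simp add: \<phi>_def)
        finally have "\<xi> (V z) * ?s \<le> p' * (\<phi> x * x\<^sup>2)" .
        moreover have "\<xi> (V z) * (?a / 2) \<le> \<xi> (V z) * ?a" using a \<xi>1 by (intro mult_left_mono) auto
        ultimately show ?thesis using main unfolding distrib_left mult_minus_right by linarith
      qed
      finally show ?thesis .
    qed
    moreover have "0 \<le> p'" using F21[of "4 * p\<^sup>2"] by (simp add: p'_def)
    moreover have "U differentiable (at z)" for z using dU by (auto simp: differentiable_def)
    moreover have "alow (norm z) \<le> U z \<and> U z \<le> a2 (norm z)" for z
    proof
      have "V z * 1 \<le> V z * H (V z)" using V(2) H(4) by (intro mult_left_mono) auto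
      then show "alow (norm z) \<le> U z" using V(3)[of z] by (simp add: U_def)
      show "U z \<le> a2 (norm z)" unfolding U_def a2_def by (rule \<Xi>mono[OF V(2,4)])
    qed
    ultimately show ?thesis by blast
  qed
  ultimately show ?thesis using that[of \<phi> a2] \<phi>nn by blast
qed

subsection \<open>Closed-loop trajectories\<close>

lemma sample_time_cases:
  assumes "0 < T"
  obtains "sample_time rho gam T x th k = \<infinity>"
  | s where "0 \<le> s" "sample_time rho gam T x th k = ereal s" "ereal s < T"
proof -
  let ?ts = "sample_time rho gam T x th"
  have "?ts k = \<infinity> \<or> (\<exists>s\<ge>0. ?ts k = ereal s \<and> ereal s < T)"
  proof (induction k)
    case 0
    then show ?case using assms by (auto simp: zero_ereal_def)
  next
    case (Suc k)
    show ?case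
    proof (cases "?ts k = \<infinity>")
      case False
      then obtain s where s: "0 \<le> s" "?ts k = ereal s" using Suc by auto
      let ?A = "{t. s \<le> t \<and> ereal t < T \<and> trigger rho gam x th s t}"
      have eq: "?ts (Suc k) = Inf (ereal ` ?A)" using s by (simp add: Let_def)
      show ?thesis
      proof (cases "?A = {}")
        case True
        show ?thesis unfolding eq True by (simp add: top_ereal_def)
      next
        case False
        then obtain t where t: "t \<in> ?A" by blast
        have le: "Inf (ereal ` ?A) \<le> ereal t" using t by (intro Inf_lower) auto
        moreover have ge: "ereal s \<le> Inf (ereal ` ?A)" by (intro Inf_greatest) auto
        ultimately obtain v where v: "Inf (ereal ` ?A) = ereal v"
          by (cases "Inf (ereal ` ?A)") auto
        then have "s \<le> v" "v \<le> t" using le ge by simp_all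
        moreover have "ereal v < T" using \<open>v \<le> t\<close> t by (auto intro: le_less_trans[of _ "ereal t"])
        ultimately show ?thesis unfolding eq v using s(1) by auto
      qed
    qed simp
  qed
  then show ?thesis using that by blast
qed

lemma sample_time_Suc_eq:
  assumes "sample_time rho gam T x th k = ereal s"
  shows "sample_time rho gam T x th (Suc k)
    = Inf (ereal ` {t. s \<le> t \<and> ereal t < T \<and> trigger rho gam x th s t})"
  using assms by (simp add: Let_def)

lemma sample_time_le_Suc: "0 < T \<Longrightarrow> sample_time rho gam T x th k \<le> sample_time rho gam T x th (Suc k)"
  by (rule sample_time_cases[of T rho gam x th k])
    (auto simp: sample_time_Suc_eq simp del: sample_time.simps(2) intro!: Inf_greatest, simp)

lemma sample_time_mono: "0 < T \<Longrightarrow> j \<le> k \<Longrightarrow> sample_time rho gam T x th j \<le> sample_time rho gam T x th k"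
  using lift_Suc_mono_le[of "sample_time rho gam T x th"] sample_time_le_Suc by blast

lemma sample_time_index_unique:
  assumes "0 < T" "sample_time rho gam T x th j \<le> t" "t < sample_time rho gam T x th (Suc j)"
    "sample_time rho gam T x th k \<le> t" "t < sample_time rho gam T x th (Suc k)"
  shows "j = k"
proof (rule ccontr)
  assume "j \<noteq> k"
  then consider "Suc j \<le> k" | "Suc k \<le> j" by linarith
  then show False
    by cases (use sample_time_mono[OF assms(1)] assms in \<open>meson leD order_trans\<close>)+
qed

lemma not_trigger_before_next_sample:
  assumes "sample_time rho gam T x th k = ereal s" "s \<le> t" "ereal t < T"
    "ereal t < sample_time rho gam T x th (Suc k)"
  shows "\<not> trigger rho gam x th s t"
proof
  assume "trigger rho gam x th s t"
  then have "sample_time rho gam T x th (Suc k) \<le> ereal t"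
    unfolding sample_time_Suc_eq[OF assms(1)] using assms by (intro Inf_lower) auto
  then show False using assms(4) by simp
qed

text \<open>The inequalities are those consumed by the estimate of the sampling error
  \<open>w\<close>. \<open>E\<close> dominates the coefficients in the derivative of
  \<open>w\<close>. Of the conditions on \<open>gam\<close>, the third controls the part of that
  derivative proportional to \<open>w\<close>, the fourth makes \<open>b * \<bar>u\<bar>\<close>
  times the elapsed time small, and the fifth does the same for the squared coefficient of the
  remaining part, up to a constant. All of \<open>rho\<close>, \<open>E\<close>, \<open>gam\<close>
  are constrained through known data only, while \<open>b\<close>, \<open>c\<close>,
  \<open>p\<close> are free.\<close>

locale closed_loop =
  fixes q :: "real ^ 'p \<Rightarrow> real \<Rightarrow> real ^ 'l \<Rightarrow> real ^ 'p"
    and f :: "real ^ 'p \<Rightarrow> real \<Rightarrow> real ^ 'l \<Rightarrow> real"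
    and D :: "(real ^ 'l) set" and d :: "real \<Rightarrow> real ^ 'l"
    and b lam c p bbar :: real
    and rho rho' :: "real \<Rightarrow> real" and gam :: "real \<Rightarrow> real \<Rightarrow> real \<Rightarrow> real" and E :: "real \<Rightarrow> real"
    and m1 :: "real ^ 'p \<Rightarrow> real" and m2 :: "real \<Rightarrow> real"
    and U :: "real ^ 'p \<Rightarrow> real" and alow a2 :: "real \<Rightarrow> real"
  assumes lam: "0 < lam" and b: "0 < b" "b \<le> bbar" and c: "0 \<le> c" and p: "0 \<le> p"
    and D: "compact D" "admissible D d"
    and qf: "C_k 1 (\<lambda>(z, x, d). q z x d)" "C_k 1 (\<lambda>(z, x, d). f z x d)"
    and f_bound: "\<And>z x d. d \<in> D \<Longrightarrow> \<bar>f z x d\<bar> \<le> c * m1 z * norm z + c * m2 x * \<bar>x\<bar>"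
    and m1: "continuous_on UNIV m1" "\<And>z. 0 < m1 z"
    and m2: "continuous_on UNIV m2" "\<And>x. 0 < m2 x"
    and rho: "\<And>x. (rho has_real_derivative rho' x) (at x)" "continuous_on UNIV rho'"
      "\<And>x. 1 \<le> rho x" "\<And>x. (m2 x)\<^sup>2 \<le> rho x"
    and E: "\<And>x y. \<bar>x\<bar> \<le> \<bar>y\<bar> \<Longrightarrow> E x \<le> E y" "\<And>x. 1 \<le> E x"
      "\<And>x. (1 + \<bar>rho x + x * rho' x\<bar>) * (1 + m2 x + rho x) * (1 + rho x * x\<^sup>2) \<le> E x"
    and gam: "continuous_on UNIV (\<lambda>(x, th, w). gam x th w)" "\<And>x th w. 1 \<le> gam x th w"
      "\<And>x th w. (bbar * th * (rho x + x * rho' x))\<^sup>2 \<le> gam x th w"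
      "\<And>x th w. bbar * (\<bar>w\<bar> + \<bar>th * rho x * x\<bar>) \<le> gam x th w"
      "\<And>x th w. ((1 + th\<^sup>2) * E (2 * (2 * \<bar>w\<bar> + \<bar>th * rho x * x\<bar> + \<bar>x\<bar>)))\<^sup>2 \<le> gam x th w"
    and U: "\<And>z. U differentiable (at z)" "\<And>z. alow (norm z) \<le> U z" "\<And>z. U z \<le> a2 (norm z)"
      "\<And>z x d. d \<in> D \<Longrightarrow> frechet_derivative U (at z) (q z x d) \<le> - (m1 z * norm z)\<^sup>2 + p * (rho x * x\<^sup>2)"
    and alow: "class_Kinf alow"
    and a2: "continuous_on {0..} a2" "a2 0 = 0" "mono_on {0..} a2"
begin

lemma U_nonneg: "0 \<le> U z"
  using class_KinfD(5)[OF alow, of "norm z"] U(2)[of z] by simp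

lemma U_continuous: "continuous_on A U"
  using U(1) by (meson continuous_at_imp_continuous_on differentiable_imp_continuous_within)

lemma rho_continuous: "continuous_on A rho"
  using rho(1) by (meson DERIV_isCont continuous_at_imp_continuous_on)

text \<open>The factor by which the integral of \<open>en\<close> bounds the squared maximum of the
  sampling error. \<open>M1\<close> bounds the energy spent while the gain is at most 1,
  \<open>c * (1 + M1) + 1\<close> the resulting displacement of \<open>x\<close>, and
  \<open>N\<close> accounts for \<open>1 + th\<^sup>2\<close> not being monotone when the gain
  starts negative.\<close>

definition coupling :: "real \<Rightarrow> real \<Rightarrow> real" where
  "coupling M1 N = 2 * ((c + bbar + lam) * N * E (2 * (c * (1 + M1) + 1)))\<^sup>2"

text \<open>\<open>C / 2\<close> compensates the sampling error, 1 is the decay that remains, and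
  \<open>1 / 2\<close> pays for the cross term between \<open>x\<close> and
  \<open>f\<close>.\<close>

definition weight :: "real \<Rightarrow> real" where
  "weight C = C / 2 + 3 / 2"

text \<open>\<open>b\<close> times this collects every coefficient of
  \<open>rho x * x\<^sup>2\<close>: the supply of the weighted \<open>U\<close>, the bounds for
  \<open>x * f\<close> and for \<open>b * x * w\<close>, and the required decay
  \<open>C / 2 + 1\<close>.\<close>

definition gain_threshold :: "real \<Rightarrow> real" where
  "gain_threshold C = (weight C * p + c\<^sup>2 / 2 + c + b\<^sup>2 / 2 + C / 2 + 1) / b"

lemma coupling_nonneg: "0 \<le> coupling M1 N"
  by (simp add: coupling_def)

end

section \<open>Energy and gain along one trajectory\<close>

locale trajectory = closed_loop +
  fixes T :: ereal and z :: "real \<Rightarrow> real ^ 'a" and x th :: "real \<Rightarrow> real"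
  assumes sol: "solution q f b lam rho gam d T z x th"
begin

abbreviation ts :: "nat \<Rightarrow> ereal" where "ts \<equiv> sample_time rho gam T x th"

definition en :: "real \<Rightarrow> real" where
  "en t = (m1 (z t) * norm (z t))\<^sup>2 + rho (x t) * (x t)\<^sup>2"

lemma T_pos: "0 < T"
  using sol by (simp add: solution_def Let_def)

lemma continuous:
  assumes "ereal t < T" "0 \<le> s"
  shows "continuous_on {s..t} z" "continuous_on {s..t} x" "continuous_on {s..t} th"
proof -
  have "{s..t} \<subseteq> {t. 0 \<le> t \<and> ereal t < T}"
    using assms by (auto intro: le_less_trans[of _ "ereal t"])
  then show "continuous_on {s..t} z" "continuous_on {s..t} x" "continuous_on {s..t} th"
    using sol unfolding solution_def Let_def by (auto intro: continuous_on_subset)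
qed

lemma in_sampling_interval:
  assumes "0 \<le> t" "ereal t < T"
  obtains k s where "ts k = ereal s" "0 \<le> s" "s \<le> t" "ereal t < ts (Suc k)"
proof -
  obtain k where k: "ts k \<le> ereal t" "ereal t < ts (Suc k)"
    using sol assms unfolding solution_def Let_def by blast
  show ?thesis
    by (rule sample_time_cases[OF T_pos, of rho gam x th k]) (use k that in auto)
qed

lemma exceptional_times:
  obtains S where "\<And>s. 0 \<le> s \<Longrightarrow> ereal s < T \<Longrightarrow> finite (S \<inter> {0..s})"
    "\<And>r k. 0 \<le> r \<Longrightarrow> ereal r < T \<Longrightarrow> r \<notin> S \<Longrightarrow> 0 < r \<Longrightarrow> ts k \<le> ereal r \<Longrightarrow> ereal r < ts (Suc k) \<Longrightarrow>
            (z has_vector_derivative q (z r) (x r) (d r)) (at r) \<and>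
            (x has_real_derivative
               f (z r) (x r) (d r)
               + b * kappa rho (x (real_of_ereal (ts k))) (th (real_of_ereal (ts k)))) (at r) \<and>
            (th has_real_derivative lam * rho (x r) * (x r)\<^sup>2) (at r)"
proof -
  let ?I = "{t. 0 \<le> t \<and> ereal t < T}"
  obtain S where S1: "\<forall>s\<in>?I. finite (S \<inter> {0..s})"
    and S2: "\<forall>t\<in>?I - S. \<forall>k. 0 < t \<and> ts k \<le> ereal t \<and> ereal t < ts (Suc k) \<longrightarrow>
            (z has_vector_derivative q (z t) (x t) (d t)) (at t) \<and>
            (x has_real_derivative
               f (z t) (x t) (d t)
               + b * kappa rho (x (real_of_ereal (ts k))) (th (real_of_ereal (ts k)))) (at t) \<and>
            (th has_real_derivative lam * rho (x t) * (x t)\<^sup>2) (at t)"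
    using sol unfolding solution_def Let_def by blast
  show ?thesis
  proof (rule that[of S])
    show "finite (S \<inter> {0..s})" if "0 \<le> s" "ereal s < T" for s using S1 that by simp
  qed (use S2 in blast)
qed

lemma derivatives_sampling_interval:
  assumes k: "ts k = ereal s" and s: "0 \<le> s" and t: "ereal t < T" "ereal t \<le> ts (Suc k)"
  obtains S where "finite S" "\<And>r. r \<in> {s<..<t} - S \<Longrightarrow>
    (z has_vector_derivative q (z r) (x r) (d r)) (at r) \<and>
    (x has_real_derivative f (z r) (x r) (d r) + b * kappa rho (x s) (th s)) (at r) \<and>
    (th has_real_derivative lam * rho (x r) * (x r)\<^sup>2) (at r) \<and> d r \<in> D"
proof (cases "s < t")
  case False
  then show ?thesis using that[of "{}"] by auto
next
  case True
  obtain S where S: "\<And>s. 0 \<le> s \<Longrightarrow> ereal s < T \<Longrightarrow> finite (S \<inter> {0..s})"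
    "\<And>r k. 0 \<le> r \<Longrightarrow> ereal r < T \<Longrightarrow> r \<notin> S \<Longrightarrow> 0 < r \<Longrightarrow> ts k \<le> ereal r \<Longrightarrow> ereal r < ts (Suc k) \<Longrightarrow>
            (z has_vector_derivative q (z r) (x r) (d r)) (at r) \<and>
            (x has_real_derivative
               f (z r) (x r) (d r)
               + b * kappa rho (x (real_of_ereal (ts k))) (th (real_of_ereal (ts k)))) (at r) \<and>
            (th has_real_derivative lam * rho (x r) * (x r)\<^sup>2) (at r)"
    using exceptional_times by blast
  show ?thesis
  proof (rule that[of "S \<inter> {0..t}"])
    show "finite (S \<inter> {0..t})" using S(1) t(1) s True by auto
    fix r assume r: "r \<in> {s<..<t} - S \<inter> {0..t}"
    then have "ereal r < ereal t" by simp
    then have "ereal r < T" "ereal r < ts (Suc k)" using t less_trans less_le_trans by blast+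
    moreover have "d r \<in> D" using D(2) r s by (auto simp: admissible_def)
    ultimately show "(z has_vector_derivative q (z r) (x r) (d r)) (at r) \<and>
      (x has_real_derivative f (z r) (x r) (d r) + b * kappa rho (x s) (th s)) (at r) \<and>
      (th has_real_derivative lam * rho (x r) * (x r)\<^sup>2) (at r) \<and> d r \<in> D"
      using S(2)[of r k] r s k by auto
  qed
qed

text \<open>Across several sampling intervals the held input is only described as
  \<open>kappa\<close> at some earlier instant \<open>s'\<close>, which is enough for bounds on the
  velocity.\<close>

lemma derivatives:
  assumes t: "ereal t < T" and "0 \<le> s"
  obtains S where "finite S" "\<And>r. r \<in> {s<..<t} - S \<Longrightarrow>
    (z has_vector_derivative q (z r) (x r) (d r)) (at r) \<and>
    (th has_real_derivative lam * rho (x r) * (x r)\<^sup>2) (at r) \<and> d r \<in> D \<and>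
    (\<exists>s'\<in>{0..r}. (x has_real_derivative f (z r) (x r) (d r) + b * kappa rho (x s') (th s')) (at r))"
proof (cases "s < t")
  case False
  then show ?thesis using that[of "{}"] by auto
next
  case True
  obtain S where S: "\<And>s. 0 \<le> s \<Longrightarrow> ereal s < T \<Longrightarrow> finite (S \<inter> {0..s})"
    "\<And>r k. 0 \<le> r \<Longrightarrow> ereal r < T \<Longrightarrow> r \<notin> S \<Longrightarrow> 0 < r \<Longrightarrow> ts k \<le> ereal r \<Longrightarrow> ereal r < ts (Suc k) \<Longrightarrow>
            (z has_vector_derivative q (z r) (x r) (d r)) (at r) \<and>
            (x has_real_derivative
               f (z r) (x r) (d r)
               + b * kappa rho (x (real_of_ereal (ts k))) (th (real_of_ereal (ts k)))) (at r) \<and>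
            (th has_real_derivative lam * rho (x r) * (x r)\<^sup>2) (at r)"
    using exceptional_times by blast
  show ?thesis
  proof (rule that[of "S \<inter> {0..t}"])
    show "finite (S \<inter> {0..t})" using S(1) t assms(2) True by auto
    fix r assume r: "r \<in> {s<..<t} - S \<inter> {0..t}"
    then have "ereal r < ereal t" by simp
    then have rT: "ereal r < T" using t by (rule less_trans)
    obtain k s' where k: "ts k = ereal s'" "0 \<le> s'" "s' \<le> r" "ereal r < ts (Suc k)"
      using in_sampling_interval[of r] rT r assms(2) by auto
    moreover have "d r \<in> D" using D(2) r assms(2) by (auto simp: admissible_def)
    ultimately show "(z has_vector_derivative q (z r) (x r) (d r)) (at r) \<and>
      (th has_real_derivative lam * rho (x r) * (x r)\<^sup>2) (at r) \<and> d r \<in> D \<and>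
      (\<exists>s'\<in>{0..r}. (x has_real_derivative f (z r) (x r) (d r) + b * kappa rho (x s') (th s')) (at r))"
      using S(2)[of r k] r rT assms(2) by auto
  qed
qed

lemma continuous_terms:
  assumes "ereal t < T" "0 \<le> s"
  shows "continuous_on {s..t} (\<lambda>r. (m1 (z r) * norm (z r))\<^sup>2)"
    "continuous_on {s..t} (\<lambda>r. rho (x r) * (x r)\<^sup>2)"
    "continuous_on {s..t} en"
    "continuous_on {s..t} (samp_err rho x th s')"
    "continuous_on {s..t} (\<lambda>r. U (z r))"
proof -
  note [continuous_intros] = continuous[OF assms]
    continuous_on_compose2[OF m1(1) continuous(1)[OF assms] subset_UNIV]
    continuous_on_compose2[OF rho_continuous[of UNIV] continuous(2)[OF assms] subset_UNIV]
  show "continuous_on {s..t} (\<lambda>r. (m1 (z r) * norm (z r))\<^sup>2)"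
    "continuous_on {s..t} (\<lambda>r. rho (x r) * (x r)\<^sup>2)"
    "continuous_on {s..t} en"
    "continuous_on {s..t} (samp_err rho x th s')"
    unfolding en_def samp_err_def kappa_def by (intro continuous_intros)+
  show "continuous_on {s..t} (\<lambda>r. U (z r))"
    by (rule continuous_on_compose2[OF U_continuous[of UNIV] continuous(1)[OF assms] subset_UNIV])
qed

lemma en_nonneg: "0 \<le> en t"
  using rho(3)[of "x t"] by (simp add: en_def)

lemma en_integrable: "ereal t < T \<Longrightarrow> 0 \<le> s \<Longrightarrow> en integrable_on {s..t}"
  by (intro integrable_continuous_real continuous_terms)

lemma integral_en_mono:
  assumes "0 \<le> s'" "s' \<le> s" "t \<le> t'" "ereal t' < T"
  shows "integral {s..t} en \<le> integral {s'..t'} en"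
  using assms en_nonneg
  by (intro integral_subset_le en_integrable) (auto intro: le_less_trans[of _ "ereal t'"])

lemma integral_en_nonneg: "0 \<le> integral {s..t} en"
  by (cases "en integrable_on {s..t}") (auto intro: integral_nonneg en_nonneg simp: not_integrable_integral)

lemma gain_increment:
  assumes "0 \<le> s" "s \<le> t" "ereal t < T"
  shows "th t - th s = lam * integral {s..t} (\<lambda>r. rho (x r) * (x r)\<^sup>2)"
proof -
  obtain S where S: "finite S" "\<And>r. r \<in> {s<..<t} - S \<Longrightarrow>
    (th has_real_derivative lam * rho (x r) * (x r)\<^sup>2) (at r)"
    using derivatives[OF assms(3,1)] by metis
  have "((\<lambda>r. lam * rho (x r) * (x r)\<^sup>2) has_integral (th t - th s)) {s..t}"
    using S assms continuous(3)[OF assms(3,1)]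
    by (intro fundamental_theorem_of_calculus_interior_strong[of S])
      (auto simp: has_real_derivative_iff_has_vector_derivative[symmetric])
  from integral_unique[OF this] show ?thesis by (simp add: mult.assoc)
qed

lemma gain_mono:
  assumes "0 \<le> s" "s \<le> t" "ereal t < T"
  shows "th s \<le> th t"
proof -
  have "0 \<le> integral {s..t} (\<lambda>r. rho (x r) * (x r)\<^sup>2)"
  proof (rule integral_nonneg)
    show "(\<lambda>r. rho (x r) * (x r)\<^sup>2) integrable_on {s..t}"
      by (intro integrable_continuous_real continuous_terms assms)
    show "0 \<le> rho (x r) * (x r)\<^sup>2" for r using rho(3)[of "x r"] by simp
  qed
  then have "0 \<le> lam * integral {s..t} (\<lambda>r. rho (x r) * (x r)\<^sup>2)" using lam by simp
  then show ?thesis using gain_increment[OF assms] by linarith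
qed

lemma U_derivative:
  assumes "(z has_vector_derivative v) (at r)"
  shows "((\<lambda>r. U (z r)) has_real_derivative frechet_derivative U (at (z r)) v) (at r)"
proof -
  have dU: "(U has_derivative frechet_derivative U (at (z r))) (at (z r))"
    using U(1) by (simp add: frechet_derivative_works)
  then have "linear (frechet_derivative U (at (z r)))" by (rule has_derivative_linear)
  then have "frechet_derivative U (at (z r)) \<circ> (\<lambda>h. h *\<^sub>R v) = (*) (frechet_derivative U (at (z r)) v)"
    by (simp add: fun_eq_iff linear_cmul mult.commute)
  then show ?thesis
    using diff_chain_at[OF assms[unfolded has_vector_derivative_def] dU]
    by (simp add: has_field_derivative_def o_def)
qed

lemma U_increment:
  assumes "0 \<le> s" "s \<le> t" "ereal t < T"
  shows "U (z t) - U (z s) \<le> p * integral {s..t} (\<lambda>r. rho (x r) * (x r)\<^sup>2)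
    - integral {s..t} (\<lambda>r. (m1 (z r) * norm (z r))\<^sup>2)"
proof -
  obtain S where S: "finite S" "\<And>r. r \<in> {s<..<t} - S \<Longrightarrow>
    (z has_vector_derivative q (z r) (x r) (d r)) (at r) \<and> d r \<in> D"
    using derivatives[OF assms(3,1)] by metis
  note cont = continuous_terms[OF assms(3,1)]
  have "U (z t) - U (z s) \<le> integral {s..t} (\<lambda>r. p * (rho (x r) * (x r)\<^sup>2) - (m1 (z r) * norm (z r))\<^sup>2)"
  proof (rule diff_le_integral_off_finite[OF assms(2) S(1) cont(5)])
    show "continuous_on {s..t} (\<lambda>r. p * (rho (x r) * (x r)\<^sup>2) - (m1 (z r) * norm (z r))\<^sup>2)"
      by (intro continuous_intros cont)
    fix r assume "r \<in> {s<..<t} - S"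
    then show "\<exists>D. ((\<lambda>r. U (z r)) has_real_derivative D) (at r) \<and>
        D \<le> p * (rho (x r) * (x r)\<^sup>2) - (m1 (z r) * norm (z r))\<^sup>2"
      using S(2) U_derivative U(4) by (metis add.commute diff_conv_add_uminus)
  qed
  also have "\<dots> = p * integral {s..t} (\<lambda>r. rho (x r) * (x r)\<^sup>2)
    - integral {s..t} (\<lambda>r. (m1 (z r) * norm (z r))\<^sup>2)"
    using cont by (subst Henstock_Kurzweil_Integration.integral_diff)
      (auto intro!: integrable_continuous_real continuous_intros)
  finally show ?thesis .
qed

text \<open>As long as the gain is at most 1 its increase, \<open>lam\<close> times the integral of
  \<open>rho x * x\<^sup>2\<close>, is at most \<open>1 - th 0\<close>; since \<open>U\<close> is
  nonnegative, its balance then bounds the \<open>z\<close>-part of the energy.\<close>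

lemma integral_en_small_gain:
  assumes "0 \<le> t" "ereal t < T" "th t \<le> 1"
  shows "integral {0..t} en \<le> U (z 0) + (p + 1) * ((1 - th 0) / lam)"
proof -
  let ?r = "integral {0..t} (\<lambda>r. rho (x r) * (x r)\<^sup>2)"
  let ?a = "integral {0..t} (\<lambda>r. (m1 (z r) * norm (z r))\<^sup>2)"
  have "lam * ?r \<le> 1 - th 0" using gain_increment[of 0 t] assms by simp
  then have r: "?r \<le> (1 - th 0) / lam" using lam by (simp add: field_simps)
  have "integral {0..t} en = ?a + ?r"
    unfolding en_def[abs_def] using assms
    by (intro Henstock_Kurzweil_Integration.integral_add integrable_continuous_real continuous_terms) auto
  moreover have "?a \<le> U (z 0) + p * ?r" using U_increment[of 0 t] U_nonneg[of "z t"] assms by simp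
  ultimately have "integral {0..t} en \<le> U (z 0) + (p + 1) * ?r" by (simp add: algebra_simps)
  also have "(p + 1) * ?r \<le> (p + 1) * ((1 - th 0) / lam)" using r p by (intro mult_left_mono) auto
  finally show ?thesis by simp
qed

end

subsection \<open>Sampling error and Lyapunov inequality\<close>

lemma integral_affine:
  fixes g :: "real \<Rightarrow> real"
  assumes "g integrable_on {s..t}" "s \<le> t"
  shows "integral {s..t} (\<lambda>r. k + c * g r) = k * (t - s) + c * integral {s..t} g"
proof -
  have "((\<lambda>r. k + c * g r) has_integral (t - s) *\<^sub>R k + c * integral {s..t} g) {s..t}"
    using has_integral_const_real[of k s t] assms
    by (intro has_integral_add has_integral_mult_right integrable_integral) auto
  then show ?thesis by (simp add: integral_unique mult.commute)
qed

context closed_loop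
begin

lemma m2_le_rho: "m2 x \<le> rho x"
proof -
  have "2 * m2 x \<le> 1 + (m2 x)\<^sup>2" using zero_le_power2[of "m2 x - 1"] by (simp add: power2_eq_square algebra_simps)
  then show ?thesis using rho(3,4)[of x] by linarith
qed

text \<open>\<open>2 * u \<le> 1 + u\<^sup>2\<close> makes the growth affine in the energy, so that
  the displacement of \<open>x\<close> is controlled by the elapsed time and the integral of
  \<open>en\<close>.\<close>

lemma f_bound_en: 
  assumes "d' \<in> D"
  shows "\<bar>f v y d'\<bar> \<le> c * (1 + ((m1 v * norm v)\<^sup>2 + rho y * y\<^sup>2))"
proof -
  have *: "2 * u \<le> 1 + u\<^sup>2" for u :: real
    using zero_le_power2[of "u - 1"] by (simp add: power2_eq_square algebra_simps)
  have "(m2 y * \<bar>y\<bar>)\<^sup>2 \<le> rho y * y\<^sup>2"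
    unfolding power_mult_distrib using rho(4)[of y] by (simp add: mult_right_mono)
  then have "m1 v * norm v + m2 y * \<bar>y\<bar> \<le> 1 + ((m1 v * norm v)\<^sup>2 + rho y * y\<^sup>2)"
    using *[of "m1 v * norm v"] *[of "m2 y * \<bar>y\<bar>"] zero_le_power2[of "m1 v * norm v"]
      zero_le_power2[of "m2 y * \<bar>y\<bar>"] by linarith
  from mult_left_mono[OF this c] show ?thesis using f_bound[OF assms, of v y] by (simp add: algebra_simps)
qed

text \<open>The left side is the derivative of \<open>th * rho x * x\<close>, that is, of the
  sampling error, because the held input \<open>u\<close> is constant. Writing \<open>u\<close> as
  \<open>w + kappa\<close> splits off the part proportional to \<open>w\<close>, where
  \<open>bbar\<close> replaces the unknown \<open>b\<close>. The other three parts come from the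
  growth of the gain, the drift and the feedback; each is linear in the state with a coefficient
  below \<open>E\<close>.\<close>

lemma input_derivative_bound:
  assumes "d' \<in> D" and u: "u = w + kappa rho y g"
  shows "\<bar>lam * rho y * y\<^sup>2 * (rho y * y) + g * (rho y + y * rho' y) * (f v y d' + b * u)\<bar>
    \<le> (c + bbar + lam) * (1 + g\<^sup>2) * E y * (m1 v * norm v + \<bar>y\<bar>) + \<bar>bbar * g * (rho y + y * rho' y) * w\<bar>"
proof -
  define G where "G = rho y + y * rho' y"
  define E0 where "E0 = (1 + \<bar>G\<bar>) * (1 + m2 y + rho y) * (1 + rho y * y\<^sup>2)"
  define a where "a = m1 v * norm v"
  have a: "0 \<le> a" using m1(2)[of v] by (simp add: a_def)
  have r: "1 \<le> rho y" "0 < m2 y" using rho(3) m2(2) by auto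
  have ry: "0 \<le> rho y * y\<^sup>2" using r by simp
  have gle: "\<bar>g\<bar> \<le> 1 + g\<^sup>2" using zero_le_power2[of "\<bar>g\<bar> - 1"] abs_ge_zero[of g]
    unfolding power2_diff power2_abs one_power2 by linarith
  have E1: "1 * (1 + m2 y + rho y) * (1 + rho y * y\<^sup>2) \<le> E0"
    unfolding E0_def using r ry by (intro mult_right_mono) auto
  have E2: "\<bar>G\<bar> * (1 + m2 y + rho y) * 1 \<le> E0"
    unfolding E0_def using r ry by (intro mult_mono) auto
  have E0nn: "0 \<le> E0" unfolding E0_def using r ry by (intro mult_nonneg_nonneg) auto
  have t1: "\<bar>lam * rho y * y\<^sup>2 * (rho y * y)\<bar> \<le> lam * ((1 + g\<^sup>2) * E0 * (a + \<bar>y\<bar>))"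
  proof -
    have "\<bar>lam * rho y * y\<^sup>2 * (rho y * y)\<bar> = lam * ((rho y * (rho y * y\<^sup>2)) * \<bar>y\<bar>)"
      using lam r by (simp add: abs_mult)
    also have "\<dots> \<le> lam * (((1 + g\<^sup>2) * E0) * (a + \<bar>y\<bar>))"
    proof (rule mult_left_mono[OF mult_mono])
      have "rho y * (rho y * y\<^sup>2) \<le> (1 + m2 y + rho y) * (1 + rho y * y\<^sup>2)"
        using r ry by (intro mult_mono) auto
      also have "\<dots> \<le> (1 + g\<^sup>2) * E0" using E1 E0nn mult_right_mono[of 1 "1 + g\<^sup>2" E0] by simp
      finally show "rho y * (rho y * y\<^sup>2) \<le> (1 + g\<^sup>2) * E0" .
    qed (use lam a E0nn in auto)
    finally show ?thesis by simp
  qed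
  have t2: "\<bar>g * G * f v y d'\<bar> \<le> c * ((1 + g\<^sup>2) * E0 * (a + \<bar>y\<bar>))"
  proof -
    have "\<bar>f v y d'\<bar> \<le> c * (a + m2 y * \<bar>y\<bar>)" using f_bound[OF assms(1), of v y] by (simp add: a_def algebra_simps)
    also have "\<dots> \<le> c * ((1 + m2 y + rho y) * (a + \<bar>y\<bar>))"
    proof (intro mult_left_mono c)
      have "m2 y * \<bar>y\<bar> \<le> (1 + m2 y + rho y) * \<bar>y\<bar>" "a \<le> (1 + m2 y + rho y) * a"
        using r a mult_right_mono[of 1 "1 + m2 y + rho y" a] by (auto intro: mult_right_mono)
      then show "a + m2 y * \<bar>y\<bar> \<le> (1 + m2 y + rho y) * (a + \<bar>y\<bar>)" unfolding distrib_left by linarith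
    qed
    finally have "\<bar>g\<bar> * (\<bar>G\<bar> * \<bar>f v y d'\<bar>) \<le> (1 + g\<^sup>2) * (\<bar>G\<bar> * (c * ((1 + m2 y + rho y) * (a + \<bar>y\<bar>))))"
      using gle by (intro mult_mono) auto
    also have "\<dots> = c * ((1 + g\<^sup>2) * (\<bar>G\<bar> * (1 + m2 y + rho y) * 1) * (a + \<bar>y\<bar>))" by simp
    also have "\<dots> \<le> c * ((1 + g\<^sup>2) * E0 * (a + \<bar>y\<bar>))"
      using a c by (intro mult_left_mono mult_right_mono E2) auto
    finally show ?thesis by (simp add: abs_mult)
  qed
  have t3: "\<bar>g * G * (b * (g * rho y * y))\<bar> \<le> bbar * ((1 + g\<^sup>2) * E0 * (a + \<bar>y\<bar>))"
  proof -
    have "\<bar>g * G * (b * (g * rho y * y))\<bar> = b * (g\<^sup>2 * (\<bar>G\<bar> * rho y) * \<bar>y\<bar>)"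
      using b r by (simp add: abs_mult power2_eq_square)
    also have "\<dots> \<le> bbar * ((1 + g\<^sup>2) * E0 * (a + \<bar>y\<bar>))"
    proof (intro mult_mono)
      show "\<bar>G\<bar> * rho y \<le> E0" using E2 r mult_left_mono[of "rho y" "1 + m2 y + rho y" "\<bar>G\<bar>"] by simp
    qed (use b r a E0nn in auto)
    finally show ?thesis .
  qed
  have t4: "\<bar>g * G * (b * w)\<bar> \<le> \<bar>bbar * g * G * w\<bar>"
    using b mult_right_mono[of b bbar "\<bar>g * G * w\<bar>"] by (simp add: abs_mult algebra_simps)
  have "lam * rho y * y\<^sup>2 * (rho y * y) + g * G * (f v y d' + b * u)
    = lam * rho y * y\<^sup>2 * (rho y * y) + g * G * f v y d' - g * G * (b * (g * rho y * y)) + g * G * (b * w)"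
    by (simp add: u kappa_def algebra_simps)
  moreover have "\<bar>A1 + A2 - A3 + A4\<bar> \<le> B1 + B2 + B3 + B4"
    if "\<bar>A1\<bar> \<le> B1" "\<bar>A2\<bar> \<le> B2" "\<bar>A3\<bar> \<le> B3" "\<bar>A4\<bar> \<le> B4" for A1 A2 A3 A4 B1 B2 B3 B4 :: real
    using that by linarith
  note this[OF t1 t2 t3 t4]
  ultimately have "\<bar>lam * rho y * y\<^sup>2 * (rho y * y) + g * G * (f v y d' + b * u)\<bar>
    \<le> lam * ((1 + g\<^sup>2) * E0 * (a + \<bar>y\<bar>)) + c * ((1 + g\<^sup>2) * E0 * (a + \<bar>y\<bar>))
      + bbar * ((1 + g\<^sup>2) * E0 * (a + \<bar>y\<bar>)) + \<bar>bbar * g * G * w\<bar>"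
    by (simp only:)
  also have "\<dots> = (c + bbar + lam) * (1 + g\<^sup>2) * E0 * (a + \<bar>y\<bar>) + \<bar>bbar * g * G * w\<bar>"
    by (simp add: algebra_simps)
  also have "\<dots> \<le> (c + bbar + lam) * (1 + g\<^sup>2) * E y * (a + \<bar>y\<bar>) + \<bar>bbar * g * G * w\<bar>"
    using E(3)[of y] c b lam a by (intro add_right_mono mult_right_mono mult_left_mono) (auto simp: E0_def G_def)
  finally show ?thesis by (simp add: G_def a_def)
qed

end

context trajectory
begin

lemma state_variation:
  assumes k: "ts k = ereal s" and s: "0 \<le> s" "s \<le> r" "r \<le> r'" and t: "ereal r' < T" "ereal r' \<le> ts (Suc k)"
  shows "\<bar>x r - x r'\<bar> \<le> (c + b * \<bar>kappa rho (x s) (th s)\<bar>) * (r' - r) + c * integral {r..r'} en"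
proof -
  let ?u = "kappa rho (x s) (th s)"
  let ?h = "\<lambda>\<tau>. (c + b * \<bar>?u\<bar>) + c * en \<tau>"
  obtain S where S: "finite S" "\<And>\<tau>. \<tau> \<in> {s<..<r'} - S \<Longrightarrow>
    (x has_real_derivative f (z \<tau>) (x \<tau>) (d \<tau>) + b * ?u) (at \<tau>) \<and> d \<tau> \<in> D"
    using derivatives_sampling_interval[OF k s(1) t] by metis
  have r0: "0 \<le> r" using s by simp
  have bd: "\<bar>f (z \<tau>) (x \<tau>) (d \<tau>) + b * ?u\<bar> \<le> ?h \<tau>" if "d \<tau> \<in> D" for \<tau>
    using f_bound_en[OF that, of "z \<tau>" "x \<tau>"] b(1) abs_triangle_ineq[of "f (z \<tau>) (x \<tau>) (d \<tau>)" "b * ?u"]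
    by (simp add: en_def abs_mult algebra_simps)
  have hc: "continuous_on {r..r'} ?h" by (intro continuous_intros continuous_terms t(1) r0)
  have "x r' - x r \<le> integral {r..r'} ?h"
  proof (rule diff_le_integral_off_finite[OF s(3) S(1) continuous(2)[OF t(1) r0] hc])
    fix \<tau> assume "\<tau> \<in> {r<..<r'} - S"
    then have "\<tau> \<in> {s<..<r'} - S" using s by auto
    from S(2)[OF this] show "\<exists>D. (x has_real_derivative D) (at \<tau>) \<and> D \<le> ?h \<tau>"
      using bd abs_le_D1 by blast
  qed
  moreover have "- x r' - (- x r) \<le> integral {r..r'} ?h"
  proof (rule diff_le_integral_off_finite[OF s(3) S(1) _ hc, of "\<lambda>r. - x r"])
    show "continuous_on {r..r'} (\<lambda>r. - x r)" by (intro continuous_intros continuous t(1) r0)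
    fix \<tau> assume "\<tau> \<in> {r<..<r'} - S"
    then have "\<tau> \<in> {s<..<r'} - S" using s by auto
    from S(2)[OF this] show "\<exists>D. ((\<lambda>r. - x r) has_real_derivative D) (at \<tau>) \<and> D \<le> ?h \<tau>"
      using bd abs_le_D2 DERIV_minus by blast
  qed
  ultimately have "\<bar>x r - x r'\<bar> \<le> integral {r..r'} ?h" by linarith
  also have "\<dots> = (c + b * \<bar>?u\<bar>) * (r' - r) + c * integral {r..r'} en"
    by (rule integral_affine[OF en_integrable[OF t(1) r0] s(3)])
  finally show ?thesis .
qed

text \<open>Everything is referred to an instant \<open>r\<close> where \<open>\<bar>w\<bar>\<close>
  attains its maximum \<open>W\<close>. There \<open>w\<^sup>2\<close> cancels against
  \<open>W\<^sup>2\<close> in the negated trigger, leaving \<open>4 * (t - s) * gam < 1\<close>: the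
  larger \<open>gam\<close> at \<open>r\<close>, the shorter the time \<open>h = r - s\<close> in
  which the error has built up. \<open>M1\<close> and \<open>N\<close> are left open so that one
  estimate serves arbitrary initial gains as well as gains above 1.\<close>

lemma samp_err_bound:
  assumes k: "ts k = ereal s" and s: "0 \<le> s" "s \<le> t" and t: "ereal t < T" "ereal t < ts (Suc k)"
    and M1: "0 \<le> M1" "\<And>t. 0 \<le> t \<Longrightarrow> ereal t < T \<Longrightarrow> th t \<le> 1 \<Longrightarrow> integral {0..t} en \<le> M1"
    and N: "1 \<le> N" "\<And>\<tau> r. 0 \<le> \<tau> \<Longrightarrow> \<tau> \<le> r \<Longrightarrow> ereal r < T \<Longrightarrow> 1 + (th \<tau>)\<^sup>2 \<le> N * (1 + (th r)\<^sup>2)"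
  defines "w \<equiv> samp_err rho x th s"
  shows "(sup_norm w s t)\<^sup>2 \<le> coupling M1 N * integral {s..t} en"
    and "sup_norm w s t \<noteq> 0 \<Longrightarrow> t - s \<le> 1"
proof -
  define W where "W = sup_norm w s t"
  define u where "u = kappa rho (x s) (th s)"
  have wc: "continuous_on {s..t} w" unfolding w_def by (rule continuous_terms[OF t(1) s(1)])
  have ws: "w s = 0" by (simp add: w_def samp_err_def)
  have absc: "continuous_on {s..t} (\<lambda>r. \<bar>w r\<bar>)" using wc by (intro continuous_intros)
  obtain r where r: "s \<le> r" "r \<le> t" "W = \<bar>w r\<bar>"
    using cSUP_attained_atLeastAtMost[OF absc s(2)] by (auto simp: W_def sup_norm_def)
  have wW: "\<bar>w \<tau>\<bar> \<le> W" if "\<tau> \<in> {s..t}" for \<tau>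
    using cSUP_upper_atLeastAtMost[OF absc s(2) that] by (simp add: W_def sup_norm_def)
  have "W\<^sup>2 \<le> coupling M1 N * integral {s..t} en \<and> (W \<noteq> 0 \<longrightarrow> t - s \<le> 1)"
  proof (cases "W = 0")
    case True
    then show ?thesis using coupling_nonneg integral_en_nonneg by simp
  next
    case False
    then have W0: "0 < W" using r by simp
    have sr: "s < r" using r ws W0 by (cases "s = r") auto
    define h where "h = r - s"
    have h: "0 < h" "h \<le> t - s" using sr r by (auto simp: h_def)
    have gc: "continuous_on {s..t} (\<lambda>r. gam (x r) (th r) (w r) * (w r)\<^sup>2)"
    proof -
      have "continuous_on {s..t} (\<lambda>r. (x r, th r, w r))"
        by (intro continuous_intros continuous t(1) s(1) wc)
      from continuous_on_compose2[OF gam(1) this]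
      show ?thesis by (intro continuous_intros wc) auto
    qed
    \<comment> \<open>The negated trigger is used at \<open>r\<close> to bound \<open>h\<close>, and
      at every other instant to bound the part of the derivative that contains
      \<open>w\<close>.\<close>
    have gw: "4 * ((t - s) * (gam (x \<tau>) (th \<tau>) (w \<tau>) * (w \<tau>)\<^sup>2)) < W\<^sup>2" if "\<tau> \<in> {s..t}" for \<tau>
    proof -
      have "2 * (t - s) * (gam (x \<tau>) (th \<tau>) (w \<tau>) * (w \<tau>)\<^sup>2)
        \<le> 2 * (t - s) * (SUP r\<in>{s..t}. gam (x r) (th r) (w r) * (w r)\<^sup>2)"
        using cSUP_upper_atLeastAtMost[OF gc s(2) that] s by (intro mult_left_mono) auto
      also have "\<dots> < W\<^sup>2 / 2"
        using not_trigger_before_next_sample[OF k s(2) t] False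
        by (auto simp: trigger_def Let_def W_def w_def)
      finally show ?thesis unfolding mult.assoc by linarith
    qed
    let ?g = "gam (x r) (th r) (w r)"
    have "(w r)\<^sup>2 = W\<^sup>2" using r by simp
    then have "(4 * ((t - s) * ?g)) * W\<^sup>2 < 1 * W\<^sup>2" using gw[of r] r(1,2) by (simp add: mult.assoc)
    then have tg: "4 * ((t - s) * ?g) < 1" using mult_less_cancel_right_pos[of "W\<^sup>2"] W0 by simp
    have g1: "1 \<le> ?g" by (rule gam(2))
    have hg: "h * ?g \<le> 1 / 4"
    proof -
      have "h * ?g \<le> (t - s) * ?g" using h g1 by (intro mult_right_mono) auto
      then show ?thesis using tg by linarith
    qed
    have ts1: "t - s \<le> 1"
    proof -
      have "t - s \<le> (t - s) * ?g" using mult_left_mono[of 1 ?g "t - s"] g1 s by simp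
      then show ?thesis using tg s by linarith
    qed
    then have h1: "h \<le> 1" using h by simp
    have rT: "ereal r < T" "ereal r \<le> ts (Suc k)"
      using r t le_less_trans[of "ereal r" "ereal t"] less_imp_le by auto
    have uk: "u = w \<tau> + kappa rho (x \<tau>) (th \<tau>)" for \<tau> by (simp add: w_def samp_err_def u_def)
    define \<kappa> where "\<kappa> = \<bar>th r * rho (x r) * x r\<bar>"
    have uW: "\<bar>u\<bar> \<le> W + \<kappa>" using uk[of r] r by (simp add: kappa_def \<kappa>_def)
    have bu: "b * \<bar>u\<bar> * h \<le> 1"
    proof -
      have "b * \<bar>u\<bar> \<le> bbar * (W + \<kappa>)" using uW b by (intro mult_mono) auto
      also have "\<dots> \<le> ?g" using gam(4)[of "w r" "th r" "x r"] r by (simp add: \<kappa>_def)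
      finally have "b * \<bar>u\<bar> * h \<le> ?g * h" using h by (intro mult_right_mono) auto
      then show ?thesis using hg by (simp add: mult.commute)
    qed
    \<comment> \<open>A function of the arguments of \<open>gam\<close> at \<open>r\<close>, since
      \<open>W = \<bar>w r\<bar>\<close>. The additional displacement \<open>M\<close> depends on
      the plant and the initial data and goes into \<open>coupling\<close>.\<close>
    define N0 where "N0 = 2 * W + \<kappa> + \<bar>x r\<bar>"
    define M where "M = c * (1 + M1) + 1"
    have M0: "0 \<le> M" using c M1 by (simp add: M_def)
    have N00: "0 \<le> N0" using W0 by (simp add: N0_def \<kappa>_def)
    have var: "\<bar>x \<tau> - x r'\<bar> \<le> M" if \<tau>: "s \<le> \<tau>" "\<tau> \<le> r'" "r' \<le> r" and small: "th r' \<le> 1" for \<tau> r'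
    proof -
      have r'T: "ereal r' < T" "ereal r' \<le> ts (Suc k)"
        using that rT le_less_trans[of "ereal r'" "ereal r"] order_trans[of "ereal r'" "ereal r"] by auto
      have "\<bar>x \<tau> - x r'\<bar> \<le> (c + b * \<bar>u\<bar>) * (r' - \<tau>) + c * integral {\<tau>..r'} en"
        unfolding u_def using that by (intro state_variation[OF k s(1) _ _ r'T]) auto
      also have "\<dots> \<le> (c + b * \<bar>u\<bar>) * h + c * M1"
      proof (intro add_mono mult_left_mono)
        show "r' - \<tau> \<le> h" using that by (simp add: h_def)
        have "integral {\<tau>..r'} en \<le> integral {0..r'} en" using s that r'T by (intro integral_en_mono) auto
        also have "\<dots> \<le> M1" using M1(2)[of r'] s that r'T by auto
        finally show "integral {\<tau>..r'} en \<le> M1" .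
      qed (use c b in auto)
      also have "\<dots> \<le> M"
      proof -
        have "c * h \<le> c * 1" using c h1 by (intro mult_left_mono) auto
        then show ?thesis using bu by (simp add: M_def algebra_simps)
      qed
      finally show ?thesis .
    qed
    have big: "\<bar>x \<tau>\<bar> \<le> 2 * W + \<kappa>" if "s \<le> \<tau>" "\<tau> \<le> r" "1 \<le> th \<tau>" for \<tau>
    proof -
      have "1 * \<bar>x \<tau>\<bar> \<le> th \<tau> * rho (x \<tau>) * \<bar>x \<tau>\<bar>"
        using that rho(3)[of "x \<tau>"] mult_mono[of 1 "th \<tau>" 1 "rho (x \<tau>)"] by (intro mult_right_mono) auto
      also have "\<dots> = \<bar>u - w \<tau>\<bar>" using that rho(3)[of "x \<tau>"] uk[of \<tau>] by (simp add: kappa_def abs_mult)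
      also have "\<dots> \<le> 2 * W + \<kappa>" using uW wW[of \<tau>] that r by auto
      finally show ?thesis by simp
    qed
    have xb: "\<bar>x \<tau>\<bar> \<le> N0 + M" if \<tau>: "s \<le> \<tau>" "\<tau> \<le> r" for \<tau>
    proof -
      consider "1 \<le> th \<tau>" | "th \<tau> < 1" "th r \<le> 1" | "th \<tau> < 1" "1 < th r" by linarith
      then show ?thesis
      proof cases
        case 1
        then show ?thesis using big[OF \<tau>] M0 by (simp add: N0_def)
      next
        case 2
        then show ?thesis using var[of \<tau> r] \<tau> W0 by (simp add: N0_def \<kappa>_def)
      next
        \<comment> \<open>At the instant \<open>r1\<close> where the gain crosses 1 both estimates
          apply: the displacement up to \<open>r1\<close>, and the size of \<open>x\<close> at
          \<open>r1\<close>.\<close>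
        case 3
        have "continuous_on {\<tau>..r} th" using \<tau> s by (intro continuous rT) auto
        then obtain r1 where r1: "\<tau> \<le> r1" "r1 \<le> r" "th r1 = 1" using IVT'[of th \<tau> 1 r] 3 \<tau> by auto
        then show ?thesis using var[of \<tau> r1] big[of r1] \<tau> by (simp add: N0_def)
      qed
    qed
    define Q where "Q = (c + bbar + lam) * N * (1 + (th r)\<^sup>2) * (E (2 * N0) * E (2 * M))"
    have E2: "1 \<le> E (2 * N0)" "1 \<le> E (2 * M)" by (rule E(2))+
    have L0: "0 < c + bbar + lam" using c b lam by linarith
    have Q0: "0 \<le> Q" unfolding Q_def using L0 N(1) E2 by (intro mult_nonneg_nonneg) auto
    \<comment> \<open>\<open>N0 + M\<close> is at most twice the larger of the two. The product
      separates the factor that \<open>gam\<close> can dominate from the constant one.\<close>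
    have Eb: "E (x \<tau>) \<le> E (2 * N0) * E (2 * M)" if \<tau>: "s \<le> \<tau>" "\<tau> \<le> r" for \<tau>
    proof (cases "M \<le> N0")
      case True
      have "E (x \<tau>) \<le> E (2 * N0)" using xb[OF \<tau>] True by (intro E(1)) auto
      also have "\<dots> \<le> E (2 * N0) * E (2 * M)" using E2 mult_left_mono[of 1 "E (2 * M)" "E (2 * N0)"] by simp
      finally show ?thesis .
    next
      case False
      have "E (x \<tau>) \<le> E (2 * M)" using xb[OF \<tau>] False by (intro E(1)) auto
      also have "\<dots> \<le> E (2 * N0) * E (2 * M)" using E2 mult_right_mono[of 1 "E (2 * N0)" "E (2 * M)"] by simp
      finally show ?thesis .
    qed
    \<comment> \<open>Cauchy-Schwarz is replaced by \<open>Q y \<le> W / (4 h) + (h / W) (Q y)\<^sup>2\<close> under the integral.\<close>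
    define H where "H = (\<lambda>\<tau>. 3 * W / (4 * h) + 2 * Q\<^sup>2 * (h / W) * en \<tau>)"
    have main: "\<bar>lam * rho (x \<tau>) * (x \<tau>)\<^sup>2 * (rho (x \<tau>) * x \<tau>)
        + th \<tau> * (rho (x \<tau>) + x \<tau> * rho' (x \<tau>)) * (f (z \<tau>) (x \<tau>) (d \<tau>) + b * u)\<bar> \<le> H \<tau>" (is "\<bar>?w'\<bar> \<le> _")
      if \<tau>: "s \<le> \<tau>" "\<tau> \<le> r" "d \<tau> \<in> D" for \<tau>
    proof -
      let ?G = "rho (x \<tau>) + x \<tau> * rho' (x \<tau>)"
      let ?y = "m1 (z \<tau>) * norm (z \<tau>) + \<bar>x \<tau>\<bar>"
      have y0: "0 \<le> ?y" using m1(2)[of "z \<tau>"] by simp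
      have "(c + bbar + lam) * (1 + (th \<tau>)\<^sup>2) * E (x \<tau>) * ?y
          \<le> (c + bbar + lam) * (N * (1 + (th r)\<^sup>2)) * (E (2 * N0) * E (2 * M)) * ?y"
        using L0 y0 N(2)[of \<tau> r] \<tau> s rT Eb[of \<tau>] E(2)[of "x \<tau>"] N(1)
        by (intro mult_right_mono mult_mono mult_left_mono) auto
      then have 1: "(c + bbar + lam) * (1 + (th \<tau>)\<^sup>2) * E (x \<tau>) * ?y \<le> Q * ?y"
        by (simp add: Q_def mult.assoc)
      \<comment> \<open>\<open>h \<le> 1\<close> gives \<open>h * h \<le> t - s\<close>, so the
        third condition on \<open>gam\<close> limits this term to \<open>W / (2 * h)\<close>; over a
        time \<open>h\<close> it contributes at most \<open>W / 2\<close>.\<close>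
      have 2: "\<bar>bbar * th \<tau> * ?G * w \<tau>\<bar> \<le> W / (2 * h)"
      proof -
        have "4 * ((t - s) * (bbar * th \<tau> * ?G * w \<tau>)\<^sup>2)
          \<le> 4 * ((t - s) * (gam (x \<tau>) (th \<tau>) (w \<tau>) * (w \<tau>)\<^sup>2))"
          unfolding power_mult_distrib[of _ "w \<tau>"] using s
          by (intro mult_left_mono mult_right_mono gam(3)) auto
        also have "\<dots> \<le> W\<^sup>2" using gw[of \<tau>] \<tau> r by (intro less_imp_le) simp
        finally have 4: "4 * ((t - s) * (bbar * th \<tau> * ?G * w \<tau>)\<^sup>2) \<le> W\<^sup>2" .
        have sq: "(2 * h * \<bar>B\<bar>)\<^sup>2 = 4 * ((h * h) * B\<^sup>2)" for B
          by (simp add: power_mult_distrib power2_eq_square[of h])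
        have hh: "h * h \<le> t - s" using h h1 mult_mono[of h 1 h "t - s"] by simp
        have "(2 * h * \<bar>bbar * th \<tau> * ?G * w \<tau>\<bar>)\<^sup>2 \<le> 4 * ((t - s) * (bbar * th \<tau> * ?G * w \<tau>)\<^sup>2)"
          unfolding sq by (intro mult_left_mono[OF mult_right_mono[OF hh]] zero_le_power2) simp
        then have "(2 * h * \<bar>bbar * th \<tau> * ?G * w \<tau>\<bar>)\<^sup>2 \<le> W\<^sup>2" using 4 by (rule order_trans)
        then have "2 * h * \<bar>bbar * th \<tau> * ?G * w \<tau>\<bar> \<le> W" by (rule power2_le_imp_le) (use W0 in simp)
        moreover have "B \<le> W / (2 * h)" if "2 * h * B \<le> W" for B
          using that h(1) by (simp add: field_simps)
        ultimately show ?thesis by blast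
      qed
      have 3: "Q * ?y \<le> W / (4 * h) + (h / W) * (Q * ?y)\<^sup>2"
      proof -
        have "0 \<le> (W / (4 * h)) * (1 - 2 * (h / W) * (Q * ?y))\<^sup>2" using W0 h by simp
        also have "\<dots> = W / (4 * h) - Q * ?y + (h / W) * (Q * ?y)\<^sup>2"
          using W0 h by (simp add: power2_eq_square field_simps)
        finally show ?thesis by simp
      qed
      have "?y\<^sup>2 \<le> 2 * en \<tau>"
      proof -
        have "(x \<tau>)\<^sup>2 \<le> rho (x \<tau>) * (x \<tau>)\<^sup>2" using rho(3)[of "x \<tau>"] mult_right_mono[of 1 "rho (x \<tau>)" "(x \<tau>)\<^sup>2"] by simp
        moreover have "?y\<^sup>2 \<le> 2 * ((m1 (z \<tau>) * norm (z \<tau>))\<^sup>2 + (x \<tau>)\<^sup>2)"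
          using zero_le_power2[of "m1 (z \<tau>) * norm (z \<tau>) - \<bar>x \<tau>\<bar>"]
          by (simp add: power2_sum power2_diff)
        ultimately show ?thesis by (simp add: en_def)
      qed
      then have "(h / W) * (Q\<^sup>2 * ?y\<^sup>2) \<le> (h / W) * (Q\<^sup>2 * (2 * en \<tau>))" using h W0 by (intro mult_left_mono) auto
      then have "(h / W) * (Q * ?y)\<^sup>2 \<le> 2 * Q\<^sup>2 * (h / W) * en \<tau>" by (simp add: power_mult_distrib mult_ac)
      moreover have "\<bar>?w'\<bar> \<le> (c + bbar + lam) * (1 + (th \<tau>)\<^sup>2) * E (x \<tau>) * ?y + \<bar>bbar * th \<tau> * ?G * w \<tau>\<bar>"
        using input_derivative_bound[OF \<tau>(3) uk] by simp
      ultimately show ?thesis using 1 2 3 by (simp add: H_def)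
    qed
    obtain S where S: "finite S" "\<And>\<tau>. \<tau> \<in> {s<..<r} - S \<Longrightarrow>
      (x has_real_derivative f (z \<tau>) (x \<tau>) (d \<tau>) + b * u) (at \<tau>) \<and>
      (th has_real_derivative lam * rho (x \<tau>) * (x \<tau>)\<^sup>2) (at \<tau>) \<and> d \<tau> \<in> D"
      using derivatives_sampling_interval[OF k s(1) rT] unfolding u_def by metis
    have dw: "(w has_real_derivative lam * rho (x \<tau>) * (x \<tau>)\<^sup>2 * (rho (x \<tau>) * x \<tau>)
        + th \<tau> * (rho (x \<tau>) + x \<tau> * rho' (x \<tau>)) * (f (z \<tau>) (x \<tau>) (d \<tau>) + b * u)) (at \<tau>)"
      if "\<tau> \<in> {s<..<r} - S" for \<tau>
    proof -
      note dx = conjunct1[OF S(2)[OF that]] and dth = conjunct1[OF conjunct2[OF S(2)[OF that]]]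
      have "((\<lambda>\<tau>. u + th \<tau> * rho (x \<tau>) * x \<tau>) has_real_derivative
        0 + ((lam * rho (x \<tau>) * (x \<tau>)\<^sup>2 * rho (x \<tau>)
            + rho' (x \<tau>) * (f (z \<tau>) (x \<tau>) (d \<tau>) + b * u) * th \<tau>) * x \<tau>
          + (f (z \<tau>) (x \<tau>) (d \<tau>) + b * u) * (th \<tau> * rho (x \<tau>)))) (at \<tau>)"
        by (intro DERIV_add DERIV_const DERIV_mult dx dth DERIV_chain2[OF rho(1)])
      moreover have "w = (\<lambda>\<tau>. u + th \<tau> * rho (x \<tau>) * x \<tau>)"
        by (simp add: w_def samp_err_def kappa_def u_def fun_eq_iff)
      ultimately show ?thesis by (auto elim!: DERIV_cong simp: algebra_simps)
    qed
    have Hc: "continuous_on {s..r} H" unfolding H_def by (intro continuous_intros continuous_terms rT s(1))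
    have wc': "continuous_on {s..r} w" using wc r by (auto intro: continuous_on_subset)
    have "w r - w s \<le> integral {s..r} H"
    proof (rule diff_le_integral_off_finite[OF r(1) S(1) wc' Hc])
      fix \<tau> assume \<tau>: "\<tau> \<in> {s<..<r} - S"
      show "\<exists>D. (w has_real_derivative D) (at \<tau>) \<and> D \<le> H \<tau>"
        using dw[OF \<tau>] main[of \<tau>] S(2)[OF \<tau>] \<tau> abs_le_D1 by fastforce
    qed
    moreover have "- w r - (- w s) \<le> integral {s..r} H"
    proof (rule diff_le_integral_off_finite[OF r(1) S(1) _ Hc, of "\<lambda>r. - w r"])
      show "continuous_on {s..r} (\<lambda>r. - w r)" by (intro continuous_intros wc')
      fix \<tau> assume \<tau>: "\<tau> \<in> {s<..<r} - S"
      show "\<exists>D. ((\<lambda>r. - w r) has_real_derivative D) (at \<tau>) \<and> D \<le> H \<tau>"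
        using DERIV_minus[OF dw[OF \<tau>]] main[of \<tau>] S(2)[OF \<tau>] \<tau> abs_le_D2 by fastforce
    qed
    ultimately have "W \<le> integral {s..r} H" using ws r by linarith
    \<comment> \<open>The constant part of \<open>H\<close> contributes only
      \<open>3 * W / 4\<close>, so a quarter of \<open>W\<close> is left over on the left side. The
      factor \<open>h\<close> that remains is later paired with \<open>Q\<^sup>2\<close> and
      absorbed by the fifth condition on \<open>gam\<close>.\<close>
    also have "\<dots> = 3 * W / 4 + 2 * Q\<^sup>2 * (h / W) * integral {s..r} en"
      unfolding H_def integral_affine[OF en_integrable[OF rT(1) s(1)] r(1)] using h(1)
      unfolding h_def[symmetric] by simp
    finally have "W / 4 \<le> 2 * Q\<^sup>2 * (h / W) * integral {s..r} en" by simp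
    then have "W\<^sup>2 \<le> 8 * Q\<^sup>2 * h * integral {s..r} en"
      using W0 by (simp add: field_simps power2_eq_square)
    also have "8 * Q\<^sup>2 * h \<le> coupling M1 N"
    proof -
      have "((1 + (th r)\<^sup>2) * E (2 * N0))\<^sup>2 * h \<le> ?g * h"
        using gam(5)[of "th r" "w r" "x r"] r h by (intro mult_right_mono) (auto simp: N0_def \<kappa>_def)
      then have "((1 + (th r)\<^sup>2) * E (2 * N0))\<^sup>2 * h \<le> 1 / 4" using hg by (simp add: mult.commute)
      then have "8 * ((c + bbar + lam) * N * E (2 * M))\<^sup>2 * (((1 + (th r)\<^sup>2) * E (2 * N0))\<^sup>2 * h)
        \<le> 8 * ((c + bbar + lam) * N * E (2 * M))\<^sup>2 * (1 / 4)" by (intro mult_left_mono) auto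
      moreover have "8 * Q\<^sup>2 * h
        = 8 * ((c + bbar + lam) * N * E (2 * M))\<^sup>2 * (((1 + (th r)\<^sup>2) * E (2 * N0))\<^sup>2 * h)"
        by (simp add: Q_def power_mult_distrib mult_ac)
      ultimately show ?thesis unfolding coupling_def M_def[symmetric] by linarith
    qed
    then have "8 * Q\<^sup>2 * h * integral {s..r} en \<le> coupling M1 N * integral {s..t} en"
      using coupling_nonneg integral_en_nonneg s r t(1) by (intro mult_mono integral_en_mono) auto
    finally show ?thesis using ts1 by simp
  qed
  then show "(sup_norm w s t)\<^sup>2 \<le> coupling M1 N * integral {s..t} en"
    and "sup_norm w s t \<noteq> 0 \<Longrightarrow> t - s \<le> 1" by (auto simp: W_def)
qed

text \<open>\<open>g\<close> is a free comparison gain: the derivative of the last summand replaces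
  \<open>th\<close> by \<open>g\<close> in the feedback term
  \<open>- b * th * rho x * x\<^sup>2\<close>.\<close>

definition Lyap :: "real \<Rightarrow> real \<Rightarrow> real \<Rightarrow> real" where
  "Lyap C g t = weight C * U (z t) + (x t)\<^sup>2 / 2 + b / (2 * lam) * (th t - g)\<^sup>2"

lemma Lyap_continuous:
  assumes "ereal t < T" "0 \<le> s"
  shows "continuous_on {s..t} (Lyap C g)"
  unfolding Lyap_def by (intro continuous_intros continuous_terms continuous assms) auto

text \<open>Young's inequality moves every cross term into the energy or into
  \<open>w\<^sup>2 / 2\<close>. What remains is linear in \<open>a\<^sup>2\<close>, \<open>r\<close>
  and \<open>w\<^sup>2\<close>, and the threshold makes the coefficient of \<open>r\<close>
  sufficiently negative.\<close>

lemma Lyap_derivative_bound: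
  assumes "d' \<in> D" and u: "u = w + kappa rho y g" and "0 \<le> C" and thr: "gain_threshold C \<le> g'"
  shows "weight C * frechet_derivative U (at v) (q v y d') + y * (f v y d' + b * u)
      + b / lam * (g - g') * (lam * rho y * y\<^sup>2)
    \<le> - (C / 2 + 1) * ((m1 v * norm v)\<^sup>2 + rho y * y\<^sup>2) + w\<^sup>2 / 2"
proof -
  define a where "a = m1 v * norm v"
  define r where "r = rho y * y\<^sup>2"
  have yr: "y\<^sup>2 \<le> r" using rho(3)[of y] mult_right_mono[of 1 "rho y" "y\<^sup>2"] by (simp add: r_def)
  have r0: "0 \<le> r" using yr order_trans[OF zero_le_power2] by blast
  have W0: "0 \<le> weight C" using assms(3) by (simp add: weight_def)
  have 1: "weight C * frechet_derivative U (at v) (q v y d') \<le> weight C * (- a\<^sup>2 + p * r)"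
    unfolding a_def r_def by (rule mult_left_mono[OF U(4)[OF assms(1)] W0])
  have 2: "y * f v y d' \<le> a\<^sup>2 / 2 + (c\<^sup>2 / 2 + c) * r"
  proof -
    have "y * f v y d' \<le> \<bar>y\<bar> * (c * a + c * m2 y * \<bar>y\<bar>)"
      using f_bound[OF assms(1), of v y] abs_ge_self[of "y * f v y d'"] mult_left_mono[of "\<bar>f v y d'\<bar>" _ "\<bar>y\<bar>"]
      by (simp add: a_def abs_mult mult.assoc) (meson abs_ge_zero order_trans mult_left_mono)
    also have "\<dots> = (c * \<bar>y\<bar>) * a + c * (m2 y * y\<^sup>2)"
      by (simp add: algebra_simps power2_eq_square)
    finally have i: "y * f v y d' \<le> (c * \<bar>y\<bar>) * a + c * (m2 y * y\<^sup>2)" .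
    have ii: "(c * \<bar>y\<bar>) * a \<le> (c\<^sup>2 * y\<^sup>2 + a\<^sup>2) / 2"
      using zero_le_power2[of "c * \<bar>y\<bar> - a"] by (simp add: power2_diff power_mult_distrib)
    have iii: "c\<^sup>2 * y\<^sup>2 \<le> c\<^sup>2 * r" using yr by (intro mult_left_mono) auto
    have iv: "c * (m2 y * y\<^sup>2) \<le> c * r"
      unfolding r_def using c m2_le_rho by (intro mult_left_mono mult_right_mono) auto
    have v: "(c\<^sup>2 / 2 + c) * r = c\<^sup>2 * r / 2 + c * r" by (simp add: distrib_right)
    have "A \<le> Q / 2 + L" if "A \<le> A1 + A2" "A1 \<le> (B1 + Q) / 2" "B1 \<le> B2" "A2 \<le> A3" "L = B2 / 2 + A3"
      for A A1 A2 A3 B1 B2 Q L :: real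
      using that by (simp add: field_simps)
    from this[OF i ii iii iv v] show ?thesis .
  qed
  have 3: "y * (b * w) \<le> b\<^sup>2 / 2 * r + w\<^sup>2 / 2"
  proof -
    have "y * (b * w) \<le> (b\<^sup>2 * y\<^sup>2 + w\<^sup>2) / 2"
      using zero_le_power2[of "b * y - w"] by (simp add: power2_eq_square algebra_simps)
    moreover have "b\<^sup>2 * y\<^sup>2 \<le> b\<^sup>2 * r" using yr by (intro mult_left_mono) auto
    ultimately show ?thesis by simp
  qed
  have 4: "y * (b * kappa rho y g) + b / lam * (g - g') * (lam * rho y * y\<^sup>2) = - (b * g') * r"
  proof -
    have "b / lam * (g - g') * (lam * rho y * y\<^sup>2) = b * (g - g') * (rho y * y\<^sup>2)" using lam by simp
    then show ?thesis by (simp add: kappa_def r_def algebra_simps power2_eq_square)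
  qed
  have "weight C * p + c\<^sup>2 / 2 + c + b\<^sup>2 / 2 + C / 2 + 1 \<le> b * g'"
    using thr b(1) by (simp add: gain_threshold_def field_simps)
  then have 5: "(weight C * p + c\<^sup>2 / 2 + c + b\<^sup>2 / 2 + C / 2 + 1) * r \<le> b * g' * r"
    using r0 by (rule mult_right_mono)
  have 6: "weight C * (- a\<^sup>2 + p * r) = - ((C / 2 + 1) * a\<^sup>2) - a\<^sup>2 / 2 + weight C * p * r"
    by (simp add: weight_def algebra_simps)
  have 7: "- (C / 2 + 1) * (a\<^sup>2 + r) = - ((C / 2 + 1) * a\<^sup>2) - (C / 2 * r + r)"
    by (simp add: algebra_simps)
  have 8: "y * (f v y d' + b * (w + kappa rho y g)) = y * f v y d' + y * (b * w) + y * (b * kappa rho y g)"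
    by (simp add: algebra_simps)
  have 9: "(weight C * p + c\<^sup>2 / 2 + c + b\<^sup>2 / 2 + C / 2 + 1) * r
      = weight C * p * r + (c\<^sup>2 / 2 + c) * r + b\<^sup>2 / 2 * r + (C / 2 * r + r)"
    by (simp add: algebra_simps)
  have "A + Y + G \<le> L" if "A \<le> A'" "Y1 \<le> a2 / 2 + X2" "Y2 \<le> X3 + W2" "Y3 + G = - B" "X5 \<le> B"
    "A' = - A1 - a2 / 2 + X1" "L' = - A1 - X4" "Y = Y1 + Y2 + Y3" "X5 = X1 + X2 + X3 + X4" "L = L' + W2"
    for A A' A1 Y Y1 Y2 Y3 G L L' a2 X1 X2 X3 X4 X5 W2 B :: real
    using that by linarith
  from this[OF 1 2 3 4[unfolded mult_minus_left] 5 6 7 8 9 refl]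
  show ?thesis unfolding u a_def[symmetric] r_def[symmetric] .
qed

lemma Lyap_increment_sampling_interval:
  assumes k: "ts k = ereal s" and s: "0 \<le> s" "s \<le> t" and t: "ereal t < T" "ereal t < ts (Suc k)"
    and M1: "0 \<le> M1" "\<And>t. 0 \<le> t \<Longrightarrow> ereal t < T \<Longrightarrow> th t \<le> 1 \<Longrightarrow> integral {0..t} en \<le> M1"
    and N: "1 \<le> N" "\<And>\<tau> r. 0 \<le> \<tau> \<Longrightarrow> \<tau> \<le> r \<Longrightarrow> ereal r < T \<Longrightarrow> 1 + (th \<tau>)\<^sup>2 \<le> N * (1 + (th r)\<^sup>2)"
    and C: "C = coupling M1 N" and g: "gain_threshold C \<le> g"
  shows "Lyap C g t - Lyap C g s \<le> - integral {s..t} en"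
proof -
  define w where "w = samp_err rho x th s"
  define W where "W = sup_norm w s t"
  define u where "u = kappa rho (x s) (th s)"
  have wc: "continuous_on {s..t} w" unfolding w_def by (rule continuous_terms[OF t(1) s(1)])
  have C0: "0 \<le> C" unfolding C by (rule coupling_nonneg)
  have uk: "u = w \<tau> + kappa rho (x \<tau>) (th \<tau>)" for \<tau> by (simp add: w_def samp_err_def u_def)
  have wi: "(\<lambda>\<tau>. (w \<tau>)\<^sup>2) integrable_on {s..t}"
    by (intro integrable_continuous_real continuous_on_power wc)
  let ?H = "\<lambda>\<tau>. - (C / 2 + 1) * en \<tau> + (w \<tau>)\<^sup>2 / 2"
  obtain S where S: "finite S" "\<And>\<tau>. \<tau> \<in> {s<..<t} - S \<Longrightarrow>
      (z has_vector_derivative q (z \<tau>) (x \<tau>) (d \<tau>)) (at \<tau>) \<and>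
      (x has_real_derivative f (z \<tau>) (x \<tau>) (d \<tau>) + b * u) (at \<tau>) \<and>
      (th has_real_derivative lam * rho (x \<tau>) * (x \<tau>)\<^sup>2) (at \<tau>) \<and> d \<tau> \<in> D"
    using derivatives_sampling_interval[OF k s(1) t(1) less_imp_le[OF t(2)]] unfolding u_def by metis
  have "Lyap C g t - Lyap C g s \<le> integral {s..t} ?H"
  proof (rule diff_le_integral_off_finite[OF s(2) S(1) Lyap_continuous[OF t(1) s(1)]])
    show "continuous_on {s..t} ?H" by (intro continuous_intros continuous_terms t(1) s(1) wc) auto
    fix \<tau> assume "\<tau> \<in> {s<..<t} - S"
    note dz = S(2)[OF this, THEN conjunct1] and dx = S(2)[OF this, THEN conjunct2, THEN conjunct1]
      and dth = S(2)[OF this, THEN conjunct2, THEN conjunct2, THEN conjunct1]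
      and dD = S(2)[OF this, THEN conjunct2, THEN conjunct2, THEN conjunct2]
    have "(Lyap C g has_real_derivative
        weight C * frechet_derivative U (at (z \<tau>)) (q (z \<tau>) (x \<tau>) (d \<tau>))
        + x \<tau> * (f (z \<tau>) (x \<tau>) (d \<tau>) + b * u)
        + b / lam * (th \<tau> - g) * (lam * rho (x \<tau>) * (x \<tau>)\<^sup>2)) (at \<tau>)"
    proof -
      have "((\<lambda>t. (x t)\<^sup>2 / 2) has_real_derivative x \<tau> * (f (z \<tau>) (x \<tau>) (d \<tau>) + b * u)) (at \<tau>)"
        using DERIV_cdivide[OF DERIV_power[OF dx, of 2], of 2] by (simp add: mult.commute)
      moreover have "((\<lambda>t. b / (2 * lam) * (th t - g)\<^sup>2) has_real_derivative
          b / lam * (th \<tau> - g) * (lam * rho (x \<tau>) * (x \<tau>)\<^sup>2)) (at \<tau>)"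
        using DERIV_cmult[OF DERIV_power[OF DERIV_diff[OF dth DERIV_const[of g]], of 2], of "b / (2 * lam)"] lam
        by (simp add: mult_ac)
      ultimately show ?thesis
        unfolding Lyap_def by (intro DERIV_add DERIV_cmult[OF U_derivative[OF dz]])
    qed
    then show "\<exists>D. (Lyap C g has_real_derivative D) (at \<tau>) \<and> D \<le> ?H \<tau>"
      using Lyap_derivative_bound[OF dD uk C0 g, of "z \<tau>" \<tau>] unfolding en_def by blast
  qed
  also have "\<dots> = - (C / 2 + 1) * integral {s..t} en + integral {s..t} (\<lambda>\<tau>. (w \<tau>)\<^sup>2) / 2"
  proof -
    have "integral {s..t} ?H = integral {s..t} (\<lambda>\<tau>. - (C / 2 + 1) * en \<tau>) + integral {s..t} (\<lambda>\<tau>. (w \<tau>)\<^sup>2 / 2)"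
      by (intro Henstock_Kurzweil_Integration.integral_add integrable_continuous_real continuous_intros
        continuous_terms t(1) s(1) wc) auto
    then show ?thesis by simp
  qed
  also have "integral {s..t} (\<lambda>\<tau>. (w \<tau>)\<^sup>2) \<le> C * integral {s..t} en"
  proof -
    have absc: "continuous_on {s..t} (\<lambda>r. \<bar>w r\<bar>)" using wc by (intro continuous_intros)
    have "(w \<tau>)\<^sup>2 \<le> W\<^sup>2" if "\<tau> \<in> {s..t}" for \<tau>
      using cSUP_upper_atLeastAtMost[OF absc s(2) that]
      unfolding W_def sup_norm_def by (metis abs_ge_zero power2_abs power_mono)
    then have "integral {s..t} (\<lambda>\<tau>. (w \<tau>)\<^sup>2) \<le> integral {s..t} (\<lambda>\<tau>. W\<^sup>2)"
      by (intro integral_le wi integrable_const_ivl) auto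
    also have "\<dots> = (t - s) * W\<^sup>2" using s by simp
    \<comment> \<open>The interval is known to be short only when \<open>W \<noteq> 0\<close>. With
      zero error its length is not limited, but then both sides vanish.\<close>
    also have "\<dots> \<le> W\<^sup>2"
    proof (cases "W = 0")
      case False
      then have "t - s \<le> 1" using samp_err_bound(2)[OF k s t M1 N] unfolding W_def w_def by blast
      then show ?thesis using mult_right_mono[of "t - s" 1 "W\<^sup>2"] by simp
    qed simp
    also have "\<dots> \<le> C * integral {s..t} en"
      unfolding C W_def w_def by (rule samp_err_bound(1)[OF k s t M1 N])
    finally show ?thesis .
  qed
  finally show ?thesis by (simp add: algebra_simps)
qed

proposition Lyap_decrease:
  assumes M1: "0 \<le> M1" "\<And>t. 0 \<le> t \<Longrightarrow> ereal t < T \<Longrightarrow> th t \<le> 1 \<Longrightarrow> integral {0..t} en \<le> M1"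
    and N: "1 \<le> N" "\<And>\<tau> r. 0 \<le> \<tau> \<Longrightarrow> \<tau> \<le> r \<Longrightarrow> ereal r < T \<Longrightarrow> 1 + (th \<tau>)\<^sup>2 \<le> N * (1 + (th r)\<^sup>2)"
    and C: "C = coupling M1 N" and g: "gain_threshold C \<le> g"
    and t: "0 \<le> t" "ereal t < T"
  shows "Lyap C g t + integral {0..t} en \<le> Lyap C g 0"
proof -
  define \<Psi> where "\<Psi> = (\<lambda>t. Lyap C g t + integral {0..t} en)"
  have step: "\<Psi> t \<le> \<Psi> s" if "ts k = ereal s" "0 \<le> s" "s \<le> t" "ereal t < T" "ereal t < ts (Suc k)" for k s t
    using Lyap_increment_sampling_interval[OF that M1 N C g]
      Henstock_Kurzweil_Integration.integral_combine[OF that(2,3) en_integrable[OF that(4) order_refl]]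
    by (simp add: \<Psi>_def)
  have "\<Psi> s \<le> \<Psi> 0" if "ts k = ereal s" for k s
    using that
  proof (induction k arbitrary: s)
    case 0
    then show ?case by (simp add: zero_ereal_def)
  next
    case (Suc k)
    from T_pos obtain v where v: "0 \<le> v" "ts k = ereal v"
      by (rule sample_time_cases[of T rho gam x th k]) (use Suc.prems in auto)
    have vs: "v \<le> s" using sample_time_le_Suc[OF T_pos, of rho gam x th k] v Suc.prems by simp
    have sT: "ereal s < T" by (rule sample_time_cases[OF T_pos, of rho gam x th "Suc k"]) (use Suc.prems in auto)
    \<comment> \<open>The estimate on a sampling interval requires an instant strictly before the
      next sample; continuity carries it to the sampling instant itself.\<close>
    have "\<Psi> s \<le> \<Psi> v"
    proof (cases "v = s")
      case False
      then have cl: "closure {v..<s} = {v..s}" using vs by simp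
      have "continuous_on (closure {v..<s}) \<Psi>"
      proof -
        have "continuous_on {0..s} (\<lambda>t. integral {0..t} en)"
          by (intro indefinite_integral_continuous_1 en_integrable sT order_refl)
        then show ?thesis unfolding cl \<Psi>_def using v(1)
          by (intro continuous_on_add Lyap_continuous sT) (auto intro: continuous_on_subset)
      qed
      moreover have "s \<in> closure {v..<s}" unfolding cl using vs by simp
      moreover have "\<Psi> t \<le> \<Psi> v" if "t \<in> {v..<s}" for t
        using that Suc.prems sT v by (intro step[OF v(2,1)]) (auto intro: less_trans[of _ "ereal s"])
      ultimately show ?thesis by (rule continuous_le_on_closure)
    qed simp
    then show ?case using Suc.IH[OF v(2)] by simp
  qed
  moreover obtain k s where k: "ts k = ereal s" "0 \<le> s" "s \<le> t" "ereal t < ts (Suc k)"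
    using in_sampling_interval[OF t] by blast
  ultimately have "\<Psi> t \<le> \<Psi> 0" using step[OF k(1-3) t(2) k(4)] order_trans by blast
  then show ?thesis by (simp add: \<Psi>_def)
qed

end

subsection \<open>Boundedness, stability, attractivity, dwell time\<close>

lemma norm_triple_le: "norm (u, v, w) \<le> norm u + norm v + norm w"
  using norm_Pair_le[of u "(v, w)"] norm_Pair_le[of v w] by linarith

lemma abs_le_1_square: "\<bar>y :: real\<bar> \<le> 1 + y\<^sup>2"
  using zero_le_power2[of "\<bar>y\<bar> - 1"] abs_ge_zero[of y] unfolding power2_diff power2_abs one_power2 by linarith

text \<open>At an event \<open>W\<close> is nonzero and the weighted maximum is at most
  \<open>G * W\<^sup>2\<close>, so \<open>W\<^sup>2\<close> cancels from the triggering inequality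
  and only the elapsed time is left.\<close>

lemma trigger_dwell:
  assumes "continuous_on {s..t} x" "continuous_on {s..t} th" "continuous_on UNIV rho"
    "continuous_on UNIV (\<lambda>(x, th, w). gam x th w)" "s \<le> t"
    and G: "\<And>r. r \<in> {s..t} \<Longrightarrow> gam (x r) (th r) (samp_err rho x th s r) \<le> G"
    and trig: "trigger rho gam x th s t"
  shows "1 \<le> 4 * G * (t - s)"
proof -
  define w where "w = samp_err rho x th s"
  define W where "W = sup_norm w s t"
  have wc: "continuous_on {s..t} w"
    unfolding w_def samp_err_def kappa_def
    by (intro continuous_intros assms(1,2) continuous_on_compose2[OF assms(3,1)]) auto
  have "continuous_on {s..t} (\<lambda>r. (x r, th r, w r))" by (intro continuous_intros assms(1,2) wc)
  from continuous_on_compose2[OF assms(4) this]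
  have gc: "continuous_on {s..t} (\<lambda>r. gam (x r) (th r) (w r) * (w r)\<^sup>2)"
    by (intro continuous_intros wc) auto
  obtain r where r: "r \<in> {s..t}" "(SUP r\<in>{s..t}. gam (x r) (th r) (w r) * (w r)\<^sup>2)
      = gam (x r) (th r) (w r) * (w r)\<^sup>2"
    using cSUP_attained_atLeastAtMost[OF gc assms(5)] by blast
  have absc: "continuous_on {s..t} (\<lambda>r. \<bar>w r\<bar>)" using wc by (intro continuous_intros)
  have wW: "\<bar>w r\<bar> \<le> W"
    using cSUP_upper_atLeastAtMost[OF absc assms(5) r(1)] by (simp add: W_def sup_norm_def)
  have W: "W \<noteq> 0" "W\<^sup>2 / 2 \<le> 2 * (t - s) * (gam (x r) (th r) (w r) * (w r)\<^sup>2)"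
    using trig r(2) by (auto simp: trigger_def Let_def w_def W_def)
  have G0: "0 \<le> G"
  proof (rule ccontr)
    assume "\<not> 0 \<le> G"
    then have neg: "gam (x r) (th r) (w r) * (w r)\<^sup>2 \<le> 0"
      using G[OF r(1)] by (intro mult_nonpos_nonneg) (auto simp: w_def)
    have "2 * (t - s) * (gam (x r) (th r) (w r) * (w r)\<^sup>2) \<le> 0"
      by (rule mult_nonneg_nonpos[OF _ neg]) (use assms(5) in simp)
    then have "W\<^sup>2 \<le> 0" using W(2) by linarith
    then show False using W(1) by simp
  qed
  have "gam (x r) (th r) (w r) * (w r)\<^sup>2 \<le> G * W\<^sup>2"
    using G[OF r(1)] wW G0 power_mono[OF wW, of 2] by (intro mult_mono) (auto simp: w_def)
  then have "2 * (t - s) * (gam (x r) (th r) (w r) * (w r)\<^sup>2) \<le> 2 * (t - s) * (G * W\<^sup>2)"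
    using assms(5) by (intro mult_left_mono) auto
  then have "1 * W\<^sup>2 \<le> (4 * G * (t - s)) * W\<^sup>2" using W(2) by (simp add: algebra_simps)
  then show ?thesis using W(1) mult_le_cancel_right[of 1 "W\<^sup>2" "4 * G * (t - s)"] by simp
qed

context closed_loop
begin

lemma kappa_bounded:
  obtains B where "\<And>y g. \<bar>y\<bar> \<le> M \<Longrightarrow> \<bar>g\<bar> \<le> M \<Longrightarrow> \<bar>kappa rho y g\<bar> \<le> B"
proof -
  have "compact (rho ` {-M..M})" by (intro compact_continuous_image rho_continuous) auto
  from compact_imp_bounded[OF this] obtain R where "\<forall>y\<in>{-M..M}. \<bar>rho y\<bar> \<le> R"
    by (auto simp: bounded_iff)
  then have R: "\<bar>rho y\<bar> \<le> R" if "\<bar>y\<bar> \<le> M" for y using that by (auto simp: abs_le_iff)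
  have "\<bar>kappa rho y g\<bar> \<le> M * R * M" if "\<bar>y\<bar> \<le> M" "\<bar>g\<bar> \<le> M" for y g
  proof -
    have "0 \<le> M" "0 \<le> R" using that R[OF that(1)] by linarith+
    then show ?thesis unfolding kappa_def abs_mult using that R[OF that(1)] by (intro mult_mono) auto
  qed
  then show ?thesis by (rule that)
qed

text \<open>The dwell time depends on the bound \<open>M\<close> alone and not on the signals, so it
  also applies to candidate signals that are not yet known to be solutions.\<close>

lemma trigger_dwell_bounded:
  obtains h where "0 < h" "\<And>x th s t. \<lbrakk>s \<le> t; continuous_on {s..t} x; continuous_on {s..t} th;
    \<And>r. r \<in> {s..t} \<Longrightarrow> \<bar>x r\<bar> \<le> M \<and> \<bar>th r\<bar> \<le> M; trigger rho gam x th s t\<rbrakk> \<Longrightarrow> h \<le> t - s"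
proof -
  obtain B where B: "\<And>y g. \<bar>y\<bar> \<le> M \<Longrightarrow> \<bar>g\<bar> \<le> M \<Longrightarrow> \<bar>kappa rho y g\<bar> \<le> B"
    using kappa_bounded[of M] by blast
  have "compact ((\<lambda>(x, th, w). gam x th w) ` ({-M..M} \<times> {-M..M} \<times> {-2*B..2*B}))"
    by (intro compact_continuous_image continuous_on_subset[OF gam(1)] compact_Times) auto
  from compact_imp_bounded[OF this]
  obtain G where G: "\<forall>v\<in>{-M..M} \<times> {-M..M} \<times> {-2*B..2*B}. \<bar>case v of (x, th, w) \<Rightarrow> gam x th w\<bar> \<le> G"
    by (auto simp: bounded_iff)
  define G' where "G' = max G 1"
  show ?thesis
  proof (rule that[of "1 / (4 * G')"])
    show "0 < 1 / (4 * G')" by (simp add: G'_def)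
    fix x th s t
    assume *: "s \<le> t" "continuous_on {s..t} x" "continuous_on {s..t} th"
      "\<And>r. r \<in> {s..t} \<Longrightarrow> \<bar>x r\<bar> \<le> M \<and> \<bar>th r\<bar> \<le> M" "trigger rho gam x th s t"
    have "gam (x r) (th r) (samp_err rho x th s r) \<le> G'" if "r \<in> {s..t}" for r
    proof -
      have "\<bar>kappa rho (x s) (th s)\<bar> \<le> B" "\<bar>kappa rho (x r) (th r)\<bar> \<le> B"
        using B *(4)[of s] *(4)[OF that] *(1) by auto
      then have "(x r, th r, samp_err rho x th s r) \<in> {-M..M} \<times> {-M..M} \<times> {-2*B..2*B}"
        using *(4)[OF that] unfolding samp_err_def by (auto simp: abs_le_iff)
      from G[rule_format, OF this] show ?thesis by (simp add: G'_def)
    qed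
    from trigger_dwell[OF *(2,3) rho_continuous gam(1) *(1) this *(5)]
    show "1 / (4 * G') \<le> t - s" by (simp add: G'_def field_simps)
  qed
qed

end

context trajectory
begin

lemma Lyap_coercive:
  assumes "0 \<le> C" "Lyap C g t \<le> B"
  shows "alow (norm (z t)) \<le> B" "(x t)\<^sup>2 \<le> 2 * B" "(th t - g)\<^sup>2 \<le> 2 * lam * B / b"
proof -
  have w: "1 \<le> weight C" using assms(1) by (simp add: weight_def)
  have nn: "0 \<le> (x t)\<^sup>2 / 2" "0 \<le> b / (2 * lam) * (th t - g)\<^sup>2" "0 \<le> weight C * U (z t)"
    using b(1) lam U_nonneg w by auto
  have "1 * U (z t) \<le> weight C * U (z t)" by (rule mult_right_mono[OF w U_nonneg])
  then show "alow (norm (z t)) \<le> B" using U(2)[of "z t"] nn assms(2) unfolding Lyap_def by linarith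
  show "(x t)\<^sup>2 \<le> 2 * B" using nn assms(2) unfolding Lyap_def by linarith
  have "b / (2 * lam) * (th t - g)\<^sup>2 \<le> B" using nn assms(2) unfolding Lyap_def by linarith
  then show "(th t - g)\<^sup>2 \<le> 2 * lam * B / b" using b(1) lam by (simp add: field_simps)
qed

text \<open>The gain is nondecreasing, so \<open>\<bar>th \<tau>\<bar>\<close> is at most the larger
  of its values at \<open>0\<close> and \<open>r\<close>; the product dominates either case and has
  the form required of \<open>N\<close>.\<close>

lemma gain_square_bound:
  assumes "0 \<le> \<tau>" "\<tau> \<le> r" "ereal r < T"
  shows "1 + (th \<tau>)\<^sup>2 \<le> (1 + (th 0)\<^sup>2) * (1 + (th r)\<^sup>2)"
proof -
  have \<tau>T: "ereal \<tau> < T" using assms le_less_trans[of "ereal \<tau>" "ereal r"] by simp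
  have "th 0 \<le> th \<tau>" "th \<tau> \<le> th r" using assms \<tau>T by (auto intro!: gain_mono)
  then have "\<bar>th \<tau>\<bar> \<le> \<bar>th 0\<bar> \<or> \<bar>th \<tau>\<bar> \<le> \<bar>th r\<bar>" by linarith
  then have "(th \<tau>)\<^sup>2 \<le> (th 0)\<^sup>2 \<or> (th \<tau>)\<^sup>2 \<le> (th r)\<^sup>2" by (simp add: abs_le_square_iff)
  moreover have "0 \<le> (th 0)\<^sup>2 * (th r)\<^sup>2" by simp
  moreover have "(1 + (th 0)\<^sup>2) * (1 + (th r)\<^sup>2) = 1 + (th 0)\<^sup>2 + (th r)\<^sup>2 + (th 0)\<^sup>2 * (th r)\<^sup>2"
    by (simp add: algebra_simps)
  ultimately show ?thesis using zero_le_power2[of "th 0"] zero_le_power2[of "th r"] by linarith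
qed

lemma Lyap_initial_bound:
  assumes "norm (z 0, x 0, th 0 - g) \<le> R" "0 \<le> C"
  shows "Lyap C g 0 \<le> weight C * a2 R + R\<^sup>2 / 2 + b / (2 * lam) * R\<^sup>2"
proof -
  have n: "norm (z 0) \<le> R" "\<bar>x 0\<bar> \<le> R" "\<bar>th 0 - g\<bar> \<le> R"
    using assms(1) norm_fst_le[of "z 0" "(x 0, th 0 - g)"] norm_snd_le[of "(x 0, th 0 - g)" "z 0"]
      norm_fst_le[of "x 0" "th 0 - g"] norm_snd_le[of "th 0 - g" "x 0"] by auto
  have "U (z 0) \<le> a2 R" using U(3)[of "z 0"] mono_onD[OF a2(3), of "norm (z 0)" R] n(1) norm_ge_zero[of "z 0"]
    by auto
  moreover have "(x 0)\<^sup>2 \<le> R\<^sup>2" "(th 0 - g)\<^sup>2 \<le> R\<^sup>2"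
    using n by (auto intro!: abs_le_square_iff[THEN iffD1])
  ultimately show ?thesis unfolding Lyap_def using assms(2) b(1) lam
    by (intro add_mono mult_left_mono divide_right_mono) (auto simp: weight_def)
qed

text \<open>Both \<open>M1\<close> and \<open>N\<close> can be chosen from \<open>R\<close> alone,
  which makes the bound uniform over initial data of norm at most \<open>R\<close>. The comparison
  gain is unrelated to the initial gain, hence the shift of the radius by
  \<open>\<bar>g\<bar>\<close>.\<close>

lemma Lyap_bound:
  assumes R: "norm (z 0, x 0, th 0) \<le> R"
    and C: "C = coupling (a2 R + (p + 1) * ((1 + R) / lam)) (1 + R\<^sup>2)" and t: "0 \<le> t" "ereal t < T"
  defines "g \<equiv> gain_threshold C"
  shows "Lyap C g t + integral {0..t} en
    \<le> weight C * a2 (R + \<bar>g\<bar>) + (R + \<bar>g\<bar>)\<^sup>2 / 2 + b / (2 * lam) * (R + \<bar>g\<bar>)\<^sup>2"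
proof -
  let ?M1 = "a2 R + (p + 1) * ((1 + R) / lam)"
  have n: "norm (z 0) \<le> R" "\<bar>th 0\<bar> \<le> R"
    using R norm_fst_le[of "z 0" "(x 0, th 0)"] norm_snd_le[of "(x 0, th 0)" "z 0"]
      norm_snd_le[of "th 0" "x 0"] by auto
  have R0: "0 \<le> R" using n by linarith
  have U0: "U (z 0) \<le> a2 R" using U(3)[of "z 0"] mono_onD[OF a2(3), of "norm (z 0)" R] n(1) norm_ge_zero[of "z 0"]
    by auto
  have "(p + 1) * ((1 - th 0) / lam) \<le> (p + 1) * ((1 + R) / lam)"
    using n p lam by (intro mult_left_mono divide_right_mono) auto
  then have M1: "integral {0..t} en \<le> ?M1" if "0 \<le> t" "ereal t < T" "th t \<le> 1" for t
    using integral_en_small_gain[OF that] U0 by linarith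
  have M10: "0 \<le> ?M1" using U0 U_nonneg[of "z 0"] p lam R0 by auto
  have N: "1 + (th \<tau>)\<^sup>2 \<le> (1 + R\<^sup>2) * (1 + (th r)\<^sup>2)" if "0 \<le> \<tau>" "\<tau> \<le> r" "ereal r < T" for \<tau> r
  proof -
    have "(th 0)\<^sup>2 \<le> R\<^sup>2" using n by (auto intro!: abs_le_square_iff[THEN iffD1])
    then have "(1 + (th 0)\<^sup>2) * (1 + (th r)\<^sup>2) \<le> (1 + R\<^sup>2) * (1 + (th r)\<^sup>2)" by (intro mult_right_mono) auto
    then show ?thesis using gain_square_bound[OF that] by linarith
  qed
  have "Lyap C g t + integral {0..t} en \<le> Lyap C g 0"
    unfolding g_def by (rule Lyap_decrease[OF M10 M1 _ N C order_refl t]) auto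
  also have "\<dots> \<le> weight C * a2 (R + \<bar>g\<bar>) + (R + \<bar>g\<bar>)\<^sup>2 / 2 + b / (2 * lam) * (R + \<bar>g\<bar>)\<^sup>2"
  proof (rule Lyap_initial_bound)
    have "norm (z 0, x 0, th 0 - g) = norm ((z 0, x 0, th 0) - (0, 0, g))" by simp
    also have "\<dots> \<le> norm (z 0, x 0, th 0) + norm (0 :: real ^ 'a, 0 :: real, g)" by (rule norm_triangle_ineq4)
    also have "norm (0 :: real ^ 'a, 0 :: real, g) = \<bar>g\<bar>" by (simp add: norm_Pair)
    finally show "norm (z 0, x 0, th 0 - g) \<le> R + \<bar>g\<bar>" using R by linarith
    show "0 \<le> C" unfolding C by (rule coupling_nonneg)
  qed
  finally show ?thesis .
qed

end

context closed_loop
begin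

abbreviation sol :: "ereal \<Rightarrow> (real \<Rightarrow> real ^ 'p) \<Rightarrow> (real \<Rightarrow> real) \<Rightarrow> (real \<Rightarrow> real) \<Rightarrow> bool" where
  "sol \<equiv> solution q f b lam rho gam d"

lemma trajectoryI: "sol T z x th \<Longrightarrow> trajectory q f D d b lam c p bbar rho rho' gam E m1 m2 U alow a2 T z x th"
  by unfold_locales

lemma bounded: "bounded_solutions sol"
  unfolding bounded_solutions_def
proof
  fix R
  define C where "C = coupling (a2 R + (p + 1) * ((1 + R) / lam)) (1 + R\<^sup>2)"
  define g where "g = gain_threshold C"
  define B where "B = weight C * a2 (R + \<bar>g\<bar>) + (R + \<bar>g\<bar>)\<^sup>2 / 2 + b / (2 * lam) * (R + \<bar>g\<bar>)\<^sup>2"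
  obtain Rz where Rz: "\<forall>r\<ge>Rz. B < alow r" using class_KinfD(6)[OF alow, of B] by blast
  define M where "M = Rz + (1 + 2 * B) + (\<bar>g\<bar> + 1 + 2 * lam * B / b)"
  have "norm (z t, x t, th t) \<le> M"
    if s: "sol T z x th" and R: "norm (z 0, x 0, th 0) \<le> R" and t: "0 \<le> t" "ereal t < T" for T z x th t
  proof -
    interpret trajectory q f D d b lam c p bbar rho rho' gam E m1 m2 U alow a2 T z x th by (rule trajectoryI[OF s])
    have C0: "0 \<le> C" unfolding C_def by (rule coupling_nonneg)
    have "Lyap C g t + integral {0..t} en \<le> B" unfolding g_def B_def by (rule Lyap_bound[OF R C_def t])
    then have "Lyap C g t \<le> B" using integral_en_nonneg[of 0 t] by linarith
    note co = Lyap_coercive[OF C0 this]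
    have "norm (z t) \<le> Rz" using co(1) Rz[rule_format, of "norm (z t)"] by linarith
    moreover have "\<bar>x t\<bar> \<le> 1 + 2 * B" using co(2) abs_le_1_square[of "x t"] by linarith
    moreover have "\<bar>th t\<bar> \<le> \<bar>g\<bar> + 1 + 2 * lam * B / b" using co(3) abs_le_1_square[of "th t - g"] by linarith
    ultimately show ?thesis using norm_triple_le[of "z t" "x t" "th t"] by (simp add: M_def)
  qed
  then show "\<exists>M. \<forall>T z x th. sol T z x th \<and> norm (z 0, x 0, th 0) \<le> R \<longrightarrow>
        (\<forall>t. 0 \<le> t \<and> ereal t < T \<longrightarrow> norm (z t, x t, th t) \<le> M)" by blast
qed

lemma stable: "stable_zx sol"
  unfolding stable_zx_def
proof (rule exI[of _ "max 3 (gain_threshold (coupling 0 1))"], intro allI impI)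
  fix g \<epsilon> :: real assume g: "max 3 (gain_threshold (coupling 0 1)) \<le> g" and e: "0 < \<epsilon>"
  \<comment> \<open>With \<open>g \<ge> 3\<close> and \<open>\<delta> \<le> 1\<close> the initial
    gain exceeds 1. Then no time is spent at gain at most 1 and \<open>1 + th\<^sup>2\<close> is
    nondecreasing, so \<open>M1 = 0\<close> and \<open>N = 1\<close> serve all these solutions, and
    the threshold is one number for all \<open>g\<close>.\<close>
  define C where "C = coupling 0 1"
  have C0: "0 \<le> C" unfolding C_def by (rule coupling_nonneg)
  define e4 where "e4 = \<epsilon> / 4"
  have e4: "0 < e4" using e by (simp add: e4_def)
  \<comment> \<open>The entries are levels of the Lyapunov function that keep \<open>z\<close>,
    \<open>x\<close> and \<open>th - g\<close> below \<open>\<epsilon> / 4\<close>, each with a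
    factor of at least 2 to spare in the squared or \<open>alow\<close> scale so that the
    inequalities are strict.\<close>
  define B where "B = min (alow e4 / 2) (min (e4\<^sup>2 / 4) (b * e4\<^sup>2 / (4 * lam)))"
  have B: "0 < B" "B < alow e4" "2 * B < e4\<^sup>2" "2 * lam * B / b < e4\<^sup>2"
  proof -
    have a: "0 < alow e4" using class_KinfD(4)[OF alow e4] .
    show "0 < B" using a e4 b(1) lam by (simp add: B_def)
    have "B \<le> alow e4 / 2" "B \<le> e4\<^sup>2 / 4" "B \<le> b * e4\<^sup>2 / (4 * lam)" by (auto simp: B_def)
    moreover have "0 < e4\<^sup>2" using e4 by simp
    ultimately show "B < alow e4" "2 * B < e4\<^sup>2" using a by linarith+
    have "2 * lam * B / b \<le> 2 * lam * (b * e4\<^sup>2 / (4 * lam)) / b"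
      using \<open>B \<le> b * e4\<^sup>2 / (4 * lam)\<close> lam b(1) by (intro divide_right_mono mult_left_mono) auto
    also have "\<dots> = e4\<^sup>2 / 2" using lam b(1) by simp
    also have "\<dots> < e4\<^sup>2" using \<open>0 < e4\<^sup>2\<close> by simp
    finally show "2 * lam * B / b < e4\<^sup>2" .
  qed
  let ?\<psi> = "\<lambda>r. weight C * a2 r + r\<^sup>2 / 2 + b / (2 * lam) * r\<^sup>2"
  have "continuous_on {0..} ?\<psi>" by (intro continuous_intros a2(1)) auto
  then obtain \<delta>0 where \<delta>0: "\<delta>0 > 0" "\<forall>r\<in>{0..}. dist r 0 < \<delta>0 \<longrightarrow> dist (?\<psi> r) (?\<psi> 0) < B"
    using B(1) unfolding continuous_on_iff by (metis atLeast_iff order_refl)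
  define \<delta> where "\<delta> = min 1 (\<delta>0 / 2)"
  have \<delta>: "0 < \<delta>" "\<delta> \<le> 1" using \<delta>0 by (auto simp: \<delta>_def)
  have "dist (?\<psi> \<delta>) (?\<psi> 0) < B" using \<delta>0 \<delta> by (intro \<delta>0(2)[rule_format]) (auto simp: \<delta>_def)
  then have \<psi>: "?\<psi> \<delta> \<le> B" by (simp add: a2(2) dist_real_def)
  have "norm (z t, x t, th t - g) < \<epsilon>"
    if s: "sol T z x th" and i: "norm (z 0, x 0, th 0 - g) < \<delta>" and t: "0 \<le> t" "ereal t < T" for T z x th t
  proof -
    interpret trajectory q f D d b lam c p bbar rho rho' gam E m1 m2 U alow a2 T z x th by (rule trajectoryI[OF s])
    have "\<bar>th 0 - g\<bar> \<le> norm (z 0, x 0, th 0 - g)"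
      using norm_snd_le[of "(x 0, th 0 - g)" "z 0"] norm_snd_le[of "th 0 - g" "x 0"] by simp
    then have th0: "1 < th 0" using i \<delta> g by linarith
    have M1: "integral {0..t} en \<le> 0" if "0 \<le> t" "ereal t < T" "th t \<le> 1" for t
      using gain_mono[of 0 t] that th0 by auto
    have N: "1 + (th \<tau>)\<^sup>2 \<le> 1 * (1 + (th r)\<^sup>2)" if \<tau>: "0 \<le> \<tau>" "\<tau> \<le> r" "ereal r < T" for \<tau> r
    proof -
      have "ereal \<tau> < T" using \<tau> le_less_trans[of "ereal \<tau>" "ereal r"] by simp
      then have "th 0 \<le> th \<tau>" "th \<tau> \<le> th r" using \<tau> by (auto intro!: gain_mono)
      then show ?thesis using th0 by (simp add: power_mono)
    qed
    have "Lyap C g t + integral {0..t} en \<le> Lyap C g 0"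
      by (rule Lyap_decrease[OF order_refl M1 order_refl N C_def _ t]) (use g in \<open>auto simp: C_def\<close>)
    also have "\<dots> \<le> ?\<psi> \<delta>" using i C0 by (intro Lyap_initial_bound) auto
    finally have "Lyap C g t \<le> B" using integral_en_nonneg[of 0 t] \<psi> by linarith
    note co = Lyap_coercive[OF C0 this]
    have "norm (z t) < e4"
      using co(1) B(2) class_KinfD(3)[OF alow, of e4 "norm (z t)"] e4 by (cases "e4 \<le> norm (z t)") auto
    moreover have "\<bar>x t\<bar> < e4" using co(2) B(3) e4 by (intro power2_less_imp_less[of "\<bar>x t\<bar>"]) auto
    moreover have "\<bar>th t - g\<bar> < e4" using co(3) B(4) e4 by (intro power2_less_imp_less[of "\<bar>th t - g\<bar>"]) auto
    ultimately show ?thesis using norm_triple_le[of "z t" "x t" "th t - g"] e by (simp add: e4_def)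
  qed
  then show "\<exists>\<delta>>0. \<forall>T z x th. sol T z x th \<and> norm (z 0, x 0, th 0 - g) < \<delta> \<longrightarrow>
        (\<forall>t. 0 \<le> t \<and> ereal t < T \<longrightarrow> norm (z t, x t, th t - g) < \<epsilon>)"
    using \<delta>(1) by blast
qed

lemma field_bounded:
  obtains B where "\<And>z x d'. norm z \<le> M \<Longrightarrow> \<bar>x\<bar> \<le> M \<Longrightarrow> d' \<in> D \<Longrightarrow> norm (q z x d') \<le> B \<and> \<bar>f z x d'\<bar> \<le> B"
proof -
  have c: "compact (cball (0 :: real ^ 'p) M \<times> {-M..M} \<times> D)" by (intro compact_Times compact_cball compact_Icc D(1))
  have "compact ((\<lambda>(z, x, d). q z x d) ` (cball 0 M \<times> {-M..M} \<times> D))"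
    by (intro compact_continuous_image C_k_1D(3)[OF qf(1)] c)
  from compact_imp_bounded[OF this] obtain B1
    where B1: "\<forall>v\<in>cball 0 M \<times> {-M..M} \<times> D. norm (case v of (z, x, d) \<Rightarrow> q z x d) \<le> B1"
    by (auto simp: bounded_iff)
  have "compact ((\<lambda>(z, x, d). f z x d) ` (cball 0 M \<times> {-M..M} \<times> D))"
    by (intro compact_continuous_image C_k_1D(3)[OF qf(2)] c)
  from compact_imp_bounded[OF this] obtain B2
    where B2: "\<forall>v\<in>cball 0 M \<times> {-M..M} \<times> D. norm (case v of (z, x, d) \<Rightarrow> f z x d) \<le> B2"
    by (auto simp: bounded_iff)
  have "norm (q z x d') \<le> max B1 B2 \<and> \<bar>f z x d'\<bar> \<le> max B1 B2"
    if "norm z \<le> M" "\<bar>x\<bar> \<le> M" "d' \<in> D" for z x d'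
  proof -
    have "(z, x, d') \<in> cball 0 M \<times> {-M..M} \<times> D" using that by (auto simp: abs_le_iff)
    then show ?thesis using B1[rule_format, of "(z, x, d')"] B2[rule_format, of "(z, x, d')"] by auto
  qed
  then show ?thesis by (rule that)
qed

end

section \<open>A priori Lipschitz bound and dwell time\<close>

context trajectory
begin

lemma solution_bound:
  obtains M where "0 \<le> M" "\<And>t. 0 \<le> t \<Longrightarrow> ereal t < T \<Longrightarrow> norm (z t) \<le> M \<and> \<bar>x t\<bar> \<le> M \<and> \<bar>th t\<bar> \<le> M"
proof -
  obtain M where M: "\<And>t. 0 \<le> t \<Longrightarrow> ereal t < T \<Longrightarrow> norm (z t, x t, th t) \<le> M"
    using bounded sol unfolding bounded_solutions_def by (metis order_refl)
  have "norm (z t) \<le> \<bar>M\<bar> \<and> \<bar>x t\<bar> \<le> \<bar>M\<bar> \<and> \<bar>th t\<bar> \<le> \<bar>M\<bar>" if "0 \<le> t" "ereal t < T" for t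
    using M[OF that] norm_fst_le[of "z t" "(x t, th t)"] norm_snd_le[of "(x t, th t)" "z t"]
      norm_fst_le[of "x t" "th t"] norm_snd_le[of "th t" "x t"] by auto
  then show ?thesis using that[of "\<bar>M\<bar>"] by auto
qed

text \<open>The bounded state, together with compactness of \<open>D\<close>, bounds all velocities.
  This serves twice: as uniform continuity in the convergence argument, and to extend a solution
  continuously to a finite horizon.\<close>

lemma lipschitz_bound:
  obtains L where "0 \<le> L" "\<And>s t. 0 \<le> s \<Longrightarrow> s \<le> t \<Longrightarrow> ereal t < T \<Longrightarrow>
    norm ((z t, x t, th t) - (z s, x s, th s)) \<le> L * (t - s)"
proof -
  obtain M where M: "0 \<le> M" "\<And>t. 0 \<le> t \<Longrightarrow> ereal t < T \<Longrightarrow> norm (z t) \<le> M \<and> \<bar>x t\<bar> \<le> M \<and> \<bar>th t\<bar> \<le> M"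
    using solution_bound by blast
  obtain B1 where B1: "\<And>z x d'. norm z \<le> M \<Longrightarrow> \<bar>x\<bar> \<le> M \<Longrightarrow> d' \<in> D \<Longrightarrow> norm (q z x d') \<le> B1 \<and> \<bar>f z x d'\<bar> \<le> B1"
    by (rule field_bounded) blast
  obtain B2 where B2: "\<And>y g. \<bar>y\<bar> \<le> M \<Longrightarrow> \<bar>g\<bar> \<le> M \<Longrightarrow> \<bar>kappa rho y g\<bar> \<le> B2"
    using kappa_bounded[of M] by blast
  have "compact ((\<lambda>y. lam * rho y * y\<^sup>2) ` {-M..M})"
    by (intro compact_continuous_image continuous_intros rho_continuous) auto
  from compact_imp_bounded[OF this] obtain B3 where "\<forall>y\<in>{-M..M}. \<bar>lam * rho y * y\<^sup>2\<bar> \<le> B3"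
    by (auto simp: bounded_iff)
  then have B3: "\<bar>lam * rho y * y\<^sup>2\<bar> \<le> B3" if "\<bar>y\<bar> \<le> M" for y using that by (auto simp: abs_le_iff)
  define L where "L = \<bar>B1\<bar> + (\<bar>B1\<bar> + b * \<bar>B2\<bar>) + \<bar>B3\<bar>"
  have L0: "0 \<le> L" using b(1) by (simp add: L_def)
  have "norm ((z t, x t, th t) - (z s, x s, th s)) \<le> L * (t - s)" if st: "0 \<le> s" "s \<le> t" "ereal t < T" for s t
  proof -
    obtain S where S: "finite S" "\<And>r. r \<in> {s<..<t} - S \<Longrightarrow>
      (z has_vector_derivative q (z r) (x r) (d r)) (at r) \<and>
      (th has_real_derivative lam * rho (x r) * (x r)\<^sup>2) (at r) \<and> d r \<in> D \<and>
      (\<exists>s'\<in>{0..r}. (x has_real_derivative f (z r) (x r) (d r) + b * kappa rho (x s') (th s')) (at r))"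
      using derivatives[OF st(3,1)] by blast
    show ?thesis
    proof (rule norm_diff_le_off_finite[OF st(2) S(1) _ L0, of "\<lambda>r. (z r, x r, th r)"])
      show "continuous_on {s..t} (\<lambda>r. (z r, x r, th r))" by (intro continuous_intros continuous st)
      fix r assume r: "r \<in> {s<..<t} - S"
      obtain s' where s': "s' \<in> {0..r}" "(x has_real_derivative f (z r) (x r) (d r) + b * kappa rho (x s') (th s')) (at r)"
        using S(2)[OF r] by blast
      have rT: "0 \<le> r" "ereal r < T" using r st less_trans[of "ereal r" "ereal t"] by auto
      have s'T: "0 \<le> s'" "ereal s' < T" using s' rT le_less_trans[of "ereal s'" "ereal r"] by auto
      let ?D = "(q (z r) (x r) (d r), f (z r) (x r) (d r) + b * kappa rho (x s') (th s'), lam * rho (x r) * (x r)\<^sup>2)"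
      have "((\<lambda>r. (z r, x r, th r)) has_vector_derivative ?D) (at r)"
        using S(2)[OF r] s'(2)
        by (intro has_vector_derivative_Pair) (auto simp: has_real_derivative_iff_has_vector_derivative)
      moreover have "norm ?D \<le> L"
      proof -
        have 1: "norm (q (z r) (x r) (d r)) \<le> B1 \<and> \<bar>f (z r) (x r) (d r)\<bar> \<le> B1"
          using B1 M(2)[OF rT] S(2)[OF r] by blast
        have "\<bar>kappa rho (x s') (th s')\<bar> \<le> B2" using B2 M(2)[OF s'T] by blast
        then have "b * \<bar>kappa rho (x s') (th s')\<bar> \<le> b * \<bar>B2\<bar>" using b(1) by (intro mult_left_mono) auto
        then have 2: "\<bar>f (z r) (x r) (d r) + b * kappa rho (x s') (th s')\<bar> \<le> \<bar>B1\<bar> + b * \<bar>B2\<bar>"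
          using 1 abs_triangle_ineq[of "f (z r) (x r) (d r)" "b * kappa rho (x s') (th s')"]
            abs_mult[of b "kappa rho (x s') (th s')"] abs_of_pos[OF b(1)] by (simp only:) linarith
        have "\<bar>lam * rho (x r) * (x r)\<^sup>2\<bar> \<le> B3" using B3 M(2)[OF rT] by blast
        then show ?thesis using 1 2 norm_triple_le[of "q (z r) (x r) (d r)"
            "f (z r) (x r) (d r) + b * kappa rho (x s') (th s')" "lam * rho (x r) * (x r)\<^sup>2"]
          unfolding L_def real_norm_def by linarith
      qed
      ultimately show "\<exists>D. ((\<lambda>r. (z r, x r, th r)) has_vector_derivative D) (at r) \<and> norm D \<le> L" by blast
    qed
  qed
  then show ?thesis using that[OF L0] by blast
qed

lemma sample_time_dwell:
  obtains h where "0 < h" "\<And>k s. ts k = ereal s \<Longrightarrow> ereal (s + h) \<le> ts (Suc k)"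
proof -
  obtain M where M: "0 \<le> M" "\<And>t. 0 \<le> t \<Longrightarrow> ereal t < T \<Longrightarrow> norm (z t) \<le> M \<and> \<bar>x t\<bar> \<le> M \<and> \<bar>th t\<bar> \<le> M"
    using solution_bound by blast
  obtain h where h: "0 < h" "\<And>x th s t. \<lbrakk>s \<le> t; continuous_on {s..t} x; continuous_on {s..t} th;
    \<And>r. r \<in> {s..t} \<Longrightarrow> \<bar>x r\<bar> \<le> M \<and> \<bar>th r\<bar> \<le> M; trigger rho gam x th s t\<rbrakk> \<Longrightarrow> h \<le> t - s"
    by (rule trigger_dwell_bounded) blast
  have "ereal (s + h) \<le> ts (Suc k)" if k: "ts k = ereal s" for k s
    unfolding sample_time_Suc_eq[OF k]
  proof (intro Inf_greatest)
    fix v assume "v \<in> ereal ` {t. s \<le> t \<and> ereal t < T \<and> trigger rho gam x th s t}"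
    then obtain t where t: "v = ereal t" "s \<le> t" "ereal t < T" "trigger rho gam x th s t" by auto
    have s0: "0 \<le> s" by (rule sample_time_cases[OF T_pos, of rho gam x th k]) (use k in auto)
    have "h \<le> t - s"
    proof (rule h(2)[OF t(2) continuous(2)[OF t(3) s0] continuous(3)[OF t(3) s0] _ t(4)])
      fix r assume "r \<in> {s..t}"
      then show "\<bar>x r\<bar> \<le> M \<and> \<bar>th r\<bar> \<le> M"
        using M(2)[of r] s0 t(3) le_less_trans[of "ereal r" "ereal t" T] by auto
    qed
    then show "ereal (s + h) \<le> v" using t(1) by simp
  qed
  then show ?thesis using that[OF h(1)] by blast
qed

lemma finite_samples: "finite {k. ts k \<le> ereal s}"
proof -
  obtain h where h: "0 < h" "\<And>k s. ts k = ereal s \<Longrightarrow> ereal (s + h) \<le> ts (Suc k)"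
    by (rule sample_time_dwell) blast
  have ge: "ereal (real k * h) \<le> ts k" for k
  proof (induction k)
    case (Suc k)
    show ?case
    proof (rule sample_time_cases[OF T_pos, of rho gam x th k])
      assume "ts k = \<infinity>"
      then show ?thesis by simp
    next
      fix s assume s: "ts k = ereal s"
      have "ereal (real (Suc k) * h) \<le> ereal (s + h)" using Suc.IH s by (simp add: algebra_simps)
      also have "\<dots> \<le> ts (Suc k)" by (rule h(2)[OF s])
      finally show ?thesis .
    qed
  qed (simp add: zero_ereal_def)
  have "k \<le> nat \<lceil>s / h\<rceil>" if "ts k \<le> ereal s" for k
  proof -
    have "real k * h \<le> s" using order_trans[OF ge that] by simp
    then have "real k \<le> s / h" using h(1) by (simp add: field_simps)
    then show ?thesis by linarith
  qed
  then have "{k. ts k \<le> ereal s} \<subseteq> {..nat \<lceil>s / h\<rceil>}" by auto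
  then show ?thesis by (rule finite_subset) simp
qed

end

context closed_loop
begin

lemma Zeno_free: "Zeno_free q f b lam rho gam d"
  unfolding Zeno_free_def using trajectory.finite_samples[OF trajectoryI] by blast

text \<open>Barbalat's argument: the energy \<open>en\<close> is integrable and the state is Lipschitz in time.\<close>

lemma attractive: "attractive_zx sol"
  unfolding attractive_zx_def
proof (intro allI impI)
  fix z x th assume s: "sol \<infinity> z x th"
  interpret trajectory q f D d b lam c p bbar rho rho' gam E m1 m2 U alow a2 \<infinity> z x th by (rule trajectoryI[OF s])
  obtain M where M: "0 \<le> M" "\<And>t. 0 \<le> t \<Longrightarrow> norm (z t) \<le> M \<and> \<bar>x t\<bar> \<le> M \<and> \<bar>th t\<bar> \<le> M"
    using solution_bound by auto
  obtain L where L: "0 \<le> L" "\<And>s t. 0 \<le> s \<Longrightarrow> s \<le> t \<Longrightarrow> norm ((z t, x t, th t) - (z s, x s, th s)) \<le> L * (t - s)"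
    using lipschitz_bound by auto
  let ?y = "\<lambda>t. norm (z t, x t)"
  have ylip: "?y s - ?y t \<le> L * (t - s)" if "0 \<le> s" "s \<le> t" for s t
  proof -
    have "?y s - ?y t \<le> norm ((z t, x t) - (z s, x s))" by (metis norm_minus_commute norm_triangle_ineq2)
    also have "\<dots> \<le> norm ((z t, x t, th t) - (z s, x s, th s))" by (simp add: norm_Pair)
    also have "\<dots> \<le> L * (t - s)" by (rule L(2)[OF that])
    finally show ?thesis .
  qed
  have "compact (m1 ` cball 0 M)" by (intro compact_continuous_image continuous_on_subset[OF m1(1)]) auto
  moreover have "m1 ` cball 0 M \<noteq> {}" using M(1) by auto
  ultimately obtain v where "\<forall>u\<in>m1 ` cball 0 M. m1 v \<le> u"
    using compact_attains_inf[of "m1 ` cball 0 M"] by blast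
  then have v: "m1 v \<le> m1 u" if "norm u \<le> M" for u using that by auto
  define \<mu> where "\<mu> = min 1 ((m1 v)\<^sup>2)"
  have \<mu>: "0 < \<mu>" "\<mu> \<le> 1" "\<mu> \<le> (m1 v)\<^sup>2" using m1(2)[of v] by (auto simp: \<mu>_def)
  have eny: "\<mu> * (?y t)\<^sup>2 \<le> en t" if "0 \<le> t" for t
  proof -
    have "\<mu> * (norm (z t))\<^sup>2 \<le> (m1 (z t))\<^sup>2 * (norm (z t))\<^sup>2"
    proof (rule mult_right_mono)
      have "(m1 v)\<^sup>2 \<le> (m1 (z t))\<^sup>2" using v M(2)[OF that] m1(2)[of v] by (intro power_mono) auto
      then show "\<mu> \<le> (m1 (z t))\<^sup>2" using \<mu> by linarith
    qed simp
    moreover have "\<mu> * (x t)\<^sup>2 \<le> rho (x t) * (x t)\<^sup>2" using \<mu>(2) rho(3)[of "x t"] by (intro mult_right_mono) auto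
    moreover have "(?y t)\<^sup>2 = (norm (z t))\<^sup>2 + (x t)\<^sup>2" by (simp add: norm_Pair)
    ultimately show ?thesis by (simp add: en_def power_mult_distrib distrib_left)
  qed
  let ?J = "\<lambda>t. integral {0..t} en"
  have "\<exists>B. \<forall>t\<ge>0. ?J t \<le> B"
  proof -
    define R where "R = norm (z 0, x 0, th 0)"
    define C where "C = coupling (a2 R + (p + 1) * ((1 + R) / lam)) (1 + R\<^sup>2)"
    have C0: "0 \<le> C" unfolding C_def by (rule coupling_nonneg)
    have nn: "0 \<le> Lyap C g t" for g t
      unfolding Lyap_def using b(1) lam U_nonneg C0 by (intro add_nonneg_nonneg) (auto simp: weight_def)
    define g where "g = gain_threshold C"
    have "?J t \<le> weight C * a2 (R + \<bar>g\<bar>) + (R + \<bar>g\<bar>)\<^sup>2 / 2 + b / (2 * lam) * (R + \<bar>g\<bar>)\<^sup>2"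
      if "0 \<le> t" for t
      using Lyap_bound[OF eq_refl[OF R_def[symmetric]] C_def that] nn[of g t] by (simp add: g_def)
    then show ?thesis by blast
  qed
  then obtain B where B: "\<And>t. 0 \<le> t \<Longrightarrow> ?J t \<le> B" by blast
  have Jmono: "?J s \<le> ?J t" if "0 \<le> s" "s \<le> t" for s t using that by (intro integral_en_mono) auto
  have "\<forall>\<^sub>F t in at_top. ?y t < e" if e: "0 < e" for e
  proof -
    \<comment> \<open>If the state has norm at least \<open>e\<close> at time \<open>t\<close>, the
      Lipschitz bound keeps it above \<open>e / 2\<close> on \<open>[t, t + h]\<close>, which costs
      energy at least \<open>\<eta>\<close>. The summand 1 avoids division by zero.\<close>
    define h where "h = e / (2 * (L + 1))"
    have h: "0 < h" "L * h \<le> e / 2"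
    proof -
      show "0 < h" using e L(1) by (simp add: h_def)
      have "L * h \<le> (L + 1) * h" using \<open>0 < h\<close> by (intro mult_right_mono) auto
      also have "\<dots> = e / 2" using L(1) by (simp add: h_def field_simps add_nonneg_eq_0_iff)
      finally show "L * h \<le> e / 2" .
    qed
    define \<eta> where "\<eta> = h * (\<mu> * (e / 2)\<^sup>2)"
    have \<eta>: "0 < \<eta>" using h e \<mu> by (simp add: \<eta>_def)
    have bdd: "bdd_above (?J ` {0..})" using B by (auto simp: bdd_above_def)
    \<comment> \<open>After \<open>t0\<close> less than \<open>\<eta>\<close> of the total energy is
      left, too little for another excursion of size \<open>e\<close>.\<close>
    obtain t0 where t0: "0 \<le> t0" "(SUP t\<in>{0..}. ?J t) - \<eta> < ?J t0"
      using less_cSUP_iff[OF _ bdd, of "(SUP t\<in>{0..}. ?J t) - \<eta>"] \<eta> by auto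
    have "?y t < e" if t: "t0 \<le> t" for t
    proof (rule ccontr)
      assume "\<not> ?y t < e"
      then have y: "e \<le> ?y t" by simp
      have t00: "0 \<le> t" using t t0 by simp
      have "\<mu> * (e / 2)\<^sup>2 \<le> en s" if s: "s \<in> {t..t + h}" for s
      proof -
        have "L * (s - t) \<le> L * h" using s L(1) by (intro mult_left_mono) auto
        then have "e / 2 \<le> ?y s" using ylip[OF t00, of s] y s h(2) by auto
        then have "\<mu> * (e / 2)\<^sup>2 \<le> \<mu> * (?y s)\<^sup>2" using e \<mu> by (intro mult_left_mono power_mono) auto
        also have "\<dots> \<le> en s" using eny[of s] s t00 by auto
        finally show ?thesis .
      qed
      then have "integral {t..t + h} (\<lambda>_. \<mu> * (e / 2)\<^sup>2) \<le> integral {t..t + h} en"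
        using t00 by (intro integral_le en_integrable integrable_const_ivl) auto
      then have "\<eta> \<le> integral {t..t + h} en" using h(1) by (simp add: \<eta>_def mult.left_commute)
      moreover have "?J t + integral {t..t + h} en = ?J (t + h)"
        using t00 h by (intro Henstock_Kurzweil_Integration.integral_combine en_integrable) auto
      moreover have "?J t0 \<le> ?J t" using t t0 by (intro Jmono)
      moreover have "?J (t + h) \<le> (SUP t\<in>{0..}. ?J t)" using t00 h by (intro cSUP_upper bdd) auto
      ultimately show False using t0(2) by linarith
    qed
    then show ?thesis by (auto simp: eventually_at_top_linorder)
  qed
  then show "((\<lambda>t. (z t, x t)) \<longlongrightarrow> (0, 0)) at_top"
    by (intro tendstoI) (simp add: dist_norm zero_prod_def[symmetric])
qed

end

subsection \<open>Localisation of solutions in time\<close>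

text \<open>\<open>t\<close> itself may belong to \<open>S\<close>. As \<open>y\<close> is the
  integral of \<open>g\<close> up to a constant, continuity of \<open>g\<close> at \<open>t\<close>
  still yields the derivative there.\<close>

lemma derivative_at_continuity_point:
  fixes y :: "real \<Rightarrow> 'a::euclidean_space"
  assumes "a < t" "t < b" "finite S" "continuous_on {a..b} y"
    and d: "\<And>r. r \<in> {a<..<b} - S \<Longrightarrow> (y has_vector_derivative g r) (at r)" and g: "isCont g t"
  shows "(y has_vector_derivative g t) (at t)"
proof -
  have hi: "(g has_integral (y r - y a)) {a..r}" if "r \<in> {a..b}" for r
    using that assms(3,4) d
    by (intro fundamental_theorem_of_calculus_interior_strong[of S]) (auto intro: continuous_on_subset)
  have "((\<lambda>u. integral {a..u} g) has_vector_derivative g t) (at t within ({a..b} - {}))"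
    using hi[of b] assms(1,2) g
    by (intro integral_has_vector_derivative_continuous_at) (auto intro: continuous_at_imp_continuous_at_within)
  then have "((\<lambda>u. integral {a..u} g) has_vector_derivative g t) (at t)"
    using assms(1,2) at_within_interior[of t "{a..b}"] by (simp add: interior_atLeastAtMost_real)
  then have "((\<lambda>u. y a + integral {a..u} g) has_vector_derivative 0 + g t) (at t)"
    by (intro has_vector_derivative_add has_vector_derivative_const)
  then have "((\<lambda>u. y a + integral {a..u} g) has_vector_derivative g t) (at t)" by simp
  then show ?thesis
  proof (rule has_vector_derivative_transform_within_open[of _ _ _ "{a<..<b}"])
    fix u assume "u \<in> {a<..<b}"
    then show "y a + integral {a..u} g = y u" using integral_unique[OF hi[of u]] by simp
  qed (use assms(1,2) in auto)
qed

lemma trigger_cong: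
  assumes "s \<le> t" "\<And>r. s \<le> r \<Longrightarrow> r \<le> t \<Longrightarrow> x' r = x r \<and> th' r = th r"
  shows "trigger rho gam x' th' s t = trigger rho gam x th s t"
proof -
  have w: "samp_err rho x' th' s r = samp_err rho x th s r" if "r \<in> {s..t}" for r
    using assms that by (simp add: samp_err_def)
  have "(SUP r\<in>{s..t}. gam (x' r) (th' r) (samp_err rho x' th' s r) * (samp_err rho x' th' s r)\<^sup>2)
    = (SUP r\<in>{s..t}. gam (x r) (th r) (samp_err rho x th s r) * (samp_err rho x th s r)\<^sup>2)"
    using w assms(2) by (intro SUP_cong) auto
  moreover have "sup_norm (samp_err rho x' th' s) s t = sup_norm (samp_err rho x th s) s t"
    unfolding sup_norm_def using w by (intro SUP_cong) auto
  ultimately show ?thesis by (simp add: trigger_def Let_def)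
qed

text \<open>An event at \<open>t\<close> is decided by the signals on \<open>[s,t]\<close>, so a
  larger horizon can only replace the value \<open>\<infinity>\<close> by one that is at least
  \<open>T\<close>.\<close>

lemma sample_time_agree:
  assumes "0 < T" "T \<le> T'" and agree: "\<And>t. 0 \<le> t \<Longrightarrow> ereal t < T \<Longrightarrow> x' t = x t \<and> th' t = th t"
  shows "sample_time rho gam T' x' th' k = sample_time rho gam T x th k
    \<or> sample_time rho gam T x th k = \<infinity> \<and> T \<le> sample_time rho gam T' x' th' k"
proof (induction k)
  case (Suc k)
  have T': "0 < T'" using assms by simp
  let ?ts = "sample_time rho gam T x th" and ?ts' = "sample_time rho gam T' x' th'"
  from Suc show ?case
  proof
    assume eq: "?ts' k = ?ts k"
    show ?thesis
    proof (rule sample_time_cases[OF assms(1), of rho gam x th k])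
      assume "?ts k = \<infinity>"
      then show ?thesis using eq by simp
    next
      fix s assume s: "0 \<le> s" "?ts k = ereal s" "ereal s < T"
      let ?A = "{t. s \<le> t \<and> ereal t < T \<and> trigger rho gam x th s t}"
      let ?A' = "{t. s \<le> t \<and> ereal t < T' \<and> trigger rho gam x' th' s t}"
      have tr: "trigger rho gam x' th' s t = trigger rho gam x th s t" if "s \<le> t" "ereal t < T" for t
        using that s by (intro trigger_cong agree) (auto intro: le_less_trans[of _ "ereal t"])
      have e: "?ts (Suc k) = Inf (ereal ` ?A)" "?ts' (Suc k) = Inf (ereal ` ?A')"
        by (rule sample_time_Suc_eq[OF s(2)], rule sample_time_Suc_eq[OF trans[OF eq s(2)]])
      show ?thesis
      proof (cases "?A = {}")
        case True
        have "T \<le> Inf (ereal ` ?A')"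
        proof (rule Inf_greatest)
          fix v assume "v \<in> ereal ` ?A'"
          then obtain t where "v = ereal t" "t \<in> ?A'" by blast
          then show "T \<le> v" using True tr[of t] by (auto simp: not_less[symmetric])
        qed
        then show ?thesis unfolding e True by (simp add: top_ereal_def)
      next
        case False
        then obtain t0 where t0: "t0 \<in> ?A" by blast
        have "?A \<subseteq> ?A'" using tr assms(2) by (auto intro: less_le_trans)
        then have "Inf (ereal ` ?A') \<le> Inf (ereal ` ?A)" by (intro Inf_superset_mono image_mono)
        moreover have "Inf (ereal ` ?A) \<le> Inf (ereal ` ?A')"
        proof (rule Inf_greatest)
          fix v assume "v \<in> ereal ` ?A'"
          then obtain t where t: "v = ereal t" "t \<in> ?A'" by blast
          show "Inf (ereal ` ?A) \<le> v"
          proof (cases "ereal t < T")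
            case True
            then show ?thesis using t tr[of t] by (intro Inf_lower) auto
          next
            case False
            have "Inf (ereal ` ?A) \<le> ereal t0" using t0 by (intro Inf_lower) auto
            also have "ereal t0 \<le> T" using t0 by (auto intro: less_imp_le)
            also have "T \<le> v" using False t(1) by (simp add: not_less)
            finally show ?thesis .
          qed
        qed
        ultimately show ?thesis unfolding e by simp
      qed
    qed
  next
    assume "?ts k = \<infinity> \<and> T \<le> ?ts' k"
    then show ?thesis using sample_time_le_Suc[OF T', of rho gam x' th' k] order_trans by (auto simp del: ereal_infty_less)
  qed
qed simp

lemma sampling_interval_agree:
  assumes "0 < T" "T \<le> T'" and agree: "\<And>t. 0 \<le> t \<Longrightarrow> ereal t < T \<Longrightarrow> x' t = x t \<and> th' t = th t"
    and t: "ereal t < T"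
  shows "sample_time rho gam T' x' th' k \<le> ereal t \<and> ereal t < sample_time rho gam T' x' th' (Suc k) \<longleftrightarrow>
      sample_time rho gam T x th k \<le> ereal t \<and> ereal t < sample_time rho gam T x th (Suc k)"
    and "sample_time rho gam T x th k \<le> ereal t \<Longrightarrow> sample_time rho gam T' x' th' k = sample_time rho gam T x th k"
proof -
  have ag: "sample_time rho gam T' x' th' j = sample_time rho gam T x th j
    \<or> sample_time rho gam T x th j = \<infinity> \<and> T \<le> sample_time rho gam T' x' th' j" for j
    by (rule sample_time_agree[OF assms(1,2) agree])
  show "sample_time rho gam T' x' th' k \<le> ereal t \<and> ereal t < sample_time rho gam T' x' th' (Suc k) \<longleftrightarrow>
      sample_time rho gam T x th k \<le> ereal t \<and> ereal t < sample_time rho gam T x th (Suc k)"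
    "sample_time rho gam T x th k \<le> ereal t \<Longrightarrow> sample_time rho gam T' x' th' k = sample_time rho gam T x th k"
    using ag[of k] ag[of "Suc k"] t by (auto simp del: sample_time.simps)
qed

lemma continuous_on_initial_segment:
  fixes y :: "real \<Rightarrow> 'a::topological_space"
  assumes "\<And>r. 0 \<le> r \<Longrightarrow> ereal r < T \<Longrightarrow> continuous_on {0..r} y"
  shows "continuous_on {t. 0 \<le> t \<and> ereal t < T} y"
  unfolding continuous_on_eq_continuous_within
proof
  fix t assume t: "t \<in> {t. 0 \<le> t \<and> ereal t < T}"
  then obtain r where r: "ereal t < ereal r" "ereal r < T" using ereal_dense2[of "ereal t" T] by auto
  have "continuous (at t within {0..r}) y"
    using assms[of r] r t by (auto simp: continuous_on_eq_continuous_within)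
  moreover have "at t within {0..r} = at t within {t. 0 \<le> t \<and> ereal t < T}"
  proof (rule at_within_nhd[of _ "{..<r}"])
    show "{0..r} \<inter> {..<r} - {t} = {t. 0 \<le> t \<and> ereal t < T} \<inter> {..<r} - {t}"
      using r(2) by (auto intro: less_trans[of _ "ereal r"])
  qed (use r in auto)
  ultimately show "continuous (at t within {t. 0 \<le> t \<and> ereal t < T}) y"
    by (simp add: continuous_within)
qed

context closed_loop
begin

text \<open>The differential equation at a single instant, isolated so that its failures can serve
  as a canonical exceptional set.\<close>

definition ode_at where
  "ode_at T z x th t \<longleftrightarrow> (\<forall>k. 0 < t \<and> sample_time rho gam T x th k \<le> ereal t \<and> ereal t < sample_time rho gam T x th (Suc k) \<longrightarrow>
     (z has_vector_derivative q (z t) (x t) (d t)) (at t) \<and>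
     (x has_real_derivative f (z t) (x t) (d t)
        + b * kappa rho (x (real_of_ereal (sample_time rho gam T x th k)))
                        (th (real_of_ereal (sample_time rho gam T x th k)))) (at t) \<and>
     (th has_real_derivative lam * rho (x t) * (x t)\<^sup>2) (at t))"

lemma solution_ode_at: "sol T z x th \<longleftrightarrow>
    (let I = {t. 0 \<le> t \<and> ereal t < T} in
       0 < T \<and> continuous_on I z \<and> continuous_on I x \<and> continuous_on I th \<and>
       (\<forall>t\<in>I. \<exists>k. sample_time rho gam T x th k \<le> ereal t \<and> ereal t < sample_time rho gam T x th (Suc k)) \<and>
       (\<exists>S. (\<forall>s\<in>I. finite (S \<inter> {0..s})) \<and> (\<forall>t\<in>I - S. ode_at T z x th t)))"
  by (simp only: solution_def Let_def ode_at_def)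

text \<open>Apart from \<open>0 < T\<close>, every clause concerns an initial segment or a single
  instant below \<open>T\<close>, and the exceptional set consists of the failures of the equation.
  In this form solutions with different horizons can be compared and glued.\<close>

lemma sol_iff: "sol T z x th \<longleftrightarrow> 0 < T \<and>
    (\<forall>r. 0 \<le> r \<and> ereal r < T \<longrightarrow> continuous_on {0..r} z \<and> continuous_on {0..r} x \<and> continuous_on {0..r} th) \<and>
    (\<forall>t. 0 \<le> t \<and> ereal t < T \<longrightarrow>
      (\<exists>k. sample_time rho gam T x th k \<le> ereal t \<and> ereal t < sample_time rho gam T x th (Suc k))) \<and>
    (\<forall>r. 0 \<le> r \<and> ereal r < T \<longrightarrow> finite {t. 0 \<le> t \<and> t \<le> r \<and> \<not> ode_at T z x th t})" (is "_ = ?R")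
proof
  assume s: "sol T z x th"
  then interpret trajectory q f D d b lam c p bbar rho rho' gam E m1 m2 U alow a2 T z x th by (rule trajectoryI)
  obtain S where S: "\<And>s. 0 \<le> s \<Longrightarrow> ereal s < T \<Longrightarrow> finite (S \<inter> {0..s})"
    "\<And>r k. 0 \<le> r \<Longrightarrow> ereal r < T \<Longrightarrow> r \<notin> S \<Longrightarrow> 0 < r \<Longrightarrow> ts k \<le> ereal r \<Longrightarrow> ereal r < ts (Suc k) \<Longrightarrow>
      (z has_vector_derivative q (z r) (x r) (d r)) (at r) \<and>
      (x has_real_derivative f (z r) (x r) (d r)
        + b * kappa rho (x (real_of_ereal (ts k))) (th (real_of_ereal (ts k)))) (at r) \<and>
      (th has_real_derivative lam * rho (x r) * (x r)\<^sup>2) (at r)"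
    using exceptional_times by blast
  have ode: "ode_at T z x th r" if "0 \<le> r" "ereal r < T" "r \<notin> S" for r
    unfolding ode_at_def using S(2)[OF that] by blast
  have "finite {t. 0 \<le> t \<and> t \<le> r \<and> \<not> ode_at T z x th t}" if r: "0 \<le> r" "ereal r < T" for r
  proof (rule finite_subset[OF _ S(1)[OF r]], rule subsetI)
    fix t assume t: "t \<in> {t. 0 \<le> t \<and> t \<le> r \<and> \<not> ode_at T z x th t}"
    then have "ereal t < T" using r(2) le_less_trans[of "ereal t" "ereal r" T] by simp
    then show "t \<in> S \<inter> {0..r}" using ode[of t] t by auto
  qed
  moreover have "\<exists>k. ts k \<le> ereal t \<and> ereal t < ts (Suc k)" if t: "0 \<le> t" "ereal t < T" for t
  proof -
    obtain k s where "ts k = ereal s" "0 \<le> s" "s \<le> t" "ereal t < ts (Suc k)"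
      using in_sampling_interval[OF t] by blast
    then show ?thesis by (intro exI[of _ k]) (simp del: sample_time.simps)
  qed
  ultimately show ?R using T_pos continuous[OF _ order_refl] by blast
next
  assume R: ?R
  let ?I = "{t. 0 \<le> t \<and> ereal t < T}"
  let ?S = "{t. 0 \<le> t \<and> ereal t < T \<and> \<not> ode_at T z x th t}"
  have S1: "\<forall>s\<in>?I. finite (?S \<inter> {0..s})"
  proof
    fix s assume "s \<in> ?I"
    then have "finite {t. 0 \<le> t \<and> t \<le> s \<and> \<not> ode_at T z x th t}" using R by auto
    then show "finite (?S \<inter> {0..s})" by (rule rev_finite_subset) auto
  qed
  have S2: "\<forall>t\<in>?I - ?S. ode_at T z x th t" by auto
  have S: "\<exists>S. (\<forall>s\<in>?I. finite (S \<inter> {0..s})) \<and> (\<forall>t\<in>?I - S. ode_at T z x th t)"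
    by (rule exI[of _ ?S]) (rule conjI[OF S1 S2])
  have "continuous_on ?I z" "continuous_on ?I x" "continuous_on ?I th"
    using R by (auto intro!: continuous_on_initial_segment)
  moreover have "0 < T"
    "\<forall>t\<in>?I. \<exists>k. sample_time rho gam T x th k \<le> ereal t \<and> ereal t < sample_time rho gam T x th (Suc k)"
    using R by blast+
  ultimately show "sol T z x th"
    unfolding solution_ode_at Let_def by (intro conjI S)
qed

lemma ode_at_agree:
  assumes "0 < T" "T \<le> T'" and agree: "\<And>t. 0 \<le> t \<Longrightarrow> ereal t < T \<Longrightarrow> z' t = z t \<and> x' t = x t \<and> th' t = th t"
    and t: "0 \<le> t" "ereal t < T"
  shows "ode_at T' z' x' th' t = ode_at T z x th t"
proof -
  note ag = sampling_interval_agree[OF assms(1,2) _ t(2), of x' x th' th rho gam]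
  obtain r where r: "ereal t < ereal r" "ereal r < T" using ereal_dense2[OF t(2)] by auto
  have dv: "(y' has_vector_derivative v) (at t) = (y has_vector_derivative v) (at t)"
    if "0 < t" "\<And>t. 0 \<le> t \<Longrightarrow> ereal t < T \<Longrightarrow> y' t = y t" for y y' :: "real \<Rightarrow> 'w::real_normed_vector" and v
  proof -
    have "y' u = y u" if "u \<in> {0<..<r}" for u
      using that \<open>\<And>t. 0 \<le> t \<Longrightarrow> ereal t < T \<Longrightarrow> y' t = y t\<close> r(2) less_trans[of "ereal u" "ereal r" T] by auto
    then show ?thesis
      using has_vector_derivative_transform_within_open[of y v t "{0<..<r}" y']
        has_vector_derivative_transform_within_open[of y' v t "{0<..<r}" y] r(1) that(1) by auto
  qed
  have eq: "x' (real_of_ereal (sample_time rho gam T' x' th' k)) = x (real_of_ereal (sample_time rho gam T x th k)) \<and>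
      th' (real_of_ereal (sample_time rho gam T' x' th' k)) = th (real_of_ereal (sample_time rho gam T x th k))"
    if "sample_time rho gam T x th k \<le> ereal t" for k
  proof -
    have "sample_time rho gam T x th k \<noteq> \<infinity>" using that by auto
    then obtain s where s: "0 \<le> s" "sample_time rho gam T x th k = ereal s" "ereal s < T"
      using sample_time_cases[OF assms(1), of rho gam x th k] by blast
    then show ?thesis using ag(2)[OF _ that] agree[of s] agree by auto
  qed
  show ?thesis
  proof (cases "0 < t")
    case True
    have "(z' has_vector_derivative v) (at t) = (z has_vector_derivative v) (at t)"
      "(x' has_real_derivative w) (at t) = (x has_real_derivative w) (at t)"
      "(th' has_real_derivative w) (at t) = (th has_real_derivative w) (at t)" for v w
      unfolding has_real_derivative_iff_has_vector_derivative using agree by (auto intro!: dv[OF True])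
    then show ?thesis
      unfolding ode_at_def using ag(1) eq agree[OF t] agree by (auto simp del: sample_time.simps)
  qed (simp add: ode_at_def)
qed

lemma sol_agree:
  assumes "sol T z x th" and agree: "\<And>t. 0 \<le> t \<Longrightarrow> ereal t < T \<Longrightarrow> z' t = z t \<and> x' t = x t \<and> th' t = th t"
  shows "sol T z' x' th'"
proof -
  have T: "0 < T" using assms(1) by (simp add: sol_iff)
  have cont: "continuous_on {0..r} z' \<and> continuous_on {0..r} x' \<and> continuous_on {0..r} th'"
    if "0 \<le> r" "ereal r < T" for r
  proof -
    have "z' t = z t \<and> x' t = x t \<and> th' t = th t" if "t \<in> {0..r}" for t
      using agree[of t] that \<open>ereal r < T\<close> le_less_trans[of "ereal t" "ereal r" T] by auto
    moreover have "continuous_on {0..r} z" "continuous_on {0..r} x" "continuous_on {0..r} th"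
      using assms(1) that unfolding sol_iff by blast+
    ultimately show ?thesis
      using continuous_on_eq[of "{0..r}" z z'] continuous_on_eq[of "{0..r}" x x']
        continuous_on_eq[of "{0..r}" th th'] by simp
  qed
  have "{t. 0 \<le> t \<and> t \<le> r \<and> \<not> ode_at T z' x' th' t} = {t. 0 \<le> t \<and> t \<le> r \<and> \<not> ode_at T z x th t}"
    if "ereal r < T" for r
    using ode_at_agree[OF T order_refl agree] that le_less_trans[of _ "ereal r" T] by force
  then show ?thesis
    using assms(1) cont sampling_interval_agree(1)[OF T order_refl, of x' x th' th] agree
    unfolding sol_iff by (auto simp del: sample_time.simps)
qed

text \<open>Every initial segment below the supremum already lies below some member of the family.
  This provides the upper bounds of chains for Zorn's lemma.\<close>

lemma sol_Sup:
  assumes "\<T> \<noteq> {}" "\<And>T. T \<in> \<T> \<Longrightarrow> sol T z x th"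
  shows "sol (Sup \<T>) z x th"
proof -
  have ex: "\<exists>T\<in>\<T>. ereal t < T" if "ereal t < Sup \<T>" for t using that by (simp add: less_Sup_iff)
  have le: "T \<le> Sup \<T>" if "T \<in> \<T>" for T using that by (rule Sup_upper)
  have pos: "0 < T" if "T \<in> \<T>" for T using assms(2)[OF that] by (simp add: sol_iff)
  then have Sp: "0 < Sup \<T>" using assms(1) le less_le_trans by blast
  show ?thesis
    unfolding sol_iff
  proof (intro conjI allI impI Sp)
    fix r assume r: "0 \<le> r \<and> ereal r < Sup \<T>"
    then obtain T where T: "T \<in> \<T>" "ereal r < T" using ex by blast
    note s = assms(2)[OF T(1), unfolded sol_iff]
    show "continuous_on {0..r} z" "continuous_on {0..r} x" "continuous_on {0..r} th" using s r T(2) by auto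
    show "\<exists>k. sample_time rho gam (Sup \<T>) x th k \<le> ereal r \<and> ereal r < sample_time rho gam (Sup \<T>) x th (Suc k)"
      using s r T sampling_interval_agree(1)[OF pos[OF T(1)] le[OF T(1)] _ T(2)] by (metis (no_types, lifting))
    have "{t. 0 \<le> t \<and> t \<le> r \<and> \<not> ode_at (Sup \<T>) z x th t} = {t. 0 \<le> t \<and> t \<le> r \<and> \<not> ode_at T z x th t}"
      using ode_at_agree[OF pos[OF T(1)] le[OF T(1)], of z z x x th th] T(2) le_less_trans[of _ "ereal r" T] by force
    then show "finite {t. 0 \<le> t \<and> t \<le> r \<and> \<not> ode_at (Sup \<T>) z x th t}" using s r T(2) by auto
  qed
qed

end

context trajectory
begin

text \<open>A solution can fail the differential equation only at discontinuities of \<open>d\<close> and at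
  sampling instants; in particular its exceptional times cannot accumulate at a finite \<open>T\<close>.\<close>

lemma ode_at_regular:
  assumes k: "ts k = ereal s" "0 \<le> s" "s < t" "ereal t < T" "ereal t < ts (Suc k)" and d: "isCont d t"
  shows "ode_at T z x th t"
proof -
  obtain r where r: "ereal t < ereal r" "ereal r < min T (ts (Suc k))"
    using ereal_dense2[of "ereal t" "min T (ts (Suc k))"] assms by auto
  define u where "u = kappa rho (x s) (th s)"
  have rT: "ereal r < T" "ereal r \<le> ts (Suc k)" using r by auto
  obtain S where S: "finite S" "\<And>\<tau>. \<tau> \<in> {s<..<r} - S \<Longrightarrow>
      (z has_vector_derivative q (z \<tau>) (x \<tau>) (d \<tau>)) (at \<tau>) \<and>
      (x has_real_derivative f (z \<tau>) (x \<tau>) (d \<tau>) + b * u) (at \<tau>) \<and>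
      (th has_real_derivative lam * rho (x \<tau>) * (x \<tau>)\<^sup>2) (at \<tau>) \<and> d \<tau> \<in> D"
    using derivatives_sampling_interval[OF k(1,2) rT] unfolding u_def by metis
  note cont = continuous[OF rT(1) k(2)]
  have st: "s < t" "t < r" using k r by auto
  then have tin: "t \<in> interior {s..r}" by (simp add: interior_atLeastAtMost_real)
  have c: "isCont z t" "isCont x t" "isCont th t"
    using cont tin by (auto intro: continuous_on_interior)
  have cp: "isCont (\<lambda>\<tau>. (z \<tau>, x \<tau>, d \<tau>)) t" using c d by (intro continuous_intros)
  have "isCont (\<lambda>(z, x, d). q z x d) (z t, x t, d t)" "isCont (\<lambda>(z, x, d). f z x d) (z t, x t, d t)"
    using C_k_1D(3)[OF qf(1), of UNIV] C_k_1D(3)[OF qf(2), of UNIV] by (auto simp: continuous_on_eq_continuous_at)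
  then have cq: "isCont (\<lambda>\<tau>. q (z \<tau>) (x \<tau>) (d \<tau>)) t" and cf: "isCont (\<lambda>\<tau>. f (z \<tau>) (x \<tau>) (d \<tau>)) t"
    using isCont_o2[OF cp] by force+
  have cr: "isCont (\<lambda>\<tau>. rho (x \<tau>)) t" using isCont_o2[OF c(2), of rho] DERIV_isCont[OF rho(1)] by blast
  have "(z has_vector_derivative q (z t) (x t) (d t)) (at t)"
    by (rule derivative_at_continuity_point[OF st S(1) cont(1) _ cq]) (use S(2) in blast)
  moreover have "(x has_real_derivative f (z t) (x t) (d t) + b * u) (at t)"
    unfolding has_real_derivative_iff_has_vector_derivative
    by (rule derivative_at_continuity_point[OF st S(1) cont(2)])
      (use S(2) cf in \<open>auto simp: has_real_derivative_iff_has_vector_derivative[symmetric] intro!: continuous_intros\<close>)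
  moreover have "(th has_real_derivative lam * rho (x t) * (x t)\<^sup>2) (at t)"
    unfolding has_real_derivative_iff_has_vector_derivative
    by (rule derivative_at_continuity_point[OF st S(1) cont(3), of "\<lambda>t. lam * rho (x t) * (x t)\<^sup>2"])
      (use S(2) cr c in \<open>auto simp: has_real_derivative_iff_has_vector_derivative[symmetric] intro!: continuous_intros\<close>)
  ultimately show ?thesis
    unfolding ode_at_def
  proof (intro allI impI)
    fix k' assume k': "0 < t \<and> ts k' \<le> ereal t \<and> ereal t < ts (Suc k')"
    have "k' = k" by (rule sample_time_index_unique[OF T_pos]) (use k k' in \<open>auto simp del: sample_time.simps\<close>)
    moreover assume "(z has_vector_derivative q (z t) (x t) (d t)) (at t)"
      "(x has_real_derivative f (z t) (x t) (d t) + b * u) (at t)"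
      "(th has_real_derivative lam * rho (x t) * (x t)\<^sup>2) (at t)"
    ultimately show "(z has_vector_derivative q (z t) (x t) (d t)) (at t) \<and>
       (x has_real_derivative f (z t) (x t) (d t) + b * kappa rho (x (real_of_ereal (ts k'))) (th (real_of_ereal (ts k')))) (at t) \<and>
       (th has_real_derivative lam * rho (x t) * (x t)\<^sup>2) (at t)"
      using k(1) by (simp add: u_def)
  qed
qed

lemma finite_exceptional_times:
  assumes T: "T = ereal T0"
  shows "finite {t. 0 \<le> t \<and> t < T0 \<and> \<not> ode_at T z x th t}"
proof -
  obtain S where S: "\<And>s. finite (S \<inter> {0..s})" "\<And>t. 0 < t \<Longrightarrow> t \<notin> S \<Longrightarrow> isCont d t"
    using D(2) unfolding admissible_def piecewise_continuous_def by blast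
  have "t \<in> {0} \<union> (S \<inter> {0..T0}) \<union> (\<lambda>k. real_of_ereal (ts k)) ` {k. ts k \<le> ereal T0}"
    if t: "0 \<le> t" "t < T0" "\<not> ode_at T z x th t" for t
  proof -
    obtain k s where k: "ts k = ereal s" "0 \<le> s" "s \<le> t" "ereal t < ts (Suc k)"
      using in_sampling_interval[of t] t T by auto
    show ?thesis
    proof (cases "s = t")
      case True
      then have "t = real_of_ereal (ts k)" "ts k \<le> ereal T0" using k t by auto
      then show ?thesis by blast
    next
      case False
      then have "\<not> isCont d t" using ode_at_regular[OF k(1,2) _ _ k(4)] k t T by auto
      then show ?thesis using S(2)[of t] t by (cases "t = 0") auto
    qed
  qed
  then have "{t. 0 \<le> t \<and> t < T0 \<and> \<not> ode_at T z x th t}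
    \<subseteq> {0} \<union> (S \<inter> {0..T0}) \<union> (\<lambda>k. real_of_ereal (ts k)) ` {k. ts k \<le> ereal T0}" by blast
  then show ?thesis by (rule finite_subset) (use S(1) finite_samples in auto)
qed

end

subsection \<open>Continuation and global existence\<close>

text \<open>A graph records the horizon together with the signals, so that extending a solution
  becomes set inclusion.\<close>

definition solution_graph :: "ereal \<Rightarrow> (real \<Rightarrow> 'v) \<Rightarrow> (real \<times> 'v) set" where
  "solution_graph T Y = {(t, Y t) | t. 0 \<le> t \<and> ereal t < T}"

context closed_loop
begin

text \<open>The disturbance may jump at \<open>T0\<close>. Putting its right limit there, which lies
  in the closed set \<open>D\<close>, makes the field continuous up to \<open>T0\<close>; taking
  half the distance to the next jump (or half of 1) keeps the closed interval free of further
  jumps.\<close>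

lemma disturbance_right_extension:
  assumes "0 \<le> T0"
  obtains a dd where "0 < a" "continuous_on {T0..T0+a} dd" "\<And>t. t \<in> {T0<..T0+a} \<Longrightarrow> dd t = d t"
    "\<And>t. t \<in> {T0..T0+a} \<Longrightarrow> dd t \<in> D"
proof -
  obtain S l where S: "\<And>s. finite (S \<inter> {0..s})" "\<And>t. 0 < t \<Longrightarrow> t \<notin> S \<Longrightarrow> isCont d t"
    and l: "(d \<longlongrightarrow> l) (at_right T0)"
    using D(2) assms unfolding admissible_def piecewise_continuous_def by blast
  have dD: "d t \<in> D" if "0 \<le> t" for t using D(2) that by (simp add: admissible_def)
  have lD: "l \<in> D"
  proof (rule Lim_in_closed_set[OF compact_imp_closed[OF D(1)] _ _ l])
    show "\<forall>\<^sub>F t in at_right T0. d t \<in> D"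
      using eventually_at_right_less[of T0] by eventually_elim (use dD assms in auto)
  qed simp
  let ?F = "S \<inter> {0..T0+1} \<inter> {T0<..}"
  have "finite (insert (T0 + 1) ?F)" using S(1) by auto
  define m where "m = Min (insert (T0 + 1) ?F)"
  have m: "T0 < m" "m \<le> T0 + 1" "\<And>t. t \<in> ?F \<Longrightarrow> m \<le> t"
    unfolding m_def using S(1)[of "T0 + 1"] by auto
  define a where "a = (m - T0) / 2"
  have a: "0 < a" "T0 + a < m" using m by (auto simp: a_def field_simps)
  define dd where "dd = (\<lambda>t. if t \<le> T0 then l else d t)"
  show ?thesis
  proof (rule that[of a dd])
    show "continuous_on {T0..T0+a} dd"
      unfolding continuous_on_eq_continuous_within
    proof
      fix t assume t: "t \<in> {T0..T0+a}"
      show "continuous (at t within {T0..T0+a}) dd"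
      proof (cases "t = T0")
        case True
        have "\<forall>\<^sub>F r in at_right T0. d r = dd r"
          using eventually_at_right_less[of T0] by eventually_elim (simp add: dd_def)
        then have "(dd \<longlongrightarrow> l) (at_right T0)" using l tendsto_cong by blast
        then show ?thesis using True a(1) at_within_Icc_at_right[of T0 "T0 + a"]
          by (simp add: continuous_within dd_def)
      next
        case False
        then have "T0 < t" using t by auto
        moreover have "t \<notin> S" using m(2) m(3)[of t] t a calculation assms by auto
        ultimately have "isCont d t" using S(2) assms by auto
        moreover have "\<forall>\<^sub>F r in nhds t. dd r = d r"
          using eventually_nhds_in_open[of "{T0<..}" t] \<open>T0 < t\<close> by (auto elim!: eventually_mono simp: dd_def)
        ultimately have "isCont dd t" using isCont_cong by blast
        then show ?thesis by (rule continuous_at_imp_continuous_at_within)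
      qed
    qed
    show "dd t \<in> D" if "t \<in> {T0..T0+a}" for t using lD dD that assms by (auto simp: dd_def)
  qed (use a in \<open>auto simp: dd_def\<close>)
qed

lemma gain_rate_lipschitz:
  obtains B where "\<And>x y. \<bar>x\<bar> \<le> R \<Longrightarrow> \<bar>y\<bar> \<le> R \<Longrightarrow>
    \<bar>lam * rho x * x\<^sup>2 - lam * rho y * y\<^sup>2\<bar> \<le> B * \<bar>x - y\<bar>"
proof -
  let ?D = "\<lambda>x. lam * rho' x * x\<^sup>2 + 2 * x * (lam * rho x)"
  have d: "((\<lambda>x. lam * rho x * x\<^sup>2) has_real_derivative ?D x) (at x)" for x
    using DERIV_mult[OF DERIV_cmult[OF rho(1)] DERIV_power[OF DERIV_ident, of 2], of lam] by simp
  have "compact (?D ` {-R..R})"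
    by (intro compact_continuous_image continuous_intros rho_continuous continuous_on_subset[OF rho(2)]) auto
  from compact_imp_bounded[OF this] obtain B where "\<forall>x\<in>{-R..R}. norm (?D x) \<le> B"
    by (auto simp: bounded_iff)
  then have B: "norm (?D x) \<le> B" if "x \<in> {-R..R}" for x using that by blast
  show ?thesis
  proof (rule that[of B])
    fix x y :: real assume "\<bar>x\<bar> \<le> R" "\<bar>y\<bar> \<le> R"
    then show "\<bar>lam * rho x * x\<^sup>2 - lam * rho y * y\<^sup>2\<bar> \<le> B * \<bar>x - y\<bar>"
      using field_differentiable_bound[OF convex_real_interval(5)[of "- R" R] DERIV_subset[OF d subset_UNIV] B, of x y]
      by (simp add: abs_le_iff)
  qed
qed

text \<open>With the input frozen at \<open>u\<close> the loop is an ordinary differential equation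
  whose field is Lipschitz in the state on bounded sets, uniformly over disturbances in
  \<open>D\<close>.\<close>

lemma local_flow:
  assumes T0: "0 \<le> T0"
  obtains \<delta> z x th where "0 < \<delta>" "continuous_on {T0..T0+\<delta>} z" "continuous_on {T0..T0+\<delta>} x"
    "continuous_on {T0..T0+\<delta>} th" "z T0 = z0" "x T0 = x0" "th T0 = th0"
    "\<And>t. t \<in> {T0<..<T0+\<delta>} \<Longrightarrow> (z has_vector_derivative q (z t) (x t) (d t)) (at t) \<and>
      (x has_real_derivative f (z t) (x t) (d t) + b * u) (at t) \<and>
      (th has_real_derivative lam * rho (x t) * (x t)\<^sup>2) (at t)"
proof -
  obtain a dd where dd: "0 < a" "continuous_on {T0..T0+a} dd" "\<And>t. t \<in> {T0<..T0+a} \<Longrightarrow> dd t = d t"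
    "\<And>t. t \<in> {T0..T0+a} \<Longrightarrow> dd t \<in> D"
    using disturbance_right_extension[OF T0] by blast
  define F where "F = (\<lambda>t (y :: (real ^ 'p) \<times> real \<times> real). (q (fst y) (fst (snd y)) (dd t),
    f (fst y) (fst (snd y)) (dd t) + b * u, lam * rho (fst (snd y)) * (fst (snd y))\<^sup>2))"
  define y0 where "y0 = (z0, x0, th0)"
  obtain Dm where Dm: "\<And>v. v \<in> D \<Longrightarrow> norm v \<le> Dm"
    using compact_imp_bounded[OF D(1)] by (auto simp: bounded_iff)
  define R where "R = (norm y0 + 1) + (norm y0 + 1) + \<bar>Dm\<bar>"
  obtain B1 where B1: "0 \<le> B1" "\<And>v w. norm v \<le> R \<Longrightarrow> norm w \<le> R \<Longrightarrow>
      norm ((case v of (z, x, d) \<Rightarrow> q z x d) - (case w of (z, x, d) \<Rightarrow> q z x d)) \<le> B1 * norm (v - w)"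
    using C_k_1_lipschitz_on_cball[OF qf(1), of R] by blast
  obtain B2 where B2: "0 \<le> B2" "\<And>v w. norm v \<le> R \<Longrightarrow> norm w \<le> R \<Longrightarrow>
      norm ((case v of (z, x, d) \<Rightarrow> f z x d) - (case w of (z, x, d) \<Rightarrow> f z x d)) \<le> B2 * norm (v - w)"
    using C_k_1_lipschitz_on_cball[OF qf(2), of R] by blast
  obtain B3 where B3: "\<And>x y. \<bar>x\<bar> \<le> R \<Longrightarrow> \<bar>y\<bar> \<le> R \<Longrightarrow>
      \<bar>lam * rho x * x\<^sup>2 - lam * rho y * y\<^sup>2\<bar> \<le> B3 * \<bar>x - y\<bar>"
    using gain_rate_lipschitz[of R] by blast
  have lip: "norm (F t v - F t w) \<le> (B1 + B2 + \<bar>B3\<bar>) * norm (v - w)"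
    if t: "t \<in> {T0..T0+a}" and v: "v \<in> cball y0 1" and w: "w \<in> cball y0 1" for t v w
  proof -
    obtain zv xv tv zw xw tw where vw: "v = (zv, xv, tv)" "w = (zw, xw, tw)" by (cases v, cases w) auto
    have comp: "norm z' \<le> norm y0 + 1 \<and> \<bar>x'\<bar> \<le> norm y0 + 1" if "(z', x', t') \<in> cball y0 1" for z' x' t'
    proof -
      have "norm (z', x', t') \<le> norm y0 + 1"
        using that norm_triangle_sub[of "(z', x', t')" y0] by (simp add: dist_norm norm_minus_commute)
      then show ?thesis using norm_fst_le[of z' "(x', t')"] norm_snd_le[of "(x', t')" z'] norm_fst_le[of x' t'] by simp
    qed
    have nR: "norm (z', x', dd t) \<le> R \<and> \<bar>x'\<bar> \<le> R" if "(z', x', t') \<in> cball y0 1" for z' x' t'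
      using comp[OF that, THEN conjunct1] comp[OF that, THEN conjunct2] norm_triple_le[of z' x' "dd t"] Dm[OF dd(4)[OF t]] norm_ge_zero[of y0]
      unfolding R_def real_norm_def by (intro conjI; linarith)
    have n1: "norm ((zv, xv, dd t) - (zw, xw, dd t)) \<le> norm (v - w)" by (simp add: vw norm_Pair)
    have n2: "\<bar>xv - xw\<bar> \<le> norm (v - w)"
      using norm_snd_le[of "(xv - xw, tv - tw)" "zv - zw"] norm_fst_le[of "xv - xw" "tv - tw"] by (simp add: vw)
    have "norm (q zv xv (dd t) - q zw xw (dd t)) \<le> B1 * norm (v - w)"
      using B1(2)[of "(zv, xv, dd t)" "(zw, xw, dd t)"] nR v w order_trans[OF _ mult_left_mono[OF n1 B1(1)]]
      unfolding vw by auto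
    moreover have "norm (f zv xv (dd t) - f zw xw (dd t)) \<le> B2 * norm (v - w)"
      using B2(2)[of "(zv, xv, dd t)" "(zw, xw, dd t)"] nR v w order_trans[OF _ mult_left_mono[OF n1 B2(1)]]
      unfolding vw by auto
    moreover have "\<bar>lam * rho xv * xv\<^sup>2 - lam * rho xw * xw\<^sup>2\<bar> \<le> \<bar>B3\<bar> * norm (v - w)"
    proof -
      have "\<bar>lam * rho xv * xv\<^sup>2 - lam * rho xw * xw\<^sup>2\<bar> \<le> B3 * \<bar>xv - xw\<bar>" using B3 nR v w vw by blast
      also have "\<dots> \<le> \<bar>B3\<bar> * norm (v - w)" using n2 by (intro mult_mono) auto
      finally show ?thesis .
    qed
    moreover have "F t v - F t w = (q zv xv (dd t) - q zw xw (dd t), f zv xv (dd t) - f zw xw (dd t),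
        lam * rho xv * xv\<^sup>2 - lam * rho xw * xw\<^sup>2)" by (simp add: F_def vw)
    ultimately show ?thesis
      using norm_triple_le[of "q zv xv (dd t) - q zw xw (dd t)" "f zv xv (dd t) - f zw xw (dd t)"
          "lam * rho xv * xv\<^sup>2 - lam * rho xw * xw\<^sup>2"] by (simp add: algebra_simps)
  qed
  have cont: "continuous_on ({T0..T0+a} \<times> cball y0 1) (\<lambda>(t, y). F t y)"
  proof -
    let ?A = "{T0..T0+a} \<times> cball y0 1"
    have cdd: "continuous_on ?A (\<lambda>v. dd (fst v))"
      by (rule continuous_on_compose2[OF dd(2)]) (auto intro: continuous_intros)
    have c1: "continuous_on ?A (\<lambda>v. (fst (snd v), fst (snd (snd v)), dd (fst v)))"
      by (intro continuous_intros cdd)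
    have "continuous_on ?A (\<lambda>v. q (fst (snd v)) (fst (snd (snd v))) (dd (fst v)))"
      using continuous_on_compose2[OF C_k_1D(3)[OF qf(1), of UNIV] c1] by simp
    moreover have "continuous_on ?A (\<lambda>v. f (fst (snd v)) (fst (snd (snd v))) (dd (fst v)))"
      using continuous_on_compose2[OF C_k_1D(3)[OF qf(2), of UNIV] c1] by simp
    moreover have "continuous_on ?A (\<lambda>v. rho (fst (snd (snd v))))"
      by (rule continuous_on_compose2[OF rho_continuous[of UNIV] _ subset_UNIV]) (intro continuous_intros)
    ultimately show ?thesis unfolding F_def split_beta by (intro continuous_intros)
  qed
  obtain \<delta> y where y: "0 < \<delta>" "\<delta> \<le> a" "continuous_on {T0..T0+\<delta>} y" "y T0 = y0"
    "\<And>t. t \<in> {T0<..<T0+\<delta>} \<Longrightarrow> (y has_vector_derivative F t (y t)) (at t)"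
    using picard[OF dd(1) zero_less_one cont lip] by blast
  show ?thesis
  proof (rule that[of \<delta> "\<lambda>t. fst (y t)" "\<lambda>t. fst (snd (y t))" "\<lambda>t. snd (snd (y t))"])
    fix t assume t: "t \<in> {T0<..<T0+\<delta>}"
    have ddt: "dd t = d t" using t y(2) by (intro dd(3)) auto
    note hd = y(5)[OF t, unfolded has_vector_derivative_def]
    have "((\<lambda>t. fst (y t)) has_vector_derivative fst (F t (y t))) (at t)"
      using has_derivative_fst[OF hd] by (simp add: has_vector_derivative_def)
    moreover have "((\<lambda>t. fst (snd (y t))) has_vector_derivative fst (snd (F t (y t)))) (at t)"
      using has_derivative_fst[OF has_derivative_snd[OF hd]] by (simp add: has_vector_derivative_def)
    moreover have "((\<lambda>t. snd (snd (y t))) has_vector_derivative snd (snd (F t (y t)))) (at t)"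
      using has_derivative_snd[OF has_derivative_snd[OF hd]] by (simp add: has_vector_derivative_def)
    ultimately show "((\<lambda>t. fst (y t)) has_vector_derivative q (fst (y t)) (fst (snd (y t))) (d t)) (at t) \<and>
      ((\<lambda>t. fst (snd (y t))) has_real_derivative f (fst (y t)) (fst (snd (y t))) (d t) + b * u) (at t) \<and>
      ((\<lambda>t. snd (snd (y t))) has_real_derivative lam * rho (fst (snd (y t))) * (fst (snd (y t)))\<^sup>2) (at t)"
      by (simp add: F_def ddt has_real_derivative_iff_has_vector_derivative)
  qed (use y in \<open>auto simp: y0_def intro!: continuous_intros\<close>)
qed

text \<open>All of \<open>[T0,T')\<close> lies in the sampling interval \<open>k\<close>. The
  equation may fail at \<open>T0\<close>, where two flows are joined; before \<open>T0\<close> it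
  fails only finitely often because the exceptional times of the old solution do not accumulate
  there. For \<open>T0 = 0\<close> there is no earlier solution.\<close>

lemma sol_extend:
  assumes T0: "0 \<le> T0" "T0 < T'" "0 < T0 \<Longrightarrow> sol (ereal T0) z x th"
    and cont: "continuous_on {0..T'} z" "continuous_on {0..T'} x" "continuous_on {0..T'} th"
    and k: "sample_time rho gam (ereal T') x th k = ereal s" "s \<le> T0"
      "ereal T' \<le> sample_time rho gam (ereal T') x th (Suc k)"
    and deriv: "\<And>t. t \<in> {T0<..<T'} \<Longrightarrow> (z has_vector_derivative q (z t) (x t) (d t)) (at t) \<and>
      (x has_real_derivative f (z t) (x t) (d t) + b * kappa rho (x s) (th s)) (at t) \<and>
      (th has_real_derivative lam * rho (x t) * (x t)\<^sup>2) (at t)"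
  shows "sol (ereal T') z x th"
proof -
  let ?ts = "sample_time rho gam (ereal T') x th"
  have T': "0 < ereal T'" using T0 by simp
  have k': "?ts k \<le> ereal t" "ereal t < ?ts (Suc k)" if "T0 \<le> t" "t < T'" for t
    using k that less_le_trans[of "ereal t" "ereal T'"] by (auto simp del: sample_time.simps)
  have bad: "finite {t. 0 \<le> t \<and> t < T0 \<and> \<not> ode_at (ereal T') z x th t}"
  proof (cases "0 < T0")
    case True
    note s = T0(3)[OF True]
    interpret trajectory q f D d b lam c p bbar rho rho' gam E m1 m2 U alow a2 "ereal T0" z x th
      by (rule trajectoryI[OF s])
    have "{t. 0 \<le> t \<and> t < T0 \<and> \<not> ode_at (ereal T') z x th t} = {t. 0 \<le> t \<and> t < T0 \<and> \<not> ode_at (ereal T0) z x th t}"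
      using ode_at_agree[OF T_pos, of "ereal T'" z z x x th th] T0(2) by auto
    then show ?thesis using finite_exceptional_times by simp
  next
    case False
    then have "{t. 0 \<le> t \<and> t < T0 \<and> \<not> ode_at (ereal T') z x th t} = {}" by auto
    then show ?thesis by (simp only: finite.emptyI)
  qed
  have ode: "ode_at (ereal T') z x th t" if "T0 < t" "t < T'" for t
    unfolding ode_at_def
  proof (intro allI impI)
    fix j assume j: "0 < t \<and> ?ts j \<le> ereal t \<and> ereal t < ?ts (Suc j)"
    have "j = k"
      using sample_time_index_unique[OF T', of rho gam x th j "ereal t" k] j k'[of t] that by auto
    then show "(z has_vector_derivative q (z t) (x t) (d t)) (at t) \<and>
         (x has_real_derivative f (z t) (x t) (d t) + b * kappa rho (x (real_of_ereal (?ts j))) (th (real_of_ereal (?ts j)))) (at t) \<and>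
         (th has_real_derivative lam * rho (x t) * (x t)\<^sup>2) (at t)"
      using deriv[of t] that k(1) by (simp del: sample_time.simps)
  qed
  show ?thesis
    unfolding sol_iff
  proof (intro conjI allI impI T')
    fix r assume r: "0 \<le> r \<and> ereal r < ereal T'"
    then show "continuous_on {0..r} z" "continuous_on {0..r} x" "continuous_on {0..r} th"
      using cont by (auto intro: continuous_on_subset)
    show "\<exists>k. ?ts k \<le> ereal r \<and> ereal r < ?ts (Suc k)"
    proof (cases "T0 \<le> r")
      case True
      then show ?thesis using k' r by auto
    next
      case False
      then have "0 < T0" "ereal r < ereal T0" using r by auto
      moreover from this obtain j where "sample_time rho gam (ereal T0) x th j \<le> ereal r"
        "ereal r < sample_time rho gam (ereal T0) x th (Suc j)"
        using T0(3) r unfolding sol_iff by blast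
      ultimately show ?thesis
        using sampling_interval_agree(1)[of "ereal T0" "ereal T'" x x th th r rho gam j] T0(2) by auto
    qed
    have "{t. 0 \<le> t \<and> t \<le> r \<and> \<not> ode_at (ereal T') z x th t}
      \<subseteq> {t. 0 \<le> t \<and> t < T0 \<and> \<not> ode_at (ereal T') z x th t} \<union> {T0}"
      using ode r by (force simp: not_less)
    then show "finite {t. 0 \<le> t \<and> t \<le> r \<and> \<not> ode_at (ereal T') z x th t}"
      by (rule finite_subset) (use bad in simp)
  qed
qed

text \<open>The one delicate case: triggering times may accumulate at \<open>T0\<close> from the right although there is
  no event at \<open>T0\<close> itself. Then the sampling error vanishes on the whole interval, so that a new
  sample at \<open>T0\<close> leaves the input unchanged.\<close>

lemma continuation:
  assumes T0: "0 \<le> T0" "0 < T0 \<Longrightarrow> sol (ereal T0) z x th"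
    and cont: "continuous_on {0..T0} z" "continuous_on {0..T0} x" "continuous_on {0..T0} th"
    and s: "0 \<le> s" "s \<le> T0" and no: "\<And>t. s \<le> t \<Longrightarrow> t < T0 \<Longrightarrow> \<not> trigger rho gam x th s t"
    and k: "\<And>T' x' th'. T0 < T' \<Longrightarrow> (\<And>t. 0 \<le> t \<Longrightarrow> t \<le> T0 \<Longrightarrow> x' t = x t \<and> th' t = th t)
      \<Longrightarrow> sample_time rho gam (ereal T') x' th' k = ereal s"
  obtains T' z' x' th' where "T0 < T'" "sol (ereal T') z' x' th'"
    "\<And>t. 0 \<le> t \<Longrightarrow> t \<le> T0 \<Longrightarrow> z' t = z t \<and> x' t = x t \<and> th' t = th t"
proof -
  note result = that
  \<comment> \<open>The input to be held right after \<open>T0\<close>: an event at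
    \<open>T0\<close> calls for a new sample, otherwise the old one is kept.\<close>
  define u where "u = (if trigger rho gam x th s T0 then kappa rho (x T0) (th T0) else kappa rho (x s) (th s))"
  obtain \<delta> z1 x1 th1 where \<delta>: "0 < \<delta>" and c1: "continuous_on {T0..T0+\<delta>} z1" "continuous_on {T0..T0+\<delta>} x1"
    "continuous_on {T0..T0+\<delta>} th1" and i1: "z1 T0 = z T0" "x1 T0 = x T0" "th1 T0 = th T0"
    and d1: "\<And>t. t \<in> {T0<..<T0+\<delta>} \<Longrightarrow> (z1 has_vector_derivative q (z1 t) (x1 t) (d t)) (at t) \<and>
      (x1 has_real_derivative f (z1 t) (x1 t) (d t) + b * u) (at t) \<and>
      (th1 has_real_derivative lam * rho (x1 t) * (x1 t)\<^sup>2) (at t)"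
    using local_flow[OF T0(1), of "z T0" "x T0" "th T0" u] by blast
  define z' where "z' = (\<lambda>t. if t \<le> T0 then z t else z1 t)"
  define x' where "x' = (\<lambda>t. if t \<le> T0 then x t else x1 t)"
  define th' where "th' = (\<lambda>t. if t \<le> T0 then th t else th1 t)"
  have ag: "z' t = z t \<and> x' t = x t \<and> th' t = th t" if "t \<le> T0" for t
    using that by (simp add: z'_def x'_def th'_def)
  have ag1: "z' t = z1 t \<and> x' t = x1 t \<and> th' t = th1 t" if "T0 \<le> t" for t
    using that i1 by (simp add: z'_def x'_def th'_def)
  have un: "{0..T0+\<delta>} = {0..T0} \<union> {T0..T0+\<delta>}" using T0(1) \<delta> by auto
  have c': "continuous_on {0..T0+\<delta>} z'" "continuous_on {0..T0+\<delta>} x'" "continuous_on {0..T0+\<delta>} th'"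
    unfolding un z'_def x'_def th'_def using cont c1 i1 by (auto intro!: continuous_on_If)
  have d': "(z' has_vector_derivative q (z' t) (x' t) (d t)) (at t) \<and>
      (x' has_real_derivative f (z' t) (x' t) (d t) + b * u) (at t) \<and>
      (th' has_real_derivative lam * rho (x' t) * (x' t)\<^sup>2) (at t)" if t: "t \<in> {T0<..<T0+\<delta>}" for t
    using d1[OF t] ag1[of t] t ag1 unfolding has_real_derivative_iff_has_vector_derivative
    by (auto intro: has_vector_derivative_transform_within_open[of _ _ t "{T0<..<T0+\<delta>}"])
  have sol0: "sol (ereal T0) z' x' th'" if "0 < T0"
    by (rule sol_agree[OF T0(2)[OF that]]) (use ag in auto)
  have s': "kappa rho (x' s) (th' s) = kappa rho (x s) (th s)" "kappa rho (x' T0) (th' T0) = kappa rho (x T0) (th T0)"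
    using ag s by auto
  have tr: "trigger rho gam x' th' s t = trigger rho gam x th s t" if "s \<le> t" "t \<le> T0" for t
    using that ag by (intro trigger_cong) auto
  have extend: ?thesis
    if T': "T0 < T'" "T' \<le> T0 + \<delta>" and j: "sample_time rho gam (ereal T') x' th' j = ereal v" "v \<le> T0"
      "ereal T' \<le> sample_time rho gam (ereal T') x' th' (Suc j)" and v: "kappa rho (x' v) (th' v) = u" for T' j v
  proof -
    have "sol (ereal T') z' x' th'"
    proof (rule sol_extend[OF T0(1) T'(1) sol0 _ _ _ j])
      show "continuous_on {0..T'} z'" "continuous_on {0..T'} x'" "continuous_on {0..T'} th'"
        using c' T'(2) by (auto intro: continuous_on_subset)
      show "(z' has_vector_derivative q (z' t) (x' t) (d t)) (at t) \<and>
        (x' has_real_derivative f (z' t) (x' t) (d t) + b * kappa rho (x' v) (th' v)) (at t) \<and>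
        (th' has_real_derivative lam * rho (x' t) * (x' t)\<^sup>2) (at t)" if "t \<in> {T0<..<T'}" for t
        unfolding v using d'[of t] that T'(2) by auto
    qed
    then show ?thesis using result[OF T'(1)] ag by blast
  qed
  have ks: "sample_time rho gam (ereal T') x' th' k = ereal s" if "T0 < T'" for T'
    by (rule k[OF that]) (use ag in auto)
  \<comment> \<open>After a sample at \<open>T0\<close>, the dwell time computed from a bound on the
    candidate signals excludes a further event on a short interval, so the next sampling instant is
    \<open>\<infinity>\<close> for the horizon \<open>T'\<close>.\<close>
  have fresh: ?thesis if u: "u = kappa rho (x T0) (th T0)"
    and I: "\<And>T'. T0 < T' \<Longrightarrow> T' \<le> T0 + \<delta> \<Longrightarrow> sample_time rho gam (ereal T') x' th' (Suc k) = ereal T0"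
  proof -
    have "compact ((\<lambda>t. (x' t, th' t)) ` {0..T0+\<delta>})"
      by (intro compact_continuous_image continuous_intros c') auto
    from compact_imp_bounded[OF this] obtain M where M0: "\<forall>v\<in>(\<lambda>t. (x' t, th' t)) ` {0..T0+\<delta>}. norm v \<le> M"
      by (auto simp: bounded_iff)
    have M: "\<bar>x' t\<bar> \<le> M \<and> \<bar>th' t\<bar> \<le> M" if "t \<in> {0..T0+\<delta>}" for t
      using M0 that norm_fst_le[of "x' t" "th' t"] norm_snd_le[of "th' t" "x' t"] by force
    obtain h where h: "0 < h" "\<And>x th s t. \<lbrakk>s \<le> t; continuous_on {s..t} x; continuous_on {s..t} th;
      \<And>r. r \<in> {s..t} \<Longrightarrow> \<bar>x r\<bar> \<le> M \<and> \<bar>th r\<bar> \<le> M; trigger rho gam x th s t\<rbrakk> \<Longrightarrow> h \<le> t - s"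
      using trigger_dwell_bounded[of M] by blast
    define T' where "T' = T0 + min \<delta> h"
    have T': "T0 < T'" "T' \<le> T0 + \<delta>" using \<delta> h(1) by (auto simp: T'_def)
    have "\<not> trigger rho gam x' th' T0 t" if t: "T0 \<le> t" "t < T'" for t
    proof
      assume "trigger rho gam x' th' T0 t"
      moreover have "{T0..t} \<subseteq> {0..T0+\<delta>}" using t T'(2) T0(1) by auto
      ultimately have "h \<le> t - T0"
        using M c' by (intro h(2)[OF t(1)]) (auto intro: continuous_on_subset)
      then show False using t by (simp add: T'_def)
    qed
    then have "{t. T0 \<le> t \<and> ereal t < ereal T' \<and> trigger rho gam x' th' T0 t} = {}" by auto
    then have "sample_time rho gam (ereal T') x' th' (Suc (Suc k)) = \<infinity>"
      unfolding sample_time_Suc_eq[OF I[OF T']] by (simp only: image_empty Inf_empty top_ereal_def)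
    then show ?thesis using extend[OF T' I[OF T'] order_refl] s'(2) u by simp
  qed
  show ?thesis
  proof (cases "trigger rho gam x th s T0")
    case True
    show ?thesis
    proof (rule fresh)
      show "u = kappa rho (x T0) (th T0)" using True by (simp add: u_def)
      fix T' assume T': "T0 < T'"
      let ?A = "{t. s \<le> t \<and> ereal t < ereal T' \<and> trigger rho gam x' th' s t}"
      have "T0 \<in> ?A" using True tr[of T0] s T' by simp
      then have "Inf (ereal ` ?A) \<le> ereal T0" by (intro Inf_lower) auto
      moreover have "ereal T0 \<le> Inf (ereal ` ?A)"
        using no tr by (intro Inf_greatest) (force simp: not_less[symmetric])
      ultimately show "sample_time rho gam (ereal T') x' th' (Suc k) = ereal T0"
        unfolding sample_time_Suc_eq[OF ks[OF T']] by (rule antisym)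
    qed
  next
    case False
    then have u: "u = kappa rho (x s) (th s)" by (simp add: u_def)
    show ?thesis
    proof (cases "\<exists>T'. T0 < T' \<and> T' \<le> T0 + \<delta> \<and> (\<forall>t. T0 \<le> t \<and> t < T' \<longrightarrow> \<not> trigger rho gam x' th' s t)")
      case True
      then obtain T' where T': "T0 < T'" "T' \<le> T0 + \<delta>" "\<And>t. T0 \<le> t \<Longrightarrow> t < T' \<Longrightarrow> \<not> trigger rho gam x' th' s t"
        by blast
      have "\<not> trigger rho gam x' th' s t" if "s \<le> t" "t < T'" for t
        using T'(3)[of t] no[of t] tr[of t] that by (cases "T0 \<le> t") auto
      then have "{t. s \<le> t \<and> ereal t < ereal T' \<and> trigger rho gam x' th' s t} = {}" by auto
      then have "sample_time rho gam (ereal T') x' th' (Suc k) = \<infinity>"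
        unfolding sample_time_Suc_eq[OF ks[OF T'(1)]] by (simp only: image_empty Inf_empty top_ereal_def)
      then show ?thesis using extend[OF T'(1,2) ks[OF T'(1)] s(2)] s'(1) u by simp
    next
      case acc: False
      define w where "w = samp_err rho x' th' s"
      define W where "W = (\<lambda>t. sup_norm w s t)"
      define G where "G = (\<lambda>t. SUP r\<in>{s..t}. gam (x' r) (th' r) (w r) * (w r)\<^sup>2)"
      have cs: "continuous_on {s..T0+\<delta>} x'" "continuous_on {s..T0+\<delta>} th'"
        using c' s(1) by (auto intro: continuous_on_subset)
      have wc: "continuous_on {s..T0+\<delta>} w"
        unfolding w_def samp_err_def kappa_def
        by (intro continuous_intros cs continuous_on_compose2[OF rho_continuous[of UNIV] cs(1)]) auto
      have "continuous_on {s..T0+\<delta>} (\<lambda>r. (x' r, th' r, w r))" by (intro continuous_intros cs wc)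
      from continuous_on_compose2[OF gam(1) this]
      have gc: "continuous_on {s..T0+\<delta>} (\<lambda>r. gam (x' r) (th' r) (w r) * (w r)\<^sup>2)"
        by (intro continuous_intros wc) auto
      have absc: "continuous_on {s..T0+\<delta>} (\<lambda>r. \<bar>w r\<bar>)" using wc by (intro continuous_intros)
      have trW: "trigger rho gam x' th' s t \<longleftrightarrow> 1 / 2 * (W t)\<^sup>2 \<le> 2 * (t - s) * G t \<and> W t \<noteq> 0" for t
        by (simp add: trigger_def Let_def w_def W_def G_def)
      \<comment> \<open>If \<open>W T0\<close> were nonzero, the negated trigger at
        \<open>T0\<close> would be a strict inequality between right-continuous quantities and would
        persist to the right of \<open>T0\<close>, contrary to the accumulation of events.\<close>
      have "W T0 = 0"
      proof (rule ccontr)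
        assume W0: "W T0 \<noteq> 0"
        have "(W \<longlongrightarrow> W T0) (at_right T0)" "(G \<longlongrightarrow> G T0) (at_right T0)"
          unfolding W_def G_def sup_norm_def using s \<delta>
          by (intro running_SUP_right_continuous[OF absc] running_SUP_right_continuous[OF gc]; simp)+
        then have "((\<lambda>t. 1 / 2 * (W t)\<^sup>2 - 2 * (t - s) * G t) \<longlongrightarrow> 1 / 2 * (W T0)\<^sup>2 - 2 * (T0 - s) * G T0) (at_right T0)"
          by (intro tendsto_intros)
        moreover have "0 < 1 / 2 * (W T0)\<^sup>2 - 2 * (T0 - s) * G T0"
          using False tr[of T0] s(2) trW[of T0] W0 by simp
        ultimately have "\<forall>\<^sub>F t in at_right T0. 0 < 1 / 2 * (W t)\<^sup>2 - 2 * (t - s) * G t"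
          by (rule order_tendstoD(1))
        then obtain v where v: "T0 < v" "\<And>t. T0 < t \<Longrightarrow> t < v \<Longrightarrow> 0 < 1 / 2 * (W t)\<^sup>2 - 2 * (t - s) * G t"
          unfolding eventually_at_right_field by blast
        have "\<not> trigger rho gam x' th' s t" if "T0 \<le> t" "t < min v (T0 + \<delta>)" for t
        proof (cases "t = T0")
          case True
          then show ?thesis using False tr[of T0] s(2) by simp
        next
          case False
          then show ?thesis using v(2)[of t] that trW[of t] by simp
        qed
        then show False using acc v(1) \<delta> by (auto dest!: spec[of _ "min v (T0 + \<delta>)"])
      qed
      moreover have "\<bar>w T0\<bar> \<le> W T0"
        using cSUP_upper_atLeastAtMost[of s T0 "\<lambda>r. \<bar>w r\<bar>" T0] s \<delta> continuous_on_subset[OF absc, of "{s..T0}"]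
        by (simp add: W_def sup_norm_def)
      ultimately have "u = kappa rho (x T0) (th T0)" using s' u by (simp add: w_def samp_err_def)
      then show ?thesis
      proof (rule fresh)
        fix T' assume T': "T0 < T'" "T' \<le> T0 + \<delta>"
        let ?A = "{t. s \<le> t \<and> ereal t < ereal T' \<and> trigger rho gam x' th' s t}"
        \<comment> \<open>The infimum equals \<open>T0\<close> although it is not attained: events
          occur arbitrarily soon after \<open>T0\<close>, none at \<open>T0\<close>.\<close>
        have "Inf (ereal ` ?A) \<le> ereal T0"
        proof (rule dense_ge)
          fix y :: ereal assume y: "ereal T0 < y"
          obtain v where v: "T0 < v" "v \<le> T'" "ereal v \<le> y"
            using y T'(1) by (cases y) (auto intro: that[of "min T' (real_of_ereal y)"] that[of T'])
          then obtain t where t: "T0 \<le> t" "t < v" "trigger rho gam x' th' s t"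
            using acc T'(2) by (meson order_trans)
          have "Inf (ereal ` ?A) \<le> ereal t" using t v(2) s(2) by (intro Inf_lower) auto
          also have "\<dots> \<le> y" using t(2) v(3) by (auto intro: order_trans[of _ "ereal v"])
          finally show "Inf (ereal ` ?A) \<le> y" .
        qed
        moreover have "ereal T0 \<le> Inf (ereal ` ?A)"
          using no tr by (intro Inf_greatest) (force simp: not_less[symmetric])
        ultimately show "sample_time rho gam (ereal T') x' th' (Suc k) = ereal T0"
          unfolding sample_time_Suc_eq[OF ks[OF T'(1)]] by (rule antisym)
      qed
    qed
  qed
qed

text \<open>The degenerate case \<open>T0 = 0\<close> of the continuation, started from constant
  signals with the first sample at 0.\<close>

lemma local_existence:
  obtains T z x th where "sol T z x th" "z 0 = z0" "x 0 = x0" "th 0 = th0"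
proof -
  have "\<exists>T' z' x' th'. 0 < T' \<and> sol (ereal T') z' x' th' \<and> z' 0 = z0 \<and> x' 0 = x0 \<and> th' 0 = th0"
  proof (rule continuation[of 0 "\<lambda>_. z0" "\<lambda>_. x0" "\<lambda>_. th0" 0 0])
    fix T' z' x' th' assume "0 < T'" "sol (ereal T') z' x' th'"
      "\<And>t. 0 \<le> t \<Longrightarrow> t \<le> 0 \<Longrightarrow> z' t = z0 \<and> x' t = x0 \<and> th' t = th0"
    then show ?thesis by (metis order_refl)
  qed (auto simp: zero_ereal_def)
  then show ?thesis using that by blast
qed

text \<open>The Lipschitz bound gives limits at \<open>T0\<close>, and finiteness of the samples
  leaves a last sampling instant before \<open>T0\<close>, from which the input is
  continued.\<close>

lemma extension:
  assumes s: "sol (ereal T0) z x th"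
  obtains T' z' x' th' where "T0 < T'" "sol (ereal T') z' x' th'"
    "\<And>t. 0 \<le> t \<Longrightarrow> t < T0 \<Longrightarrow> z' t = z t \<and> x' t = x t \<and> th' t = th t"
proof -
  have T0: "0 < T0" using s by (simp add: sol_iff)
  obtain L where L: "0 \<le> L" "\<And>s t. 0 \<le> s \<Longrightarrow> s \<le> t \<Longrightarrow> ereal t < ereal T0 \<Longrightarrow>
    norm ((z t, x t, th t) - (z s, x s, th s)) \<le> L * (t - s)"
    using trajectory.lipschitz_bound[OF trajectoryI[OF s]] by blast
  have "L-lipschitz_on {0..<T0} (\<lambda>t. (z t, x t, th t))"
  proof (rule lipschitz_onI[OF _ L(1)])
    fix u v assume uv: "u \<in> {0..<T0}" "v \<in> {0..<T0}"
    show "dist (z u, x u, th u) (z v, x v, th v) \<le> L * dist u v"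
    proof (cases "u \<le> v")
      case True
      then have "dist (z v, x v, th v) (z u, x u, th u) \<le> L * dist v u"
        using L(2)[of u v] uv unfolding dist_norm by auto
      then show ?thesis by (simp only: dist_commute)
    next
      case False
      then show ?thesis using L(2)[of v u] uv unfolding dist_norm by auto
    qed
  qed
  then obtain Y where Y: "L-lipschitz_on {0..T0} Y" "\<And>t. t \<in> {0..<T0} \<Longrightarrow> Y t = (z t, x t, th t)"
    using lipschitz_extend_closure[of L "{0..<T0}" "\<lambda>t. (z t, x t, th t)"] T0 by auto
  define z2 where "z2 = (\<lambda>t. fst (Y t))"
  define x2 where "x2 = (\<lambda>t. fst (snd (Y t)))"
  define th2 where "th2 = (\<lambda>t. snd (snd (Y t)))"
  have Yc: "continuous_on {0..T0} Y" by (rule lipschitz_on_continuous_on[OF Y(1)])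
  have c2: "continuous_on {0..T0} z2" "continuous_on {0..T0} x2" "continuous_on {0..T0} th2"
    unfolding z2_def x2_def th2_def by (intro continuous_intros Yc)+
  have ag: "z2 t = z t \<and> x2 t = x t \<and> th2 t = th t" if "0 \<le> t" "t < T0" for t
    using Y(2)[of t] that by (simp add: z2_def x2_def th2_def)
  have s2: "sol (ereal T0) z2 x2 th2" by (rule sol_agree[OF s]) (use ag in auto)
  interpret trajectory q f D d b lam c p bbar rho rho' gam E m1 m2 U alow a2 "ereal T0" z2 x2 th2
    by (rule trajectoryI[OF s2])
  define k where "k = Max {k. ts k \<le> ereal T0}"
  have "0 \<in> {k. ts k \<le> ereal T0}" using T0 by simp
  then have "k \<in> {k. ts k \<le> ereal T0}" unfolding k_def by (intro Max_in[OF finite_samples]) blast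
  then have "ts k \<noteq> \<infinity>" by auto
  then obtain v where v: "0 \<le> v" "ts k = ereal v" "ereal v < ereal T0"
    using sample_time_cases[OF T_pos, of rho gam x2 th2 k] by blast
  have kSuc: "ts (Suc k) = \<infinity>"
  proof (rule sample_time_cases[OF T_pos, of rho gam x2 th2 "Suc k"])
    fix w assume "ts (Suc k) = ereal w" "ereal w < ereal T0"
    then have "Suc k \<in> {k. ts k \<le> ereal T0}" by (simp del: sample_time.simps)
    then have "Suc k \<le> k" unfolding k_def by (rule Max_ge[OF finite_samples])
    then show ?thesis by simp
  qed
  show ?thesis
  proof (rule continuation[of T0 z2 x2 th2 v k])
    show "\<not> trigger rho gam x2 th2 v t" if "v \<le> t" "t < T0" for t
      using not_trigger_before_next_sample[OF v(2) that(1)] that(2) kSuc by simp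
    show "sample_time rho gam (ereal T') x' th' k = ereal v"
      if "T0 < T'" "\<And>t. 0 \<le> t \<Longrightarrow> t \<le> T0 \<Longrightarrow> x' t = x2 t \<and> th' t = th2 t" for T' x' th'
      using sample_time_agree[OF T_pos, of "ereal T'" x' x2 th' th2 rho gam k] that v(2) by simp
    fix T' z' x' th' assume "T0 < T'" "sol (ereal T') z' x' th'"
      "\<And>t. 0 \<le> t \<Longrightarrow> t \<le> T0 \<Longrightarrow> z' t = z2 t \<and> x' t = x2 t \<and> th' t = th2 t"
    then show ?thesis using that[of T' z' x' th'] ag by (metis less_imp_le)
  qed (use T0 s2 c2 v in auto)
qed

section \<open>Maximal continuation by Zorn's lemma\<close>

abbreviation sol_triple :: "ereal \<Rightarrow> (real \<Rightarrow> (real ^ 'p) \<times> real \<times> real) \<Rightarrow> bool" where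
  "sol_triple T Y \<equiv> sol T (\<lambda>t. fst (Y t)) (\<lambda>t. fst (snd (Y t))) (\<lambda>t. snd (snd (Y t)))"

lemma global_existence:
  obtains z x th where "sol \<infinity> z x th" "z 0 = z0" "x 0 = x0" "th 0 = th0"
proof -
  define \<A> where "\<A> = {solution_graph T Y | T Y. sol_triple T Y \<and> Y 0 = (z0, x0, th0)}"
  have "\<exists>M\<in>\<A>. \<forall>X\<in>\<A>. M \<subseteq> X \<longrightarrow> X = M"
  proof (rule subset_Zorn_nonempty)
    obtain T z x th where s: "sol T z x th" "z 0 = z0" "x 0 = x0" "th 0 = th0" using local_existence[of z0 x0 th0] by blast
    have "solution_graph T (\<lambda>t. (z t, x t, th t)) \<in> \<A>"
      unfolding \<A>_def using s by (auto intro!: exI[of _ T] exI[of _ "\<lambda>t. (z t, x t, th t)"])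
    then show "\<A> \<noteq> {}" by blast
  next
    fix \<C> assume ne: "\<C> \<noteq> {}" and ch: "subset.chain \<A> \<C>"
    have CA: "\<C> \<subseteq> \<A>" and tot: "\<And>A B. A \<in> \<C> \<Longrightarrow> B \<in> \<C> \<Longrightarrow> A \<subseteq> B \<or> B \<subseteq> A"
      using ch by (auto simp: subset_chain_def)
    define \<T> where "\<T> = {T. \<exists>Y. solution_graph T Y \<in> \<C> \<and> sol_triple T Y \<and> Y 0 = (z0, x0, th0)}"
    have ex: "\<exists>T Y. G = solution_graph T Y \<and> sol_triple T Y \<and> Y 0 = (z0, x0, th0)" if "G \<in> \<C>" for G
      using CA that unfolding \<A>_def by blast
    \<comment> \<open>Two members of a chain lie in the larger one, so the union of the chain is
      again single-valued.\<close>
    have fn: "v = w" if vw: "(t, v) \<in> \<Union>\<C>" "(t, w) \<in> \<Union>\<C>" for t v w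
    proof -
      obtain A B where AB: "A \<in> \<C>" "B \<in> \<C>" "(t, v) \<in> A" "(t, w) \<in> B" using vw by blast
      then obtain G where "G \<in> \<C>" "(t, v) \<in> G" "(t, w) \<in> G" using tot[OF AB(1,2)] by blast
      then show ?thesis using ex[of G] by (auto simp: solution_graph_def)
    qed
    define Y where "Y = (\<lambda>t. SOME v. (t, v) \<in> \<Union>\<C>)"
    have Yeq: "Y t = Y' t" if "solution_graph T Y' \<in> \<C>" "0 \<le> t" "ereal t < T" for T Y' t
    proof -
      have "(t, Y' t) \<in> solution_graph T Y'" using that by (simp add: solution_graph_def)
      then have "(t, Y' t) \<in> \<Union>\<C>" using that(1) by blast
      then show ?thesis unfolding Y_def using fn by (intro some_equality) auto
    qed
    have TT: "sol_triple T Y \<and> 0 < T" if T: "T \<in> \<T>" for T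
    proof -
      obtain Y' where Y': "solution_graph T Y' \<in> \<C>" "sol_triple T Y'" using T unfolding \<T>_def by blast
      have "sol_triple T Y" by (rule sol_agree[OF Y'(2)]) (use Yeq[OF Y'(1)] in auto)
      then show ?thesis by (simp add: sol_iff)
    qed
    have Tne: "\<T> \<noteq> {}" using ne ex unfolding \<T>_def by fast
    have "\<Union>\<C> = solution_graph (Sup \<T>) Y"
    proof (intro set_eqI iffI)
      fix a assume "a \<in> \<Union>\<C>"
      then obtain G where G: "G \<in> \<C>" "a \<in> G" by blast
      obtain T Y' where TY: "G = solution_graph T Y'" "sol_triple T Y'" "Y' 0 = (z0, x0, th0)" using ex[OF G(1)] by blast
      then have "T \<in> \<T>" using G by (auto simp: \<T>_def)
      then have "T \<le> Sup \<T>" by (rule Sup_upper)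
      moreover obtain t where t: "a = (t, Y' t)" "0 \<le> t" "ereal t < T" using G(2) TY by (auto simp: solution_graph_def)
      ultimately show "a \<in> solution_graph (Sup \<T>) Y"
        using Yeq[of T Y' t] G(1) TY(1) by (auto simp: solution_graph_def intro: less_le_trans)
    next
      fix a assume "a \<in> solution_graph (Sup \<T>) Y"
      then obtain t where t: "a = (t, Y t)" "0 \<le> t" "ereal t < Sup \<T>" by (auto simp: solution_graph_def)
      then obtain T where T: "T \<in> \<T>" "ereal t < T" by (auto simp: less_Sup_iff)
      then obtain Y' where Y': "solution_graph T Y' \<in> \<C>" by (auto simp: \<T>_def)
      have "(t, Y' t) \<in> solution_graph T Y'" using t T by (auto simp: solution_graph_def)
      then show "a \<in> \<Union>\<C>" using Y' Yeq[OF Y' t(2) T(2)] t(1) by auto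
    qed
    moreover have "sol_triple (Sup \<T>) Y" by (rule sol_Sup[OF Tne]) (use TT in blast)
    moreover have "Y 0 = (z0, x0, th0)"
    proof -
      obtain T Y' where "solution_graph T Y' \<in> \<C>" "T \<in> \<T>" "Y' 0 = (z0, x0, th0)" using Tne by (auto simp: \<T>_def)
      then show ?thesis using Yeq[of T Y' 0] TT[of T] by (simp add: zero_ereal_def)
    qed
    ultimately show "\<Union>\<C> \<in> \<A>" unfolding \<A>_def by blast
  qed
  then obtain M where M: "M \<in> \<A>" "\<And>X. X \<in> \<A> \<Longrightarrow> M \<subseteq> X \<Longrightarrow> X = M" by blast
  then obtain T Y where TY: "sol_triple T Y" "Y 0 = (z0, x0, th0)" and "M = solution_graph T Y"
    unfolding \<A>_def by blast
  then have max: "X = solution_graph T Y" if "X \<in> \<A>" "solution_graph T Y \<subseteq> X" for X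
    using M(2) that by blast
  have "T = \<infinity>"
  proof (rule ccontr)
    assume "T \<noteq> \<infinity>"
    moreover have "0 < T" using TY(1) by (simp add: sol_iff)
    ultimately obtain T0 where T0: "T = ereal T0" "0 < T0" by (cases T) auto
    obtain T' z' x' th' where e: "T0 < T'" "sol (ereal T') z' x' th'"
      "\<And>t. 0 \<le> t \<Longrightarrow> t < T0 \<Longrightarrow> z' t = fst (Y t) \<and> x' t = fst (snd (Y t)) \<and> th' t = snd (snd (Y t))"
      using extension[OF TY(1)[unfolded T0(1)]] by blast
    let ?Y' = "\<lambda>t. (z' t, x' t, th' t)"
    have Y'eq: "?Y' t = Y t" if "0 \<le> t" "t < T0" for t using e(3)[OF that] by (simp add: prod_eq_iff)
    have "solution_graph (ereal T') ?Y' \<in> \<A>"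
      unfolding \<A>_def using e(2) Y'eq[of 0] T0(2) TY(2) by (auto intro!: exI[of _ "ereal T'"] exI[of _ ?Y'])
    moreover have "solution_graph T Y \<subseteq> solution_graph (ereal T') ?Y'"
      using Y'eq e(1) by (force simp: solution_graph_def T0(1))
    ultimately have "solution_graph (ereal T') ?Y' = solution_graph T Y" by (rule max)
    \<comment> \<open>\<open>T0\<close> is in the domain of the extension but not in that of the
      maximal solution, which is defined on \<open>[0,T0)\<close>.\<close>
    moreover have "(T0, ?Y' T0) \<in> solution_graph (ereal T') ?Y'" using e(1) T0(2) by (auto simp: solution_graph_def)
    ultimately show False by (auto simp: solution_graph_def T0(1))
  qed
  then show ?thesis using that[of "\<lambda>t. fst (Y t)" "\<lambda>t. fst (snd (Y t))" "\<lambda>t. snd (snd (Y t))"] TY by simp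
qed

lemma forward_complete: "forward_complete q f b lam rho gam d"
  unfolding forward_complete_def
proof (intro conjI allI impI)
  fix z0 x0 th0
  show "\<exists>z x th. sol \<infinity> z x th \<and> z 0 = z0 \<and> x 0 = x0 \<and> th 0 = th0"
    by (rule global_existence[of z0 x0 th0]) blast
next
  fix T z x th assume m: "maximal_solution q f b lam rho gam d T z x th"
  then have s: "sol T z x th" by (simp add: maximal_solution_def)
  show "T = \<infinity>"
  proof (rule ccontr)
    assume "T \<noteq> \<infinity>"
    moreover have "0 < T" using s by (simp add: sol_iff)
    ultimately obtain T0 where T0: "T = ereal T0" by (cases T) auto
    obtain T' z' x' th' where e: "T0 < T'" "sol (ereal T') z' x' th'"
      "\<And>t. 0 \<le> t \<Longrightarrow> t < T0 \<Longrightarrow> z' t = z t \<and> x' t = x t \<and> th' t = th t"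
      using extension[OF s[unfolded T0]] by blast
    then have "ereal T0 < ereal T'" "\<forall>t. 0 \<le> t \<and> ereal t < ereal T0 \<longrightarrow> z' t = z t \<and> x' t = x t \<and> th' t = th t" by auto
    then show False using m e(2) unfolding maximal_solution_def T0 by blast
  qed
qed

theorem stabilised: "globally_asymptotically_stable q f b lam rho gam d \<and> Zeno_free q f b lam rho gam d"
  unfolding globally_asymptotically_stable_def
  using forward_complete stable bounded attractive Zeno_free by blast

end

subsection \<open>Choice of the design functions\<close>

lemma smooth_const: "smooth (\<lambda>x :: 'a::euclidean_space. c :: 'b::euclidean_space)"
proof -
  have "C_k k (\<lambda>x :: 'a. c :: 'b)" for k c
    by (induction k arbitrary: c) (auto simp: frechet_derivative_const)
  then show ?thesis by (simp add: smooth_def)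
qed

lemma bdd_above_image_Icc:
  fixes g :: "real \<Rightarrow> real"
  assumes "continuous_on UNIV g"
  shows "bdd_above (g ` {a..b})"
proof -
  have "compact (g ` {a..b})"
    by (intro compact_continuous_image continuous_on_subset[OF assms]) auto
  then show ?thesis by (intro bounded_imp_bdd_above compact_imp_bounded)
qed

text \<open>The order of choice matters: \<open>rho\<close> from \<open>\<phi>\<close> and
  \<open>m2\<close>, then \<open>E\<close> from \<open>rho\<close> and its derivative, then
  \<open>gam\<close> from all of them.\<close>

lemma design_functions:
  fixes m2 \<phi> :: "real \<Rightarrow> real" and bbar :: real
  assumes m2: "continuous_on UNIV m2"
    and \<phi>: "\<And>n::nat. bdd_above (\<phi> ` {- real n..real n})" "\<And>x. 0 \<le> \<phi> x" and bbar: "0 \<le> bbar"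
  obtains rho rho' gam E where "smooth rho" "\<And>x. (rho has_real_derivative rho' x) (at x)"
    "continuous_on UNIV rho'" "\<And>x. 1 \<le> rho x" "\<And>x. (m2 x)\<^sup>2 \<le> rho x" "\<And>x. \<phi> x \<le> rho x"
    "\<And>x y :: real. \<bar>x\<bar> \<le> \<bar>y\<bar> \<Longrightarrow> E x \<le> E y" "\<And>x. 1 \<le> (E x :: real)"
    "\<And>x. (1 + \<bar>rho x + x * rho' x\<bar>) * (1 + m2 x + rho x) * (1 + rho x * x\<^sup>2) \<le> E x"
    "smooth (\<lambda>(x, th, w). gam x th w)" "continuous_on UNIV (\<lambda>(x, th, w). gam x th w)"
    "\<And>x th w. 1 \<le> (gam x th w :: real)"
    "\<And>x th w. (bbar * th * (rho x + x * rho' x))\<^sup>2 \<le> gam x th w"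
    "\<And>x th w. bbar * (\<bar>w\<bar> + \<bar>th * rho x * x\<bar>) \<le> gam x th w"
    "\<And>x th w. ((1 + th\<^sup>2) * E (2 * (2 * \<bar>w\<bar> + \<bar>th * rho x * x\<bar> + \<bar>x\<bar>)))\<^sup>2 \<le> gam x th w"
proof -
  have "bdd_above ((\<lambda>x. \<phi> x + (m2 x)\<^sup>2) ` {- real n..real n})" for n
  proof -
    obtain B1 where "\<forall>x\<in>{- real n..real n}. \<phi> x \<le> B1" using \<phi>(1)[of n] by (auto simp: bdd_above_def)
    moreover have "bdd_above ((\<lambda>x. (m2 x)\<^sup>2) ` {- real n..real n})"
      by (intro bdd_above_image_Icc continuous_intros m2)
    then obtain B2 where "\<forall>x\<in>{- real n..real n}. (m2 x)\<^sup>2 \<le> B2" by (auto simp: bdd_above_def)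
    ultimately show ?thesis by (intro bdd_aboveI2[of _ _ "B1 + B2"] add_mono) auto
  qed
  then obtain rho rho' where rho: "smooth rho" "\<And>x. (rho has_real_derivative rho' x) (at x)"
    "continuous_on UNIV rho'" "\<And>x. 1 \<le> rho x" "\<And>x. \<phi> x + (m2 x)\<^sup>2 \<le> rho x"
    by (rule smooth_majorant[where 'a = real]) blast
  have rc: "continuous_on A rho" for A
    using rho(2) by (meson DERIV_isCont continuous_at_imp_continuous_on)
  have "bdd_above ((\<lambda>x. (1 + \<bar>rho x + x * rho' x\<bar>) * (1 + m2 x + rho x) * (1 + rho x * x\<^sup>2)) ` {- real n..real n})" for n
    by (intro bdd_above_image_Icc continuous_intros m2 rc rho(3))
  then obtain E E' where E: "\<And>x. (E has_real_derivative E' x) (at x)"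
    "\<And>x y. \<bar>x\<bar> \<le> \<bar>y\<bar> \<Longrightarrow> E x \<le> E y" "\<And>x. 1 \<le> E x"
    "\<And>x. (1 + \<bar>rho x + x * rho' x\<bar>) * (1 + m2 x + rho x) * (1 + rho x * x\<^sup>2) \<le> E x"
    by (rule smooth_majorant[where 'a = real]) blast
  have Ec: "continuous_on A E" for A
    using E(1) by (meson DERIV_isCont continuous_at_imp_continuous_on)
  define g1 where "g1 = (\<lambda>(x, th, w :: real). (bbar * th * (rho x + x * rho' x))\<^sup>2)"
  define g2 where "g2 = (\<lambda>(x, th, w). bbar * (\<bar>w\<bar> + \<bar>th * rho x * x\<bar>))"
  define g3 where "g3 = (\<lambda>(x, th, w). ((1 + th\<^sup>2) * E (2 * (2 * \<bar>w\<bar> + \<bar>th * rho x * x\<bar> + \<bar>x\<bar>)))\<^sup>2)"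
  define g where "g = (\<lambda>v. g1 v + g2 v + g3 v)"
  have gc: "continuous_on A g" for A
    unfolding g_def g1_def g2_def g3_def split_beta
    by (intro continuous_intros continuous_on_compose2[OF rc[of UNIV]] continuous_on_compose2[OF rho(3)]
      continuous_on_compose2[OF Ec[of UNIV]] subset_UNIV)
  have g0: "0 \<le> g1 v" "0 \<le> g2 v" "0 \<le> g3 v" for v using bbar by (auto simp: g1_def g2_def g3_def split_beta)
  \<comment> \<open>Suprema over boxes reduce the bound in three variables to a function of the
    largest absolute value among them, so that a majorant in one variable suffices.\<close>
  define Q where "Q = (\<lambda>r. {-\<bar>r\<bar>..\<bar>r\<bar>} \<times> {-\<bar>r\<bar>..\<bar>r\<bar>} \<times> {-\<bar>r\<bar>..\<bar>r :: real\<bar>})"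
  have gQ: "bdd_above (g ` Q r)" for r
    unfolding Q_def by (intro bounded_imp_bdd_above compact_imp_bounded compact_continuous_image gc
      compact_Times compact_Icc)
  define F where "F = (\<lambda>r. SUP v\<in>Q r. g v)"
  have "bdd_above (F ` {- real n..real n})" for n
  proof (rule bdd_aboveI2)
    fix r assume r: "r \<in> {- real n..real n}"
    then have "\<bar>r\<bar> \<le> \<bar>real n\<bar>" by auto
    then have "Q r \<subseteq> Q (real n)" unfolding Q_def by auto
    moreover have "Q r \<noteq> {}" by (auto simp: Q_def)
    ultimately show "F r \<le> F (real n)" unfolding F_def using gQ by (intro cSUP_subset_mono) auto
  qed
  then obtain H H' where H: "\<And>L :: real \<times> real \<times> real \<Rightarrow> real. bounded_linear L \<Longrightarrow> smooth (\<lambda>p. H (L p))"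
    "\<And>x. (H has_real_derivative H' x) (at x)"
    "\<And>x y. \<bar>x\<bar> \<le> \<bar>y\<bar> \<Longrightarrow> H x \<le> H y" "\<And>x. 1 \<le> H x" "\<And>x. F x \<le> H x"
    by (rule smooth_majorant[where 'a = "real \<times> real \<times> real"]) blast
  have Hc: "continuous_on A H" for A
    using H(2) by (meson DERIV_isCont continuous_at_imp_continuous_on)
  \<comment> \<open>The value of \<open>H\<close> at the largest argument already dominates, but a
    maximum is not smooth. The sum of all three values is smooth and at least as large, since
    \<open>H\<close> is positive.\<close>
  define gam where "gam = (\<lambda>x th w. H x + (H th + H w))"
  have gam: "g (x, th, w) \<le> gam x th w" for x th w
  proof -
    define m where "m = max \<bar>x\<bar> (max \<bar>th\<bar> \<bar>w\<bar>)"
    have "y \<in> {-\<bar>m\<bar>..\<bar>m\<bar>}" if "\<bar>y\<bar> \<le> m" for y using that by auto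
    moreover have "\<bar>x\<bar> \<le> m" "\<bar>th\<bar> \<le> m" "\<bar>w\<bar> \<le> m" by (auto simp: m_def)
    ultimately have "(x, th, w) \<in> Q m" unfolding Q_def by blast
    then have "g (x, th, w) \<le> F m" unfolding F_def by (intro cSUP_upper gQ)
    also have "\<dots> \<le> H m" by (rule H(5))
    also have "\<dots> \<le> gam x th w"
    proof -
      have "m = \<bar>x\<bar> \<or> m = \<bar>th\<bar> \<or> m = \<bar>w\<bar>" unfolding m_def max_def by auto
      then have "H m \<le> H x \<or> H m \<le> H th \<or> H m \<le> H w" by (elim disjE) (simp_all add: H(3))
      then show ?thesis using H(4)[of x] H(4)[of th] H(4)[of w] unfolding gam_def by linarith
    qed
    finally show ?thesis .
  qed
  have "smooth (\<lambda>v :: real \<times> real \<times> real. H (fst v) + (H (fst (snd v)) + H (snd (snd v))))"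
    by (intro smooth_add H(1) bounded_linear_fst bounded_linear_compose[OF bounded_linear_fst bounded_linear_snd]
      bounded_linear_compose[OF bounded_linear_snd bounded_linear_snd])
  moreover have "(\<lambda>(x, th, w). gam x th w) = (\<lambda>v. H (fst v) + (H (fst (snd v)) + H (snd (snd v))))"
    by (auto simp: gam_def)
  ultimately have sm: "smooth (\<lambda>(x, th, w). gam x th w)" by simp
  have gamc: "continuous_on UNIV (\<lambda>(x, th, w). gam x th w)"
    unfolding gam_def split_beta
    by (intro continuous_intros continuous_on_compose2[OF Hc[of UNIV]] subset_UNIV)
  show ?thesis
  proof (rule that[of rho rho' E gam])
    show "1 \<le> gam x th w" for x th w
      using H(4)[of x] H(4)[of th] H(4)[of w] unfolding gam_def by linarith
    show "(m2 x)\<^sup>2 \<le> rho x" "\<phi> x \<le> rho x" for x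
      using rho(5)[of x] \<phi>(2)[of x] zero_le_power2[of "m2 x"] by linarith+
    show "(bbar * th * (rho x + x * rho' x))\<^sup>2 \<le> gam x th w"
      "bbar * (\<bar>w\<bar> + \<bar>th * rho x * x\<bar>) \<le> gam x th w"
      "((1 + th\<^sup>2) * E (2 * (2 * \<bar>w\<bar> + \<bar>th * rho x * x\<bar> + \<bar>x\<bar>)))\<^sup>2 \<le> gam x th w" for x th w
      using gam[of x th w] g0[of "(x, th, w)"] unfolding g_def g1_def g2_def g3_def prod.case by linarith+
  qed (use rho E sm gamc in auto)
qed

theorem theoremV2:
  fixes bbar lam :: real
    and alow aup alpha sigma :: "real \<Rightarrow> real"
    and m1 :: "real ^ 'p \<Rightarrow> real" and m2 :: "real \<Rightarrow> real"
  assumes "lam > 0"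
    and "C_k 1 m1" and "\<And>z. m1 z > 0"
    and "C_k 1 m2" and "\<And>x. m2 x > 0"
    and "Limsup (at_right 0) (\<lambda>s. ereal (s\<^sup>2 / alpha s)) < \<infinity>"
  shows "\<exists>(rho :: real \<Rightarrow> real) (gam :: real \<Rightarrow> real \<Rightarrow> real \<Rightarrow> real).
    smooth rho \<and> (\<forall>x. rho x > 0) \<and>
    smooth (\<lambda>(x, th, w). gam x th w) \<and> (\<forall>x th w. gam x th w > 0) \<and>
    (\<forall>(D :: (real ^ 'l) set)
      (q :: real ^ 'p \<Rightarrow> real \<Rightarrow> real ^ 'l \<Rightarrow> real ^ 'p)
      (f :: real ^ 'p \<Rightarrow> real \<Rightarrow> real ^ 'l \<Rightarrow> real)
      (V :: real ^ 'p \<Rightarrow> real) b c pbar.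
      compact D \<and>
      C_k 1 (\<lambda>(z, x, d). q z x d) \<and> C_k 1 (\<lambda>(z, x, d). f z x d) \<and>
      (\<forall>d\<in>D. q 0 0 d = 0 \<and> f 0 0 d = 0) \<and>
      c > 0 \<and> (\<forall>z x. \<forall>d\<in>D. \<bar>f z x d\<bar> \<le> c * m1 z * norm z + c * m2 x * \<bar>x\<bar>) \<and>
      0 < b \<and> b \<le> bbar \<and>
      ISS_Lyapunov V alow aup alpha (\<lambda>s. pbar * sigma s) q D \<and>
      Limsup (at_right 0) (\<lambda>s. ereal (pbar * sigma s / s\<^sup>2)) < \<infinity>
      \<longrightarrow>
      (\<forall>d. admissible D d \<longrightarrow>
         globally_asymptotically_stable q f b lam rho gam d \<and>
         Zeno_free q f b lam rho gam d))"
proof (cases "0 < bbar \<and> class_Kinf alow \<and> class_Kinf aup \<and> class_Kinf alpha \<and>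
    (\<exists>p0. class_Kinf (\<lambda>s. p0 * sigma s) \<and> Limsup (at_right 0) (\<lambda>s. ereal (p0 * sigma s / s\<^sup>2)) < \<infinity>)")
  \<comment> \<open>These conditions on the known data are imposed only inside the quantifier over
    plants. If they fail there is no admissible plant, and constant functions will do.\<close>
  case False
  show ?thesis
  proof (intro exI[of _ "\<lambda>_. 1"] exI[of _ "\<lambda>_ _ _. 1"] conjI allI impI)
    show "smooth (\<lambda>_ :: real. 1 :: real)" by (rule smooth_const)
    show "smooth (\<lambda>(x :: real, th :: real, w :: real). 1 :: real)"
    proof -
      have "(\<lambda>(x :: real, th :: real, w :: real). 1 :: real) = (\<lambda>_. 1)" by auto
      then show ?thesis by (simp only: smooth_const)
    qed
  qed (use False in \<open>auto simp: ISS_Lyapunov_def\<close>)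
next
  \<comment> \<open>\<open>p0\<close> is any factor admissible for \<open>sigma\<close>. It serves
    to read off the local behaviour of \<open>sigma\<close> before the plant, which later comes with
    its own \<open>pbar\<close>, is given.\<close>
  case True
  then obtain p0 where bbar: "0 < bbar" and K: "class_Kinf alow" "class_Kinf aup" "class_Kinf alpha"
    "class_Kinf (\<lambda>s. p0 * sigma s)" and lim: "Limsup (at_right 0) (\<lambda>s. ereal (p0 * sigma s / s\<^sup>2)) < \<infinity>"
    by blast
  obtain \<phi> a2 where \<phi>: "\<And>n::nat. bdd_above (\<phi> ` {- real n..real n})" "\<And>x. 0 \<le> \<phi> x"
    and a2: "continuous_on {0..} a2" "a2 0 = 0" "mono_on {0..} a2"
    and supp: "\<forall>V q (D :: (real ^ 'l) set) p. ISS_Lyapunov V alow aup alpha (\<lambda>s. p * sigma s) q D \<longrightarrow>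
      (\<exists>U p'. 0 \<le> p' \<and> (\<forall>z. U differentiable (at z)) \<and>
        (\<forall>z. alow (norm z) \<le> U z \<and> U z \<le> a2 (norm z)) \<and>
        (\<forall>z x d. d \<in> D \<longrightarrow> frechet_derivative U (at z) (q z x d)
          \<le> - (m1 z * norm z)\<^sup>2 + p' * (\<phi> x * x\<^sup>2)))"
    by (rule change_of_supply[OF K assms(6) lim C_k_1D(3)[OF assms(2)]]) (rule that, assumption+)
  obtain rho rho' gam E where smooth: "smooth rho" "smooth (\<lambda>(x, th, w). gam x th w)"
    and rho: "\<And>x. (rho has_real_derivative rho' x) (at x)" "continuous_on UNIV rho'"
      "\<And>x. 1 \<le> rho x" "\<And>x. (m2 x)\<^sup>2 \<le> rho x" "\<And>x. \<phi> x \<le> rho x"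
    and E: "\<And>x y :: real. \<bar>x\<bar> \<le> \<bar>y\<bar> \<Longrightarrow> E x \<le> E y" "\<And>x. 1 \<le> (E x :: real)"
      "\<And>x. (1 + \<bar>rho x + x * rho' x\<bar>) * (1 + m2 x + rho x) * (1 + rho x * x\<^sup>2) \<le> E x"
    and gam: "continuous_on UNIV (\<lambda>(x, th, w). gam x th w)" "\<And>x th w. 1 \<le> gam x th w"
      "\<And>x th w. (bbar * th * (rho x + x * rho' x))\<^sup>2 \<le> gam x th w"
      "\<And>x th w. bbar * (\<bar>w\<bar> + \<bar>th * rho x * x\<bar>) \<le> gam x th w"
      "\<And>x th w. ((1 + th\<^sup>2) * E (2 * (2 * \<bar>w\<bar> + \<bar>th * rho x * x\<bar> + \<bar>x\<bar>)))\<^sup>2 \<le> gam x th w"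
    using design_functions[OF C_k_1D(3)[OF assms(4)] \<phi> less_imp_le[OF bbar]] by metis
  show ?thesis
  proof (intro exI[of _ rho] exI[of _ gam] conjI allI impI)
    show "smooth rho" "smooth (\<lambda>(x, th, w). gam x th w)" by (rule smooth)+
    show "0 < rho x" for x using rho(3)[of x] by linarith
    show "0 < gam x th w" for x th w using gam(2)[of x th w] by linarith
    fix D :: "(real ^ 'l) set" and q f and V :: "real ^ 'p \<Rightarrow> real" and b c pbar d
    assume plant: "compact D \<and>
      C_k 1 (\<lambda>(z, x, d). q z x d) \<and> C_k 1 (\<lambda>(z, x, d). f z x d) \<and>
      (\<forall>d\<in>D. q 0 0 d = 0 \<and> f 0 0 d = 0) \<and>
      c > 0 \<and> (\<forall>z x. \<forall>d\<in>D. \<bar>f z x d\<bar> \<le> c * m1 z * norm z + c * m2 x * \<bar>x\<bar>) \<and>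
      0 < b \<and> b \<le> bbar \<and>
      ISS_Lyapunov V alow aup alpha (\<lambda>s. pbar * sigma s) q D \<and>
      Limsup (at_right 0) (\<lambda>s. ereal (pbar * sigma s / s\<^sup>2)) < \<infinity>"
      and d: "admissible D d"
    obtain U p' where U: "0 \<le> p'" "\<And>z. U differentiable (at z)" "\<And>z. alow (norm z) \<le> U z"
      "\<And>z. U z \<le> a2 (norm z)"
      "\<And>z x d. d \<in> D \<Longrightarrow> frechet_derivative U (at z) (q z x d) \<le> - (m1 z * norm z)\<^sup>2 + p' * (\<phi> x * x\<^sup>2)"
      using supp[rule_format, of V pbar q D] plant by blast
    have P: "compact D" "C_k 1 (\<lambda>(z, x, d). q z x d)" "C_k 1 (\<lambda>(z, x, d). f z x d)" "0 \<le> c"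
      "\<And>z x d. d \<in> D \<Longrightarrow> \<bar>f z x d\<bar> \<le> c * m1 z * norm z + c * m2 x * \<bar>x\<bar>" "0 < b" "b \<le> bbar"
      using plant by auto
    interpret closed_loop q f D d b lam c p' bbar rho rho' gam E m1 m2 U alow a2
    proof
      show "frechet_derivative U (at z) (q z x d) \<le> - (m1 z * norm z)\<^sup>2 + p' * (rho x * x\<^sup>2)"
        if "d \<in> D" for z x d
      proof -
        have "p' * (\<phi> x * x\<^sup>2) \<le> p' * (rho x * x\<^sup>2)"
          using U(1) rho(5) by (intro mult_left_mono mult_right_mono) auto
        then show ?thesis using U(5)[OF that, of z x] by linarith
      qed
      show "continuous_on UNIV m1" "continuous_on UNIV m2" using C_k_1D(3) assms(2,4) by blast+
    qed (fact assms(1,3,5) P d rho(1-4) E gam U(1-4) K(1) a2)+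
    show "globally_asymptotically_stable q f b lam rho gam d" "Zeno_free q f b lam rho gam d"
      using stabilised by blast+
  qed
qed

end
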